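(* Let $\mu\ge 0$, $L>0$, let $W_L$ be a weight function on $[0,L]$, let $m\ge 0$ be an integer, and let $\phi_\nu=\frac{2\nu\pi}{2m+1}$ for $0\le\nu\le 2m$. Then for every $f\in L^2(W_{\mu,L};B_L)$ and $\mathbf x=(x_1,x_2,x_3)\in B_L$, $$S_{2m,L}^\mu f(\mathbf x)=\frac{1}{2m+1}\sum_{\nu=0}^{2m}a_\mu\int_{-1}^1\int_0^L\mathcal R_{\phi_\nu}^\mu(f(\cdot,\cdot,w);t)\,\Phi_{2m}^\mu(\phi_\nu,w,t;\mathbf x)\,W_L(w)\,dw\,dt,$$ where $$\Phi_{2m}^\mu(\xi,w,t;\mathbf x)=\sum_{k=0}^{2m}D_k^{\mu+1/2}(\xi,t;x_1,x_2)\sum_{l=0}^{2m-k}p_l(w)\,p_l(x_3).$$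
   Context: $B^2$ is the closed unit disk in $\mathbb R^2$; $W_\mu(x,y)=(1-x^2-y^2)^{\mu-1/2}$; $a_\mu=(\mu+1/2)/\pi=1/\int_{B^2}W_\mu$. $B_L=B^2\times[0,L]$ and $W_{\mu,L}(x,y,z)=W_\mu(x,y)W_L(z)$, where $W_L$ is a weight function on $[0,L]$ (nonnegative, with finite moments and $\int_0^Lp^2W_L>0$ for every nonzero polynomial $p$). $p_k$ is the polynomial of degree $k$, with positive leading coefficient, such that $\int_0^Lp_kp_lW_L\,dz=\delta_{k,l}$. $\mathcal V_k^2(W_\mu)$ is the space of polynomials in two variables of degree $k$ (together with $0$) orthogonal to all polynomials of degree $<k$ under $\langle P,Q\rangle_\mu=a_\mu\int_{B^2}PQW_\mu\,dx\,dy$. Partial sum operator: let $\{P_j^k:0\le j\le k\}$ be any orthonormal basis of $\mathcal V_k^2(W_\mu)$ and $P_{l,k,j}^\mu(x,y,z)=P_j^k(x,y)p_{l-k}(z)$; then $$S_{n,L}^\mu f=\sum_{l=0}^n\sum_{k=0}^l\sum_{j=0}^k\widehat f_{l,k,j}^{\,\mu}P_{l,k,j}^\mu,\qquad\widehat f_{l,k,j}^{\,\mu}=a_\mu\int_{B_L}f\,P_{l,k,j}^\mu\,W_{\mu,L}\,d\mathbf x .$$ For a function $g$ on $B^2$, $$\mathcal R_\theta^\mu(g;t)=\int_{-\sqrt{1-t^2}}^{\sqrt{1-t^2}}g(t\cos\theta-s\sin\theta,\,t\sin\theta+s\cos\theta)\,(1-s^2-t^2)^{\mu-1/2}\,ds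 .$$ $(a)_k=a(a+1)\cdots(a+k-1)$. $C_k^\lambda$ is the Gegenbauer polynomial of degree $k$, orthogonal for $(1-s^2)^{\lambda-1/2}$ on $[-1,1]$, with $C_k^\lambda(1)=(2\lambda)_k/k!$. $p_l^{(\alpha,\beta)}$ is the Jacobi polynomial of degree $l$ with positive leading coefficient, orthonormal for $(1-t)^\alpha(1+t)^\beta$ normalized to integral $1$ on $[-1,1]$. A specific orthonormal basis of $\mathcal V_k^2(W_\mu)$: with $x=r\cos\phi$, $y=r\sin\phi$, $$P_{l,\varepsilon}^k(x,y)=h_{l,k}\,p_l^{(\mu-1/2,\,k-2l)}(2r^2-1)\,r^{k-2l}S_{k-2l,\varepsilon}(\phi),$$ $S_{j,0}(\phi)=\cos j\phi$, $S_{j,1}(\phi)=\sin j\phi$, $0\le 2l\le k$ if $\varepsilon=0$, $0\le 2l\le k-1$ if $\varepsilon=1$, $$h_{l,k}^2=\frac1{d_{l,k}}\,\frac{\Gamma(k-2l+\mu+3/2)}{\Gamma(\mu+3/2)\Gamma(k-2l+1)},\quad h_{l,k}>0,\qquad d_{l,k}=\tfrac12\ (2l<k),\ d_{l,k}=1\ (2l=k).$$ $$\lambda_{l,k}^\mu=\frac{l!\,(k-l)!\,(k-l+\mu+\frac12)}{(\mu+\frac12)_l(\mu+\frac32)_{k-l}(k+\mu+\frac12)},\qquad D_k^{\mu+1/2}(\xi;x,y)=\sum_{l,\varepsilon}\lambda_{l,k}^\mu P_{l,\varepsilon}^k(\cos\xi,\sin\xi)P_{l,\varepsilon}^k(x,y)$$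 (all admissible $(l,\varepsilon)$), and $$D_k^{\mu+1/2}(\xi,t;x,y)=\frac{k+\mu+1/2}{\mu+1/2}\,C_k^{\mu+1/2}(t)\,D_k^{\mu+1/2}(\xi;x,y).$$ *)

theory Defs
  imports "HOL-Analysis.Analysis"
begin

section \<open>Orthogonal polynomials in one variable\<close>

definition weight_function_on :: "real \<Rightarrow> real \<Rightarrow> (real \<Rightarrow> real) \<Rightarrow> bool" where
  "weight_function_on a b w \<longleftrightarrow>
     (\<forall>z\<in>{a..b}. 0 \<le> w z) \<and>
     (\<forall>k::nat. set_integrable lebesgue {a..b} (\<lambda>z. z ^ k * w z)) \<and>
     (\<forall>p::real poly. p \<noteq> 0 \<longrightarrow> 0 < (LINT z:{a..b}|lebesgue. (poly p z)\<^sup>2 * w z))"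

definition orthonormal_polys :: "real \<Rightarrow> real \<Rightarrow> (real \<Rightarrow> real) \<Rightarrow> nat \<Rightarrow> real poly" where
  "orthonormal_polys a b w =
     (THE p. \<forall>k. degree (p k) = k \<and> 0 < lead_coeff (p k) \<and>
        (\<forall>l. (LINT z:{a..b}|lebesgue. poly (p k) z * poly (p l) z * w z) = (if k = l then 1 else 0)))"

definition gegenbauer :: "real \<Rightarrow> nat \<Rightarrow> real poly" where
  "gegenbauer lam =
     (THE C. \<forall>k. degree (C k) = k \<and> poly (C k) 1 = pochhammer (2 * lam) k / fact k \<and>
        (\<forall>l. l \<noteq> k \<longrightarrow>
           (LINT s:{-1..1}|lebesgue. poly (C k) s * poly (C l) s * (1 - s\<^sup>2) powr (lam - 1/2)) = 0))"

definition jacobi_weight :: "real \<Rightarrow> real \<Rightarrow> real \<Rightarrow> real" where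
  "jacobi_weight \<alpha> \<beta> t = (1 - t) powr \<alpha> * (1 + t) powr \<beta>"

definition jacobi :: "real \<Rightarrow> real \<Rightarrow> nat \<Rightarrow> real poly" where
  "jacobi \<alpha> \<beta> = orthonormal_polys (-1) 1
     (\<lambda>t. jacobi_weight \<alpha> \<beta> t / (LINT u:{-1..1}|lebesgue. jacobi_weight \<alpha> \<beta> u))"


section \<open>Orthogonal polynomials on the unit disk\<close>

text \<open>The closed unit disk is \<open>cball 0 1\<close> in \<open>real \<times> real\<close>, whose norm is Euclidean.  Polynomials
  in two variables are represented by the functions they induce on the plane.\<close>

definition bipolys :: "nat \<Rightarrow> (real \<times> real \<Rightarrow> real) set" where
  "bipolys n = {Q. \<exists>c::nat \<Rightarrow> nat \<Rightarrow> real. Q = (\<lambda>(x, y). \<Sum>i\<le>n. \<Sum>j\<le>n - i. c i j * x ^ i * y ^ j)}"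

definition has_total_degree :: "nat \<Rightarrow> (real \<times> real \<Rightarrow> real) \<Rightarrow> bool" where
  "has_total_degree n Q \<longleftrightarrow> Q \<in> bipolys n \<and> (\<forall>m<n. Q \<notin> bipolys m) \<and> Q \<noteq> (\<lambda>_. 0)"

definition disk_weight :: "real \<Rightarrow> real \<times> real \<Rightarrow> real" where
  "disk_weight \<mu> = (\<lambda>(x, y). (1 - x\<^sup>2 - y\<^sup>2) powr (\<mu> - 1/2))"

definition disk_const :: "real \<Rightarrow> real" where
  "disk_const \<mu> = (\<mu> + 1/2) / pi"

definition disk_inner :: "real \<Rightarrow> (real \<times> real \<Rightarrow> real) \<Rightarrow> (real \<times> real \<Rightarrow> real) \<Rightarrow> real" where
  "disk_inner \<mu> P Q = disk_const \<mu> * (LINT v:cball 0 1|lebesgue. P v * Q v * disk_weight \<mu> v)"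

definition disk_orth_polys :: "real \<Rightarrow> nat \<Rightarrow> (real \<times> real \<Rightarrow> real) set" where
  "disk_orth_polys \<mu> k =
     {P. (has_total_degree k P \<or> P = (\<lambda>_. 0)) \<and> (\<forall>j<k. \<forall>Q\<in>bipolys j. disk_inner \<mu> P Q = 0)}"

definition disk_orthonormal_basis :: "real \<Rightarrow> nat \<Rightarrow> (nat \<Rightarrow> real \<times> real \<Rightarrow> real) \<Rightarrow> bool" where
  "disk_orthonormal_basis \<mu> k P \<longleftrightarrow>
     (\<forall>j\<le>k. P j \<in> disk_orth_polys \<mu> k) \<and>
     (\<forall>i\<le>k. \<forall>j\<le>k. disk_inner \<mu> (P i) (P j) = (if i = j then 1 else 0)) \<and>
     (\<forall>Q\<in>disk_orth_polys \<mu> k. \<exists>c::nat \<Rightarrow> real. Q = (\<lambda>v. \<Sum>j\<le>k. c j * P j v))"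

definition angular :: "nat \<Rightarrow> nat \<Rightarrow> real \<Rightarrow> real" where
  "angular j \<epsilon> \<phi> = (if \<epsilon> = 0 then cos (real j * \<phi>) else sin (real j * \<phi>))"

definition disk_basis_index :: "nat \<Rightarrow> (nat \<times> nat) set" where
  "disk_basis_index k = {(l, \<epsilon>). (\<epsilon> = 0 \<and> 2 * l \<le> k) \<or> (\<epsilon> = 1 \<and> 2 * l + 1 \<le> k)}"

definition disk_basis_coeff :: "real \<Rightarrow> nat \<Rightarrow> nat \<Rightarrow> real" where
  "disk_basis_coeff \<mu> l k =
     (let d = (if 2 * l < k then 1/2 else 1) in
      sqrt (1 / d * (Gamma (real (k - 2 * l) + \<mu> + 3/2) / (Gamma (\<mu> + 3/2) * Gamma (real (k - 2 * l) + 1)))))"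

definition disk_basis :: "real \<Rightarrow> nat \<Rightarrow> nat \<Rightarrow> nat \<Rightarrow> real \<times> real \<Rightarrow> real" where
  "disk_basis \<mu> k l \<epsilon> = (\<lambda>(x, y).
     let r = norm (x, y); \<phi> = Arg (Complex x y) in
     disk_basis_coeff \<mu> l k * poly (jacobi (\<mu> - 1/2) (real (k - 2 * l)) l) (2 * r\<^sup>2 - 1) *
       r ^ (k - 2 * l) * angular (k - 2 * l) \<epsilon> \<phi>)"


section \<open>Partial sums on the cylinder\<close>

definition cylinder :: "real \<Rightarrow> ((real \<times> real) \<times> real) set" where
  "cylinder L = cball 0 1 \<times> {0..L}"

definition cylinder_weight :: "real \<Rightarrow> (real \<Rightarrow> real) \<Rightarrow> (real \<times> real) \<times> real \<Rightarrow> real" where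
  "cylinder_weight \<mu> W = (\<lambda>(v, z). disk_weight \<mu> v * W z)"

definition cylinder_L2 :: "real \<Rightarrow> real \<Rightarrow> (real \<Rightarrow> real) \<Rightarrow> ((real \<times> real) \<times> real \<Rightarrow> real) set" where
  "cylinder_L2 \<mu> L W =
     {f. f \<in> borel_measurable (lebesgue_on (cylinder L)) \<and>
         set_integrable lebesgue (cylinder L) (\<lambda>u. (f u)\<^sup>2 * cylinder_weight \<mu> W u)}"

definition cylinder_poly ::
  "real \<Rightarrow> (real \<Rightarrow> real) \<Rightarrow> (nat \<Rightarrow> nat \<Rightarrow> real \<times> real \<Rightarrow> real) \<Rightarrow> nat \<Rightarrow> nat \<Rightarrow> nat \<Rightarrow>
     (real \<times> real) \<times> real \<Rightarrow> real" where
  "cylinder_poly L W P l k j = (\<lambda>(v, z). P k j v * poly (orthonormal_polys 0 L W (l - k)) z)"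

definition cylinder_coeff ::
  "real \<Rightarrow> real \<Rightarrow> (real \<Rightarrow> real) \<Rightarrow> (nat \<Rightarrow> nat \<Rightarrow> real \<times> real \<Rightarrow> real) \<Rightarrow>
     ((real \<times> real) \<times> real \<Rightarrow> real) \<Rightarrow> nat \<Rightarrow> nat \<Rightarrow> nat \<Rightarrow> real" where
  "cylinder_coeff \<mu> L W P f l k j =
     disk_const \<mu> * (LINT u:cylinder L|lebesgue. f u * cylinder_poly L W P l k j u * cylinder_weight \<mu> W u)"

text \<open>\<open>P k\<close> enumerates the chosen orthonormal basis of \<open>disk_orth_polys \<mu> k\<close>.\<close>

definition partial_sum ::
  "real \<Rightarrow> real \<Rightarrow> (real \<Rightarrow> real) \<Rightarrow> (nat \<Rightarrow> nat \<Rightarrow> real \<times> real \<Rightarrow> real) \<Rightarrow> nat \<Rightarrow>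
     ((real \<times> real) \<times> real \<Rightarrow> real) \<Rightarrow> (real \<times> real) \<times> real \<Rightarrow> real" where
  "partial_sum \<mu> L W P n f x =
     (\<Sum>l=0..n. \<Sum>k=0..l. \<Sum>j=0..k. cylinder_coeff \<mu> L W P f l k j * cylinder_poly L W P l k j x)"


section \<open>Radon projections and the reconstruction kernel\<close>

definition radon :: "real \<Rightarrow> real \<Rightarrow> (real \<times> real \<Rightarrow> real) \<Rightarrow> real \<Rightarrow> real" where
  "radon \<mu> \<theta> g t =
     (LINT s:{- sqrt (1 - t\<^sup>2)..sqrt (1 - t\<^sup>2)}|lebesgue.
        g (t * cos \<theta> - s * sin \<theta>, t * sin \<theta> + s * cos \<theta>) * (1 - s\<^sup>2 - t\<^sup>2) powr (\<mu> - 1/2))"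

definition ridge_factor :: "real \<Rightarrow> nat \<Rightarrow> nat \<Rightarrow> real" where
  "ridge_factor \<mu> l k =
     fact l * fact (k - l) * (real (k - l) + \<mu> + 1/2) /
     (pochhammer (\<mu> + 1/2) l * pochhammer (\<mu> + 3/2) (k - l) * (real k + \<mu> + 1/2))"

definition D_angle :: "real \<Rightarrow> nat \<Rightarrow> real \<Rightarrow> real \<times> real \<Rightarrow> real" where
  "D_angle \<mu> k \<xi> v =
     (\<Sum>(l, \<epsilon>)\<in>disk_basis_index k.
        ridge_factor \<mu> l k * disk_basis \<mu> k l \<epsilon> (cos \<xi>, sin \<xi>) * disk_basis \<mu> k l \<epsilon> v)"

definition D_kernel :: "real \<Rightarrow> nat \<Rightarrow> real \<Rightarrow> real \<Rightarrow> real \<times> real \<Rightarrow> real" where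
  "D_kernel \<mu> k \<xi> t v =
     (real k + \<mu> + 1/2) / (\<mu> + 1/2) * poly (gegenbauer (\<mu> + 1/2) k) t * D_angle \<mu> k \<xi> v"

definition Phi_kernel ::
  "real \<Rightarrow> real \<Rightarrow> (real \<Rightarrow> real) \<Rightarrow> nat \<Rightarrow> real \<Rightarrow> real \<Rightarrow> real \<Rightarrow> (real \<times> real) \<times> real \<Rightarrow> real" where
  "Phi_kernel \<mu> L W n \<xi> w t = (\<lambda>(v, z).
     \<Sum>k=0..n. D_kernel \<mu> k \<xi> t v *
       (\<Sum>l=0..n - k. poly (orthonormal_polys 0 L W l) w * poly (orthonormal_polys 0 L W l) z))"

end

theory Submission
  imports Defs
begin

text \<open>
  Write \<open>e\<^sub>\<xi> = (cos \<xi>, sin \<xi>)\<close> and \<open>\<lambda> = \<mu> + 1/2\<close>.  The ridge polynomial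
  \<open>g\<^sub>\<xi>(v) = (k + \<lambda>)/\<lambda> C\<^sub>k\<^sup>\<lambda>(v \<bullet> e\<^sub>\<xi>)\<close> lies in \<open>V\<^sub>k\<close> and reproduces the values of elements of
  \<open>V\<^sub>k\<close> at \<open>e\<^sub>\<xi>\<close>, because integrating out the direction orthogonal to \<open>e\<^sub>\<xi>\<close> reduces the disk inner
  product to Gegenbauer orthogonality.  Expanding \<open>C\<^sub>k\<^sup>\<lambda>(r cos \<theta>)\<close> in cosines produces exactly the
  Jacobi radial parts of the basis \<open>P\<^sub>l\<^sub>,\<^sub>\<epsilon>\<close>; since \<open>2 m + 1\<close> equidistant angles separate the frequencies
  of equal parity up to \<open>2 m\<close>, averaging \<open>g\<^sub>\<xi>(v) P\<^sub>l\<^sub>,\<^sub>\<epsilon>(e\<^sub>\<xi>)\<close> over them gives back \<open>P\<^sub>l\<^sub>,\<^sub>\<epsilon>(v)\<close> up to the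
  ridge factor.  So \<open>V\<^sub>k\<close> contains the \<open>P\<^sub>l\<^sub>,\<^sub>\<epsilon>\<close>, and the average of \<open>g\<^sub>\<xi>(v)\<close> against
  \<open>D\<^sub>k(\<xi>; x)\<close> is \<open>\<Sum> P\<^sub>l\<^sub>,\<^sub>\<epsilon>(v) P\<^sub>l\<^sub>,\<^sub>\<epsilon>(x)\<close>.  This is the reproducing kernel of \<open>V\<^sub>k\<close>: it reproduces
  boundary values by the addition formula \<open>g\<^sub>\<xi> = \<Sum> P\<^sub>l\<^sub>,\<^sub>\<epsilon>(e\<^sub>\<xi>) P\<^sub>l\<^sub>,\<^sub>\<epsilon>\<close>, and an element of \<open>V\<^sub>k\<close>
  vanishing on the circle is divisible by \<open>1 - x\<^sup>2 - y\<^sup>2\<close>, hence zero by orthogonality.  The claim follows by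
  rotating the disk in each of the integrals.
\<close>

section \<open>Volume-preserving maps and Fubini for Lebesgue measure\<close>

text \<open>Three obstacles shape the development. \<open>gegenbauer\<close> and
  \<open>jacobi\<close> are definite descriptions, so explicit families (a three-term recurrence, a
  hypergeometric sum) are built and identified through a uniqueness argument for orthogonal
  families. The integrals are taken for complete Lebesgue measure and f is only Lebesgue measurable,
  so the slices on which \<open>radon\<close> acts are controlled merely almost everywhere; Fubini
  is applied to Borel representatives. Finally, the basis in \<open>partial_sum\<close> is arbitrary
  and must be related to \<open>disk_basis\<close>: both give the same reproducing kernel, and for
  \<open>disk_basis\<close> the reproducing property is tested on the circle, where the sum has a
  closed form. As for the constants, \<open>ridge_factor\<close> inverts the product of (k +
  \<lambda>) / \<lambda>, the value at 1 of the standard Jacobi polynomial and the factor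
  (\<lambda>)_(k-l) / (k-l)! of the cosine coefficients; \<open>disk_const\<close> gives the disk
  weight total mass one, which amounts to Legendre's duplication formula.\<close>

definition plane_rotation :: "real \<Rightarrow> real \<times> real \<Rightarrow> real \<times> real" where
  "plane_rotation \<theta> = (\<lambda>(t, s). (t * cos \<theta> - s * sin \<theta>, t * sin \<theta> + s * cos \<theta>))"

text \<open>Stated for Borel maps and \<open>lborel\<close>. Lebesgue measurable integrands are
  reduced to this case by almost everywhere equality with a Borel function.\<close>

definition volume_preserving :: "('a::euclidean_space \<Rightarrow> 'b::euclidean_space) \<Rightarrow> bool" where
  "volume_preserving T \<longleftrightarrow> T \<in> borel_measurable borel \<and> distr lborel borel T = lborel"

lemma volume_preservingI:
  assumes [measurable]: "T \<in> borel_measurable borel"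
    and eq: "\<And>g::'b \<Rightarrow> ennreal. g \<in> borel_measurable borel \<Longrightarrow>
      (\<integral>\<^sup>+x. g (T x) \<partial>lborel) = (\<integral>\<^sup>+y. g y \<partial>lborel)"
  shows "volume_preserving (T :: 'a::euclidean_space \<Rightarrow> 'b::euclidean_space)"
  unfolding volume_preserving_def
proof
  show "distr lborel borel T = lborel"
  proof (rule measure_eqI)
    fix A :: "'b set" assume "A \<in> sets (distr lborel borel T)"
    then have [measurable]: "A \<in> sets borel" by simp
    have "emeasure (distr lborel borel T) A = (\<integral>\<^sup>+y. indicator A y \<partial>distr lborel borel T)"
      by simp
    also have "\<dots> = (\<integral>\<^sup>+x. indicator A (T x) \<partial>lborel)"
      by (subst nn_integral_distr) auto
    also have "\<dots> = emeasure lborel A"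
      by (subst eq) auto
    finally show "emeasure (distr lborel borel T) A = emeasure lborel A" .
  qed simp
qed fact

lemma volume_preserving_comp:
  assumes "volume_preserving S" "volume_preserving T"
  shows "volume_preserving (S \<circ> T)"
proof -
  have [measurable]: "S \<in> borel_measurable borel" "T \<in> borel_measurable borel"
    using assms by (auto simp: volume_preserving_def)
  have "distr lborel borel (S \<circ> T) = distr (distr lborel borel T) borel S"
    by (subst distr_distr) auto
  also have "\<dots> = lborel"
    using assms by (simp add: volume_preserving_def)
  finally show ?thesis
    by (simp add: volume_preserving_def)
qed

lemma nn_integral_lborel_pair:
  fixes g :: "'a::euclidean_space \<times> 'b::euclidean_space \<Rightarrow> ennreal"
  assumes "g \<in> borel_measurable borel"
  shows "(\<integral>\<^sup>+z. g z \<partial>lborel) = (\<integral>\<^sup>+x. \<integral>\<^sup>+y. g (x, y) \<partial>lborel \<partial>lborel)"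
    and "(\<integral>\<^sup>+z. g z \<partial>lborel) = (\<integral>\<^sup>+y. \<integral>\<^sup>+x. g (x, y) \<partial>lborel \<partial>lborel)"
proof -
  have [measurable]: "g \<in> borel_measurable (lborel \<Otimes>\<^sub>M lborel)"
    using assms by (simp add: lborel_prod)
  show "(\<integral>\<^sup>+z. g z \<partial>lborel) = (\<integral>\<^sup>+x. \<integral>\<^sup>+y. g (x, y) \<partial>lborel \<partial>lborel)"
    by (subst lborel_prod[symmetric], subst lborel.nn_integral_fst[symmetric]) auto
  then show "(\<integral>\<^sup>+z. g z \<partial>lborel) = (\<integral>\<^sup>+y. \<integral>\<^sup>+x. g (x, y) \<partial>lborel \<partial>lborel)"
    by (subst lborel_pair.Fubini') auto
qed

text \<open>The order t, w, s is that of the iterated integral in the theorem: s belongs to the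
  Radon projection and is innermost, although it is a disk coordinate and w is not.\<close>

lemma volume_preserving_swap_args:
  "volume_preserving (\<lambda>(t, w, s). ((t, s), w) :: ('a::euclidean_space \<times> 'b::euclidean_space) \<times> 'c::euclidean_space)"
proof (rule volume_preservingI)
  show m: "(\<lambda>(t, w, s). ((t, s), w) :: ('a \<times> 'b) \<times> 'c) \<in> borel_measurable borel"
    unfolding split_beta
    by (intro borel_measurable_continuous_onI continuous_intros)
  fix g :: "('a \<times> 'b) \<times> 'c \<Rightarrow> ennreal" assume g: "g \<in> borel_measurable borel"
  have g_comp: "(\<lambda>x. g (h x)) \<in> borel_measurable borel" if "continuous_on UNIV h" for h :: "'d::topological_space \<Rightarrow> _"
    using measurable_compose[OF borel_measurable_continuous_onI[OF that] g] .
  have "(\<integral>\<^sup>+x. g (case x of (t, w, s) \<Rightarrow> ((t, s), w)) \<partial>lborel)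
      = (\<integral>\<^sup>+t. \<integral>\<^sup>+ws. g ((t, snd ws), fst ws) \<partial>lborel \<partial>lborel)"
    using measurable_compose[OF m g] by (subst nn_integral_lborel_pair(1)) (auto simp: split_beta)
  also have "\<dots> = (\<integral>\<^sup>+t. \<integral>\<^sup>+s. \<integral>\<^sup>+w. g ((t, s), w) \<partial>lborel \<partial>lborel \<partial>lborel)"
    by (subst nn_integral_lborel_pair(2)) (auto intro!: g_comp continuous_intros)
  also have "\<dots> = (\<integral>\<^sup>+v. \<integral>\<^sup>+w. g (v, w) \<partial>lborel \<partial>lborel)"
  proof (rule nn_integral_lborel_pair(1)[symmetric])
    have "sets (borel \<Otimes>\<^sub>M lborel) = sets (borel :: (('a \<times> 'b) \<times> 'c) measure)"
      by (metis borel_prod sets_lborel sets_pair_measure_cong)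
    then have "g \<in> borel_measurable (borel \<Otimes>\<^sub>M lborel)"
      using g measurable_cong_sets by blast
    then show "(\<lambda>v. \<integral>\<^sup>+w. g (v, w) \<partial>lborel) \<in> borel_measurable borel"
      by (rule lborel.borel_measurable_nn_integral_fst)
  qed
  also have "\<dots> = (\<integral>\<^sup>+y. g y \<partial>lborel)"
    by (rule nn_integral_lborel_pair(1)[symmetric]) fact
  finally show "(\<integral>\<^sup>+x. g (case x of (t, w, s) \<Rightarrow> ((t, s), w)) \<partial>lborel) = (\<integral>\<^sup>+y. g y \<partial>lborel)" .
qed

lemma volume_preserving_map_fst:
  fixes T :: "'a::euclidean_space \<Rightarrow> 'b::euclidean_space"
  assumes "volume_preserving T"
  shows "volume_preserving (\<lambda>(v, w::'c::euclidean_space). (T v, w))"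
proof (rule volume_preservingI)
  have [measurable]: "T \<in> borel_measurable borel"
    using assms by (simp add: volume_preserving_def)
  show m: "(\<lambda>(v, w::'c). (T v, w)) \<in> borel_measurable borel"
    by (simp add: borel_prod[symmetric])
  fix g :: "'b \<times> 'c \<Rightarrow> ennreal" assume [measurable]: "g \<in> borel_measurable borel"
  have [measurable]: "(\<lambda>v. g (v, w)) \<in> borel_measurable borel" for w
    by (rule measurable_compose[OF _ \<open>g \<in> borel_measurable borel\<close>])
      (intro borel_measurable_continuous_onI continuous_intros)
  have "(\<integral>\<^sup>+x. g (case x of (v, w) \<Rightarrow> (T v, w)) \<partial>lborel) = (\<integral>\<^sup>+w. \<integral>\<^sup>+v. g (T v, w) \<partial>lborel \<partial>lborel)"
    by (subst nn_integral_lborel_pair(2)) (use measurable_compose[OF m \<open>g \<in> borel_measurable borel\<close>] in simp_all)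
  also have "\<dots> = (\<integral>\<^sup>+w. \<integral>\<^sup>+v. g (v, w) \<partial>distr lborel borel T \<partial>lborel)"
    by (subst nn_integral_distr) auto
  also have "distr lborel borel T = lborel"
    using assms by (simp add: volume_preserving_def)
  finally show "(\<integral>\<^sup>+x. g (case x of (v, w) \<Rightarrow> (T v, w)) \<partial>lborel) = (\<integral>\<^sup>+y. g y \<partial>lborel)"
    by (subst (2) nn_integral_lborel_pair(2)) auto
qed

lemma nn_integral_shift_real:
  fixes g :: "real \<Rightarrow> ennreal"
  assumes "g \<in> borel_measurable borel"
  shows "(\<integral>\<^sup>+x. g (x + c) \<partial>lborel) = (\<integral>\<^sup>+x. g x \<partial>lborel)"
  using nn_integral_real_affine[OF assms, of 1 c] by (simp add: add.commute)

lemma volume_preserving_shear: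
  "volume_preserving (\<lambda>(x::real, y::real). (x + a * y, y))"
  "volume_preserving (\<lambda>(x::real, y::real). (x, y + a * x))"
proof -
  have slice[measurable]: "(\<lambda>x. g (x, y)) \<in> borel_measurable borel" "(\<lambda>y. g (x, y)) \<in> borel_measurable borel"
    if "g \<in> borel_measurable borel" for g :: "real \<times> real \<Rightarrow> ennreal" and x y
    by (rule measurable_compose[OF _ that], intro borel_measurable_continuous_onI continuous_intros)+
  have m1: "(\<lambda>(x::real, y::real). (x + a * y, y)) \<in> borel_measurable borel"
    and m2: "(\<lambda>(x::real, y::real). (x, y + a * x)) \<in> borel_measurable borel"
    unfolding split_beta by (intro borel_measurable_continuous_onI continuous_intros)+
  show "volume_preserving (\<lambda>(x::real, y::real). (x + a * y, y))"
  proof (rule volume_preservingI[OF m1])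
    fix g :: "real \<times> real \<Rightarrow> ennreal" assume [measurable]: "g \<in> borel_measurable borel"
    have "(\<integral>\<^sup>+z. g (case z of (x, y) \<Rightarrow> (x + a * y, y)) \<partial>lborel)
        = (\<integral>\<^sup>+y. \<integral>\<^sup>+x. g (x + a * y, y) \<partial>lborel \<partial>lborel)"
      by (subst nn_integral_lborel_pair(2)) (use measurable_compose[OF m1 \<open>g \<in> borel_measurable borel\<close>] in simp_all)
    also have "\<dots> = (\<integral>\<^sup>+y. \<integral>\<^sup>+x. g (x, y) \<partial>lborel \<partial>lborel)"
      by (subst nn_integral_shift_real) auto
    finally show "(\<integral>\<^sup>+z. g (case z of (x, y) \<Rightarrow> (x + a * y, y)) \<partial>lborel) = (\<integral>\<^sup>+z. g z \<partial>lborel)"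
      by (subst (2) nn_integral_lborel_pair(2)) auto
  qed
  show "volume_preserving (\<lambda>(x::real, y::real). (x, y + a * x))"
  proof (rule volume_preservingI[OF m2])
    fix g :: "real \<times> real \<Rightarrow> ennreal" assume [measurable]: "g \<in> borel_measurable borel"
    have "(\<integral>\<^sup>+z. g (case z of (x, y) \<Rightarrow> (x, y + a * x)) \<partial>lborel)
        = (\<integral>\<^sup>+x. \<integral>\<^sup>+y. g (x, y + a * x) \<partial>lborel \<partial>lborel)"
      by (subst nn_integral_lborel_pair(1)) (use measurable_compose[OF m2 \<open>g \<in> borel_measurable borel\<close>] in simp_all)
    also have "\<dots> = (\<integral>\<^sup>+x. \<integral>\<^sup>+y. g (x, y) \<partial>lborel \<partial>lborel)"
      by (subst nn_integral_shift_real) auto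
    finally show "(\<integral>\<^sup>+z. g (case z of (x, y) \<Rightarrow> (x, y + a * x)) \<partial>lborel) = (\<integral>\<^sup>+z. g z \<partial>lborel)"
      by (subst (2) nn_integral_lborel_pair(1)) auto
  qed
qed

lemma plane_rotation_add: "plane_rotation (\<alpha> + \<beta>) = plane_rotation \<alpha> \<circ> plane_rotation \<beta>"
  by (rule ext) (auto simp: plane_rotation_def cos_add sin_add algebra_simps)

text \<open>A rotation is a product of three shears, each of which is a translation in one variable.
  The shear parameter \<open>a\<close> equals - tan (\<theta> / 2), written as a quotient by sin
  \<theta>.\<close>

lemma volume_preserving_rotation_aux:
  assumes "sin \<theta> \<noteq> 0"
  shows "volume_preserving (plane_rotation \<theta>)"
proof -
  define a where "a = (cos \<theta> - 1) / sin \<theta>"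
  have a: "a * sin \<theta> = cos \<theta> - 1"
    using assms by (simp add: a_def)
  have "sin \<theta> * (a + a * cos \<theta>) = (cos \<theta> - 1) * (1 + cos \<theta>)"
    using a by algebra
  also have "\<dots> = sin \<theta> * (- sin \<theta>)"
    using sin_cos_squared_add[of \<theta>] by (simp add: algebra_simps power2_eq_square)
  finally have b: "a + a * cos \<theta> = - sin \<theta>"
    using mult_left_cancel[OF assms] by blast
  have "plane_rotation \<theta> = (\<lambda>(x, y). (x + a * y, y)) \<circ> ((\<lambda>(x, y). (x, y + sin \<theta> * x)) \<circ> (\<lambda>(x, y). (x + a * y, y)))"
  proof (rule ext, clarify)
    fix t s
    have "t * cos \<theta> - s * sin \<theta> = t + a * s + a * (s + sin \<theta> * (t + a * s))"
      using a b by algebra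
    moreover have "t * sin \<theta> + s * cos \<theta> = s + sin \<theta> * (t + a * s)"
      using a by algebra
    ultimately show "plane_rotation \<theta> (t, s) =
        ((\<lambda>(x, y). (x + a * y, y)) \<circ> ((\<lambda>(x, y). (x, y + sin \<theta> * x)) \<circ> (\<lambda>(x, y). (x + a * y, y)))) (t, s)"
      by (simp add: plane_rotation_def)
  qed
  then show ?thesis
    by (simp add: volume_preserving_comp volume_preserving_shear)
qed

lemma volume_preserving_rotation: "volume_preserving (plane_rotation \<theta>)"
proof (cases "sin \<theta> = 0")
  case True
  \<comment> \<open>A rotation with vanishing sine is the product of two rotations whose sines do
    not vanish, one of them by a right angle.\<close>
  then have "sin (\<theta> - pi/2) \<noteq> 0"
    using sin_zero_abs_cos_one[of \<theta>] by (auto simp: sin_diff)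
  then show ?thesis
    using plane_rotation_add[of "\<theta> - pi/2" "pi/2"]
    by (simp add: volume_preserving_comp volume_preserving_rotation_aux)
qed (rule volume_preserving_rotation_aux)

section \<open>Fubini for the completed measure through Borel representatives\<close>

text \<open>Completeness is the point: the exceptional set lies in a null set, and all subsets of a
  null set are Lebesgue measurable.\<close>

lemma lebesgue_measurable_AE_eq:
  fixes h g :: "'a::euclidean_space \<Rightarrow> real"
  assumes [measurable]: "g \<in> borel_measurable borel" and ae: "AE x in lborel. h x = g x"
  shows "h \<in> borel_measurable lebesgue"
proof (rule measurableI)
  have g: "g \<in> borel_measurable lebesgue"
    by (rule measurable_completion) simp
  fix A :: "real set" assume "A \<in> sets borel"
  then have A: "g -` A \<in> sets lebesgue"
    using measurable_sets[OF g] by fastforce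
  obtain N where N: "N \<in> null_sets lborel" "{x. h x \<noteq> g x} \<subseteq> N"
    using ae by (auto simp: eventually_ae_filter)
  have nl: "X \<in> sets lebesgue" if "X \<subseteq> N" for X
    using N that by (meson null_sets_completionI null_sets_completion_subset null_setsD2)
  have "h -` A = (g -` A - {x. h x \<noteq> g x}) \<union> (h -` A \<inter> {x. h x \<noteq> g x})" by auto
  also have "\<dots> \<in> sets lebesgue"
    using N by (intro sets.Un sets.Diff A nl) auto
  finally show "h -` A \<inter> space lebesgue \<in> sets lebesgue" by simp
qed simp

text \<open>Made for iterated integrals: an inner integral is known only for almost every outer
  variable, and the measurability of h comes out of the comparison with g instead of being
  assumed.\<close>

lemma lebesgue_integral_eq_lborelI:
  fixes h g :: "'a::euclidean_space \<Rightarrow> real"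
  assumes g: "g \<in> borel_measurable borel" and ae: "AE x in lborel. h x = g x"
  shows "integral\<^sup>L lebesgue h = integral\<^sup>L lborel g"
    and "integrable lebesgue h \<longleftrightarrow> integrable lborel g"
proof -
  note h = lebesgue_measurable_AE_eq[OF assms]
  have g': "g \<in> borel_measurable lebesgue"
    by (rule measurable_completion) (use g in simp)
  have "integral\<^sup>L lebesgue h = integral\<^sup>L lebesgue g"
    by (rule integral_cong_AE[OF h g' AE_completion[OF ae]])
  also have "\<dots> = integral\<^sup>L lborel g"
    by (rule integral_completion) (use g in simp)
  finally show "integral\<^sup>L lebesgue h = integral\<^sup>L lborel g" .
  have "integrable lebesgue h \<longleftrightarrow> integrable lebesgue g"
    by (rule integrable_cong_AE[OF h g' AE_completion[OF ae]])
  also have "\<dots> \<longleftrightarrow> integrable lborel g"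
    by (rule integrable_completion) (use g in simp)
  finally show "integrable lebesgue h \<longleftrightarrow> integrable lborel g" .
qed

lemma lebesgue_integrableE:
  fixes F :: "'a::euclidean_space \<Rightarrow> real"
  assumes "integrable lebesgue F"
  obtains g where "g \<in> borel_measurable borel" "AE x in lborel. F x = g x" "integrable lborel g"
proof -
  obtain g where g: "g \<in> borel_measurable borel" "AE x in lborel. F x = g x"
    using completion_ex_borel_measurable_real[of F lborel] assms by auto
  then show thesis
    using that lebesgue_integral_eq_lborelI(2)[OF g] assms by simp
qed

lemma lebesgue_Fubini_volume_preserving:
  fixes F :: "'c::euclidean_space \<Rightarrow> real" and T :: "'a::euclidean_space \<times> 'b::euclidean_space \<Rightarrow> 'c"
  assumes F: "integrable lebesgue F" and T: "volume_preserving T"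
  obtains g :: "'a \<times> 'b \<Rightarrow> real" where "g \<in> borel_measurable borel" "integrable lborel g"
    "integral\<^sup>L lebesgue F = integral\<^sup>L lborel g" "AE z in lborel. F (T z) = g z"
proof -
  have [measurable]: "T \<in> borel_measurable borel" and dT: "distr lborel borel T = lborel"
    using T by (auto simp: volume_preserving_def)
  obtain G where [measurable]: "G \<in> borel_measurable borel" and ae: "AE x in lborel. F x = G x"
    and G: "integrable lborel G"
    using lebesgue_integrableE[OF F] .
  show thesis
  proof (rule that[of "\<lambda>z. G (T z)"])
    show "integrable lborel (\<lambda>z. G (T z))"
      using G integrable_distr_eq[of T lborel borel G] by (simp add: dT)
    show "integral\<^sup>L lebesgue F = (\<integral>z. G (T z) \<partial>lborel)"
      using integral_distr[of T lborel borel G] lebesgue_integral_eq_lborelI(1)[OF _ ae] by (simp add: dT)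
    obtain N where N: "N \<in> null_sets lborel" "{x. F x \<noteq> G x} \<subseteq> N"
      using ae by (auto simp: eventually_ae_filter)
    then have [measurable]: "N \<in> sets borel" by auto
    \<comment> \<open>Null sets pull back to null sets under T, because the image measure of T is
      again \<open>lborel\<close>.\<close>
    have "AE y in distr lborel borel T. y \<notin> N"
      unfolding dT using N(1) by (rule AE_not_in)
    then have "AE z in lborel. T z \<notin> N"
      by (subst (asm) AE_distr_iff) auto
    then show "AE z in lborel. F (T z) = G (T z)"
      using N(2) by auto
  qed simp
qed

lemma AE_lborel_pairD:
  fixes P :: "'a::euclidean_space \<times> 'b::euclidean_space \<Rightarrow> bool"
  assumes "AE z in lborel. P z"
  shows "AE x in lborel. AE y in lborel. P (x, y)"
  using assms unfolding lborel_prod[symmetric] by (rule lborel_pair.AE_pair)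

lemma lborel_Fubini:
  fixes g :: "'a::euclidean_space \<times> 'b::euclidean_space \<Rightarrow> real"
  assumes "integrable lborel g"
  shows "(\<integral>x. \<integral>y. g (x, y) \<partial>lborel \<partial>lborel) = integral\<^sup>L lborel g"
  using lborel_pair.integral_fst'[of g] assms by (simp add: lborel_prod)

lemma slice_measurable:
  fixes g :: "'a::euclidean_space \<times> 'b::euclidean_space \<Rightarrow> real"
  assumes "g \<in> borel_measurable borel"
  shows "(\<lambda>y. g (x, y)) \<in> borel_measurable borel"
    and "(\<lambda>x. \<integral>y. g (x, y) \<partial>lborel) \<in> borel_measurable borel"
proof -
  have [measurable]: "g \<in> borel_measurable (lborel \<Otimes>\<^sub>M lborel)"
    using assms by (simp add: lborel_prod)
  show "(\<lambda>y. g (x, y)) \<in> borel_measurable borel"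
    using measurable_compose[OF _ assms] by (simp add: borel_prod[symmetric])
  show "(\<lambda>x. \<integral>y. g (x, y) \<partial>lborel) \<in> borel_measurable borel"
    using lborel.borel_measurable_lebesgue_integral[of "\<lambda>x y. g (x, y)" lborel] by simp
qed

lemma lebesgue_integral_plane_rotation:
  fixes F :: "real \<times> real \<Rightarrow> real"
  assumes "integrable lebesgue F"
  shows "integral\<^sup>L lebesgue F = (\<integral>t. \<integral>s. F (plane_rotation \<theta> (t, s)) \<partial>lebesgue \<partial>lebesgue)"
proof -
  obtain g where g[measurable]: "g \<in> borel_measurable borel" "integrable lborel g"
    "integral\<^sup>L lebesgue F = integral\<^sup>L lborel g"
    and ae: "AE z in lborel. F (plane_rotation \<theta> z) = g z"
    using lebesgue_Fubini_volume_preserving[OF assms volume_preserving_rotation] .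
  have "AE t in lborel. AE s in lborel. F (plane_rotation \<theta> (t, s)) = g (t, s)"
    using AE_lborel_pairD[OF ae] .
  then have "AE t in lborel. (\<integral>s. F (plane_rotation \<theta> (t, s)) \<partial>lebesgue) = (\<integral>s. g (t, s) \<partial>lborel)"
    by (rule AE_mp) (auto intro!: lebesgue_integral_eq_lborelI(1) slice_measurable)
  then show ?thesis
    unfolding g(3) lborel_Fubini[OF g(2), symmetric]
    by (intro lebesgue_integral_eq_lborelI(1)[symmetric] slice_measurable) auto
qed

lemma lebesgue_integral_rotated_cylinder:
  fixes F :: "(real \<times> real) \<times> real \<Rightarrow> real"
  assumes "integrable lebesgue F"
  shows "integral\<^sup>L lebesgue F =
    (\<integral>t. \<integral>w. \<integral>s. F (plane_rotation \<theta> (t, s), w) \<partial>lebesgue \<partial>lebesgue \<partial>lebesgue)"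
proof -
  define T :: "real \<times> real \<times> real \<Rightarrow> (real \<times> real) \<times> real"
    where "T = (\<lambda>(v, w). (plane_rotation \<theta> v, w)) \<circ> (\<lambda>(t, w, s). ((t, s), w))"
  have T: "volume_preserving T"
    unfolding T_def
    by (intro volume_preserving_comp volume_preserving_map_fst volume_preserving_rotation
        volume_preserving_swap_args)
  obtain g where g[measurable]: "g \<in> borel_measurable borel" "integrable lborel g"
    "integral\<^sup>L lebesgue F = integral\<^sup>L lborel g"
    and ae: "AE z in lborel. F (T z) = g z"
    using lebesgue_Fubini_volume_preserving[OF assms T] .
  have T_eq: "T (t, w, s) = (plane_rotation \<theta> (t, s), w)" for t w s
    by (simp add: T_def)
  have ae1: "AE t in lborel. AE ws in lborel. F (T (t, ws)) = g (t, ws)"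
    using AE_lborel_pairD[OF ae] .
  \<comment> \<open>Integrability of almost every slice in (w, s) permits the second use of Fubini,
    for fixed t.\<close>
  have ae2: "AE t in lborel. integrable lborel (\<lambda>ws. g (t, ws))"
    using lborel_pair.AE_integrable_fst'[of g] g(2) by (simp add: lborel_prod)
  from ae1 ae2 have "AE t in lborel. (\<integral>w. \<integral>s. F (plane_rotation \<theta> (t, s), w) \<partial>lebesgue \<partial>lebesgue)
      = (\<integral>ws. g (t, ws) \<partial>lborel)"
  proof eventually_elim
    case (elim t)
    have [measurable]: "(\<lambda>ws. g (t, ws)) \<in> borel_measurable borel"
      by (rule slice_measurable) simp
    have "AE w in lborel. AE s in lborel. F (T (t, w, s)) = g (t, w, s)"
      using AE_lborel_pairD[OF elim(1)] .
    then have "AE w in lborel. (\<integral>s. F (plane_rotation \<theta> (t, s), w) \<partial>lebesgue) = (\<integral>s. g (t, w, s) \<partial>lborel)"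
      by (rule AE_mp)
        (auto intro!: lebesgue_integral_eq_lborelI(1)
          slice_measurable[where g="\<lambda>ws. g (t, ws)"] simp: T_eq)
    then show ?case
      unfolding lborel_Fubini[OF elim(2), symmetric]
      by (intro lebesgue_integral_eq_lborelI(1) slice_measurable[where g="\<lambda>ws. g (t, ws)"]) auto
  qed
  then show ?thesis
    unfolding g(3) lborel_Fubini[OF g(2), symmetric]
    by (intro lebesgue_integral_eq_lborelI(1)[symmetric] slice_measurable) auto
qed

lemma AE_lborel_times:
  assumes "AE x in lborel. P x" "AE y in lborel. Q y"
  shows "AE z in lborel. P (fst (z :: 'a::euclidean_space \<times> 'b::euclidean_space)) \<and> Q (snd z)"
proof -
  obtain N where N: "N \<in> null_sets lborel" "{x. \<not> P x} \<subseteq> N"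
    using assms(1) by (auto simp: eventually_ae_filter)
  obtain N' where N': "N' \<in> null_sets lborel" "{y. \<not> Q y} \<subseteq> N'"
    using assms(2) by (auto simp: eventually_ae_filter)
  have "emeasure (lborel \<Otimes>\<^sub>M lborel) (N \<times> (UNIV :: 'b set)) = emeasure lborel N * emeasure lborel (UNIV :: 'b set)"
    using N(1) by (intro lborel.emeasure_pair_measure_Times) auto
  then have "N \<times> UNIV \<in> null_sets (lborel \<Otimes>\<^sub>M (lborel :: 'b measure))"
    using N(1) by (intro null_setsI) (auto simp: null_setsD1)
  moreover have "emeasure (lborel \<Otimes>\<^sub>M lborel) ((UNIV :: 'a set) \<times> N') = emeasure lborel (UNIV :: 'a set) * emeasure lborel N'"
    using N'(1) by (intro lborel.emeasure_pair_measure_Times) auto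
  then have "UNIV \<times> N' \<in> null_sets ((lborel :: 'a measure) \<Otimes>\<^sub>M lborel)"
    using N'(1) by (intro null_setsI) (auto simp: null_setsD1)
  ultimately have "N \<times> UNIV \<union> UNIV \<times> N' \<in> null_sets lborel"
    unfolding lborel_prod by (rule null_sets.Un)
  then show ?thesis
    by (rule AE_I') (use N(2) N'(2) in auto)
qed

lemma lebesgue_integrable_times:
  fixes f :: "'a::euclidean_space \<Rightarrow> real" and g :: "'b::euclidean_space \<Rightarrow> real"
  assumes "integrable lebesgue f" "integrable lebesgue g"
  shows "integrable lebesgue (\<lambda>z. f (fst z) * g (snd z))"
proof -
  obtain f' where [measurable]: "f' \<in> borel_measurable borel" and f': "AE x in lborel. f x = f' x" "integrable lborel f'"
    using lebesgue_integrableE[OF assms(1)] .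
  obtain g' where [measurable]: "g' \<in> borel_measurable borel" and g': "AE x in lborel. g x = g' x" "integrable lborel g'"
    using lebesgue_integrableE[OF assms(2)] .
  have "integrable (lborel \<Otimes>\<^sub>M lborel) (\<lambda>z. f' (fst z) * g' (snd z))"
  proof (rule lborel_pair.Fubini_integrable)
    show "integrable lborel (\<lambda>x. \<integral>y. norm (f' (fst (x, y)) * g' (snd (x, y))) \<partial>lborel)"
      using f'(2) by (simp add: abs_mult)
  qed (use f' g' in auto)
  then have "integrable lborel (\<lambda>z. f' (fst z) * g' (snd z))"
    by (simp add: lborel_prod)
  moreover have ae: "AE z in lborel. f (fst z) * g (snd z) = f' (fst z) * g' (snd z)"
    using AE_lborel_times[OF f'(1) g'(1)] by auto
  have "(\<lambda>z. f' (fst z) * g' (snd z)) \<in> borel_measurable borel"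
    by (simp add: borel_prod[symmetric])
  ultimately show ?thesis
    using lebesgue_integral_eq_lborelI(2)[OF _ ae] by simp
qed

section \<open>Gegenbauer polynomials\<close>

text \<open>Subtracting a multiple of G k removes the top coefficient and lowers the bound by one.
  The bound is put on coefficients instead of the degree so that k = 0 means p = 0.\<close>

lemma orthogonal_to_lower_degree:
  fixes \<Lambda> :: "real poly \<Rightarrow> real" and G :: "nat \<Rightarrow> real poly"
  assumes add: "\<And>p q. \<Lambda> (p + q) = \<Lambda> p + \<Lambda> q" and smult: "\<And>c p. \<Lambda> (smult c p) = c * \<Lambda> p"
    and G: "\<And>n. n < k \<Longrightarrow> degree (G n) = n" "\<And>n. n < k \<Longrightarrow> G n \<noteq> 0"
    and orth: "\<And>n. n < k \<Longrightarrow> \<Lambda> (q * G n) = 0"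
    and p: "\<And>i. i \<ge> k \<Longrightarrow> coeff p i = 0"
  shows "\<Lambda> (q * p) = 0"
  using G orth p
proof (induction k arbitrary: p)
  case 0
  then have "p = 0" by (intro poly_eqI) auto
  then show ?case using smult[of 0 0] by simp
next
  case (Suc k)
  define a where "a = coeff p k / lead_coeff (G k)"
  have dk: "degree (G k) = k" "coeff (G k) k \<noteq> 0"
    using Suc.prems(1,2)[of k] leading_coeff_0_iff[of "G k"] by auto
  have "\<Lambda> (q * (p - smult a (G k))) = 0"
  proof (rule Suc.IH)
    fix i assume "i \<ge> k"
    then show "coeff (p - smult a (G k)) i = 0"
    proof (cases "i = k")
      case True
      then show ?thesis using dk by (simp add: a_def)
    next
      case False
      then have "coeff (G k) i = 0" using dk \<open>i \<ge> k\<close> by (intro coeff_eq_0) auto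
      then show ?thesis using False \<open>i \<ge> k\<close> Suc.prems(4)[of i] by simp
    qed
  qed (use Suc.prems in auto)
  moreover have "q * p = q * (p - smult a (G k)) + smult a (q * G k)"
    by (simp add: algebra_simps)
  ultimately show ?case
    using Suc.prems(3)[of k] add smult by simp
qed

text \<open>If d had degree n, its product with G n would give a nonzero multiple of \<Lambda> (G n
  * G n), the lower terms of d being orthogonal to G n. Nonvanishing of these values takes the place
  of positivity of \<Lambda>.\<close>

lemma zero_if_orthogonal:
  fixes \<Lambda> :: "real poly \<Rightarrow> real" and G :: "nat \<Rightarrow> real poly"
  assumes add: "\<And>p q. \<Lambda> (p + q) = \<Lambda> p + \<Lambda> q" and smult: "\<And>c p. \<Lambda> (smult c p) = c * \<Lambda> p"
    and G: "\<And>n. degree (G n) = n" "\<And>n. G n \<noteq> 0"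
      "\<And>m n. m \<noteq> n \<Longrightarrow> \<Lambda> (G m * G n) = 0" "\<And>n. \<Lambda> (G n * G n) \<noteq> 0"
    and dk: "\<And>i. i \<ge> k \<Longrightarrow> coeff d i = 0" and orth: "\<And>n. n < k \<Longrightarrow> \<Lambda> (d * G n) = 0"
  shows "d = 0"
proof (rule ccontr)
  assume "d \<noteq> 0"
  define n where "n = degree d"
  have "n < k"
    using dk[of n] \<open>d \<noteq> 0\<close> by (metis n_def leading_coeff_0_iff not_le)
  define a where "a = lead_coeff d / lead_coeff (G n)"
  define r where "r = d - smult a (G n)"
  have "\<Lambda> (G n * r) = 0"
  proof (rule orthogonal_to_lower_degree[where k=n and G=G, OF add smult])
    fix i assume "n \<le> i"
    then show "coeff r i = 0"
      using G(1)[of n] G(2)[of n] leading_coeff_0_iff[of "G n"]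
      by (cases "i = n") (auto simp: r_def a_def n_def coeff_eq_0)
  qed (use G in auto)
  moreover have "d * G n = G n * r + smult a (G n * G n)"
    by (simp add: r_def algebra_simps)
  ultimately have "a * \<Lambda> (G n * G n) = 0"
    using orth[OF \<open>n < k\<close>] add smult by simp
  then show False using G(2)[of n] G(4)[of n] \<open>d \<noteq> 0\<close> by (simp add: a_def)
qed

text \<open>The difference d has lost its top coefficient and is orthogonal to every earlier G n, so
  it is zero. This resolves the definite descriptions of \<open>gegenbauer\<close> and
  \<open>jacobi\<close>.\<close>

lemma orthogonal_family_unique:
  fixes \<Lambda> :: "real poly \<Rightarrow> real" and G C :: "nat \<Rightarrow> real poly"
  assumes add: "\<And>p q. \<Lambda> (p + q) = \<Lambda> p + \<Lambda> q" and smult: "\<And>c p. \<Lambda> (smult c p) = c * \<Lambda> p"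
    and G: "\<And>n. degree (G n) = n" "\<And>n. G n \<noteq> 0"
      "\<And>m n. m \<noteq> n \<Longrightarrow> \<Lambda> (G m * G n) = 0" "\<And>n. \<Lambda> (G n * G n) \<noteq> 0"
    and C: "\<And>n. degree (C n) = n" "\<And>n. C n \<noteq> 0" "\<And>m n. m \<noteq> n \<Longrightarrow> \<Lambda> (C m * C n) = 0"
  shows "C k = smult (lead_coeff (C k) / lead_coeff (G k)) (G k)"
proof -
  define c where "c = lead_coeff (C k) / lead_coeff (G k)"
  define d where "d = C k - smult c (G k)"
  have dk: "coeff d i = 0" if "i \<ge> k" for i
  proof (cases "i = k")
    case True
    then show ?thesis using G(1)[of k] G(2)[of k] C(1)[of k] leading_coeff_0_iff[of "G k"]
      by (auto simp: d_def c_def)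
  next
    case False
    then show ?thesis using that G(1)[of k] C(1)[of k] by (simp add: d_def coeff_eq_0)
  qed
  have orth: "\<Lambda> (d * G n) = 0" if "n < k" for n
  proof -
    have "\<Lambda> (C k * G n) = 0"
    proof (rule orthogonal_to_lower_degree[where k=k and G=C, OF add smult])
      show "coeff (G n) i = 0" if "k \<le> i" for i
        using that \<open>n < k\<close> G(1)[of n] by (simp add: coeff_eq_0)
    qed (use C in auto)
    moreover have "d * G n = C k * G n + smult (- c) (G k * G n)"
      by (simp add: d_def algebra_simps)
    ultimately show ?thesis using G(3)[of k n] that by (simp only: add smult mult_zero_right add_0)
  qed
  have "d = 0"
    by (rule zero_if_orthogonal[where \<Lambda>=\<Lambda> and G=G, OF add smult G dk orth])
  then show ?thesis by (simp add: d_def c_def)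
qed

section \<open>Integration against Jacobi weights\<close>

text \<open>The weight is not normalised here, whereas \<open>jacobi\<close> uses total mass 1; the
  value at the polynomial 1 therefore appears as a factor below.\<close>

definition jacobi_functional :: "real \<Rightarrow> real \<Rightarrow> real poly \<Rightarrow> real" where
  "jacobi_functional \<alpha> \<beta> p = (LINT t:{-1..1}|lebesgue. poly p t * jacobi_weight \<alpha> \<beta> t)"

lemma affine_interval_lebesgue:
  fixes f :: "real \<Rightarrow> real"
  shows "set_integrable lebesgue {-1..1} f \<longleftrightarrow> set_integrable lebesgue {0..1} (\<lambda>u. f (2 * u - 1))"
    and "(LINT t:{-1..1}|lebesgue. f t) = 2 * (LINT u:{0..1}|lebesgue. f (2 * u - 1))"
proof -
  have ind: "indicator {-1..1} (2 * u - 1) = (indicator {0..1} u :: real)" for u :: real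
    by (auto simp: indicator_def)
  show "set_integrable lebesgue {-1..1} f \<longleftrightarrow> set_integrable lebesgue {0..1} (\<lambda>u. f (2 * u - 1))"
    unfolding set_integrable_def
    by (subst lebesgue_integrable_real_affine_iff[where c=2 and t="-1", symmetric]) (auto simp: ind)
  show "(LINT t:{-1..1}|lebesgue. f t) = 2 * (LINT u:{0..1}|lebesgue. f (2 * u - 1))"
    unfolding set_lebesgue_integral_def
    by (subst lebesgue_integral_real_affine[where c=2 and t="-1"]) (auto simp: ind)
qed

lemma Beta_lebesgue:
  assumes "a > 0" "b > (0::real)"
  shows "set_integrable lebesgue {0..1} (\<lambda>u. u powr (a - 1) * (1 - u) powr (b - 1))"
    and "(LINT u:{0..1}|lebesgue. u powr (a - 1) * (1 - u) powr (b - 1)) = Beta a b"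
proof -
  note I = has_integral_Beta_real[OF assms]
  show S: "set_integrable lebesgue {0..1} (\<lambda>u. u powr (a - 1) * (1 - u) powr (b - 1))"
    using I by (intro nonnegative_absolutely_integrable_1) auto
  show "(LINT u:{0..1}|lebesgue. u powr (a - 1) * (1 - u) powr (b - 1)) = Beta a b"
    using set_lebesgue_integral_eq_integral(2)[OF S] I by (simp add: integral_unique)
qed

lemma set_integrable_continuous_mult:
  fixes f g :: "'a::euclidean_space \<Rightarrow> real"
  assumes g: "set_integrable lebesgue S g" and f: "continuous_on S f" and S: "compact S"
  shows "set_integrable lebesgue S (\<lambda>t. f t * g t)"
proof -
  have "S \<in> sets lebesgue" using S by (simp add: compact_imp_closed)
  moreover have "f \<in> borel_measurable (lebesgue_on S)"
    using f \<open>S \<in> sets lebesgue\<close> by (rule continuous_imp_measurable_on_sets_lebesgue)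
  ultimately show ?thesis
    using assms compact_imp_bounded[OF compact_continuous_image[OF f S]]
    by (intro absolutely_integrable_bounded_measurable_product[OF bilinear_times]) auto
qed

lemma jacobi_weight_affine:
  assumes "u \<in> {0..1}"
  shows "jacobi_weight \<alpha> \<beta> (2 * u - 1) = 2 powr (\<alpha> + \<beta>) * (u powr \<beta> * (1 - u) powr \<alpha>)"
proof -
  have "jacobi_weight \<alpha> \<beta> (2 * u - 1) = (2 * (1 - u)) powr \<alpha> * (2 * u) powr \<beta>"
    by (simp add: jacobi_weight_def algebra_simps)
  also have "\<dots> = 2 powr \<alpha> * (1 - u) powr \<alpha> * (2 powr \<beta> * u powr \<beta>)"
    using assms by (subst (1 2) powr_mult) auto
  finally show ?thesis by (simp add: powr_add)
qed

lemma jacobi_functional_integrable: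
  assumes "\<alpha> > -1" "\<beta> > -1"
  shows "set_integrable lebesgue {-1..1} (\<lambda>t. poly p t * jacobi_weight \<alpha> \<beta> t)"
proof (rule set_integrable_continuous_mult)
  have "set_integrable lebesgue {0..1} (\<lambda>u. 2 powr (\<alpha> + \<beta>) * (u powr \<beta> * (1 - u) powr \<alpha>))"
    using Beta_lebesgue(1)[of "\<beta> + 1" "\<alpha> + 1"] assms by (intro set_integrable_mult_right) auto
  then show "set_integrable lebesgue {-1..1} (jacobi_weight \<alpha> \<beta>)"
    unfolding affine_interval_lebesgue
    by (subst set_integrable_cong[OF refl refl jacobi_weight_affine]) auto
qed (auto intro!: continuous_intros)

lemma jacobi_functional_add:
  assumes "\<alpha> > -1" "\<beta> > -1"
  shows "jacobi_functional \<alpha> \<beta> (p + q) = jacobi_functional \<alpha> \<beta> p + jacobi_functional \<alpha> \<beta> q"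
  using set_integral_add(2)[OF jacobi_functional_integrable[OF assms, of p] jacobi_functional_integrable[OF assms, of q]]
  by (simp add: jacobi_functional_def algebra_simps)

lemma jacobi_functional_smult:
  "jacobi_functional \<alpha> \<beta> (smult c p) = c * jacobi_functional \<alpha> \<beta> p"
  by (simp add: jacobi_functional_def mult.assoc)

text \<open>With t = 2 u - 1 the two linear factors become u and 1 - u, which leaves a Beta integral
  on the unit interval.\<close>

lemma jacobi_functional_moment:
  assumes "\<alpha> > -1" "\<beta> > -1"
  shows "jacobi_functional \<alpha> \<beta> ([:1/2, 1/2:] ^ i * [:1/2, - (1/2):] ^ q)
    = 2 powr (\<alpha> + \<beta> + 1) * Beta (\<beta> + 1 + real i) (\<alpha> + 1 + real q)"
proof -
  have "jacobi_functional \<alpha> \<beta> ([:1/2, 1/2:] ^ i * [:1/2, - (1/2):] ^ q)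
     = 2 * (LINT u:{0..1}|lebesgue. u ^ i * (1 - u) ^ q * jacobi_weight \<alpha> \<beta> (2 * u - 1))"
    unfolding jacobi_functional_def affine_interval_lebesgue
    by (intro arg_cong[where f="(*) 2"] set_lebesgue_integral_cong)
      (auto simp: algebra_simps diff_divide_distrib)
  also have "(LINT u:{0..1}|lebesgue. u ^ i * (1 - u) ^ q * jacobi_weight \<alpha> \<beta> (2 * u - 1))
     = (LINT u:{0..1}|lebesgue. 2 powr (\<alpha> + \<beta>) *
         (u powr (\<beta> + 1 + real i - 1) * (1 - u) powr (\<alpha> + 1 + real q - 1)))"
  proof (rule set_lebesgue_integral_cong_AE)
    show "AE u\<in>{0..1} in lebesgue. u ^ i * (1 - u) ^ q * jacobi_weight \<alpha> \<beta> (2 * u - 1) =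
      2 powr (\<alpha> + \<beta>) * (u powr (\<beta> + 1 + real i - 1) * (1 - u) powr (\<alpha> + 1 + real q - 1))"
    proof -
      have "AE u in lebesgue. (u::real) \<noteq> 0" "AE u in lebesgue. (u::real) \<noteq> 1"
        by (auto intro: AE_completion AE_lborel_singleton)
      then show ?thesis
      proof eventually_elim
        case (elim u)
        then show ?case
          by (auto simp: jacobi_weight_affine powr_add powr_realpow)
      qed
    qed
  qed (simp, (rule measurable_completion, simp add: jacobi_weight_def)+)
  also have "\<dots> = 2 powr (\<alpha> + \<beta>) * Beta (\<beta> + 1 + real i) (\<alpha> + 1 + real q)"
    using assms Beta_lebesgue(2)[of "\<beta> + 1 + real i" "\<alpha> + 1 + real q"] by simp
  finally show ?thesis by (simp add: powr_add)
qed

lemma jacobi_functional_pos: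
  assumes "\<alpha> > -1" "\<beta> > -1"
  shows "jacobi_functional \<alpha> \<beta> 1 > 0"
proof -
  have "Beta (\<beta> + 1) (\<alpha> + 1) > 0"
    using assms by (simp add: Beta_def Gamma_real_pos)
  then show ?thesis
    using jacobi_functional_moment[OF assms, of 0 0] by simp
qed

text \<open>The integrand is the derivative of (1 - s^2)^(\<mu> + 1) p(s), which is zero at both
  endpoints. In this form integration by parts is an algebraic identity for polynomials.\<close>

lemma jacobi_functional_pearson:
  assumes "\<mu> \<ge> 0"
  shows "jacobi_functional \<mu> \<mu> ([:1, 0, -1:] * pderiv p - smult (2 * \<mu> + 2) ([:0, 1:] * p)) = 0"
proof -
  let ?q = "[:1, 0, -1:] * pderiv p - smult (2 * \<mu> + 2) ([:0, 1:] * p)"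
  have "((\<lambda>t. poly ?q t * jacobi_weight \<mu> \<mu> t) has_integral
     ((1 - 1\<^sup>2) powr (\<mu> + 1) * poly p 1 - (1 - (-1)\<^sup>2) powr (\<mu> + 1) * poly p (-1))) {-1..1}"
  proof (rule fundamental_theorem_of_calculus_interior)
    show "continuous_on {-1..1} (\<lambda>s. (1 - s\<^sup>2) powr (\<mu> + 1) * poly p s)"
      using assms by (intro continuous_intros continuous_on_powr') (auto simp: abs_square_le_1 abs_le_iff)
    fix s :: real assume s: "s \<in> {-1<..<1}"
    then have "s\<^sup>2 < 1" by (auto simp: abs_square_less_1)
    then have pos: "1 - s\<^sup>2 > 0" by simp
    have *: "(1 - s\<^sup>2) powr (\<mu> + 1) = (1 - s\<^sup>2) * (1 - s\<^sup>2) powr \<mu>"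
      using pos by (simp add: powr_add)
    have **: "jacobi_weight \<mu> \<mu> s = (1 - s\<^sup>2) powr \<mu>"
      using s by (simp add: jacobi_weight_def powr_mult[symmetric] algebra_simps power2_eq_square)
    have "((\<lambda>s. (1 - s\<^sup>2) powr (\<mu> + 1) * poly p s) has_real_derivative
      (1 - s\<^sup>2) powr (\<mu> + 1) * poly (pderiv p) s + ((\<mu> + 1) * (1 - s\<^sup>2) powr \<mu> * (- 2 * s)) * poly p s) (at s)"
      using pos by (auto intro!: derivative_eq_intros)
    also have "(1 - s\<^sup>2) powr (\<mu> + 1) * poly (pderiv p) s + ((\<mu> + 1) * (1 - s\<^sup>2) powr \<mu> * (- 2 * s)) * poly p s
       = poly ?q s * jacobi_weight \<mu> \<mu> s"
      unfolding * ** by (simp add: algebra_simps power2_eq_square)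
    finally show "((\<lambda>s. (1 - s\<^sup>2) powr (\<mu> + 1) * poly p s) has_vector_derivative
       poly ?q s * jacobi_weight \<mu> \<mu> s) (at s)"
      by (simp add: has_real_derivative_iff_has_vector_derivative)
  qed simp
  then show ?thesis
    using set_lebesgue_integral_eq_integral(2)[OF jacobi_functional_integrable[of \<mu> \<mu> ?q]] assms
    by (simp add: jacobi_functional_def integral_unique)
qed

section \<open>Gegenbauer polynomials from the three-term recurrence\<close>

fun gegenbauer_rec :: "real \<Rightarrow> nat \<Rightarrow> real poly" where
  "gegenbauer_rec lam 0 = 1"
| "gegenbauer_rec lam (Suc 0) = [:0, 2 * lam:]"
| "gegenbauer_rec lam (Suc (Suc k)) = smult (1 / real (k + 2))
    (smult (2 * (real k + 1 + lam)) ([:0, 1:] * gegenbauer_rec lam (Suc k)) -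
     smult (real k + 2 * lam) (gegenbauer_rec lam k))"

lemma gegenbauer_rec_step:
  "(real k + 2) * poly (gegenbauer_rec lam (Suc (Suc k))) s =
    2 * (real k + 1 + lam) * s * poly (gegenbauer_rec lam (Suc k)) s - (real k + 2 * lam) * poly (gegenbauer_rec lam k) s"
  by (simp add: add.commute)

declare gegenbauer_rec.simps(3)[simp del]

lemma gegenbauer_rec_step_poly:
  "smult (real k + 2) (gegenbauer_rec lam (Suc (Suc k))) =
    smult (2 * (real k + 1 + lam)) ([:0, 1:] * gegenbauer_rec lam (Suc k)) - smult (real k + 2 * lam) (gegenbauer_rec lam k)"
proof (rule poly_eq_poly_eq_iff[THEN iffD1], rule ext)
  fix s
  show "poly (smult (real k + 2) (gegenbauer_rec lam (Suc (Suc k)))) s =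
    poly (smult (2 * (real k + 1 + lam)) ([:0, 1:] * gegenbauer_rec lam (Suc k)) - smult (real k + 2 * lam) (gegenbauer_rec lam k)) s"
    using gegenbauer_rec_step[of k lam s] by (simp add: algebra_simps)
qed

text \<open>The second identity at k turns the differentiated recurrence into the first identity at
  k + 1, which in turn gives the second at k + 1; hence the joint induction.\<close>

lemma gegenbauer_rec_deriv_aux:
  "poly (pderiv (gegenbauer_rec lam (Suc k))) s =
     s * poly (pderiv (gegenbauer_rec lam k)) s + (real k + 2 * lam) * poly (gegenbauer_rec lam k) s \<and>
   s * poly (pderiv (gegenbauer_rec lam (Suc k))) s - poly (pderiv (gegenbauer_rec lam k)) s =
     (real k + 1) * poly (gegenbauer_rec lam (Suc k)) s"
proof (induction k)
  case 0
  show ?case by (simp add: pderiv_pCons)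
next
  case (Suc k)
  let ?G = "gegenbauer_rec lam"
  have "poly (pderiv (smult (real k + 2) (?G (Suc (Suc k))))) s =
     poly (pderiv (smult (2 * (real k + 1 + lam)) ([:0, 1:] * ?G (Suc k)) - smult (real k + 2 * lam) (?G k))) s"
    by (simp only: gegenbauer_rec_step_poly)
  then have D: "(real k + 2) * poly (pderiv (?G (Suc (Suc k)))) s =
     2 * (real k + 1 + lam) * (poly (?G (Suc k)) s + s * poly (pderiv (?G (Suc k))) s)
       - (real k + 2 * lam) * poly (pderiv (?G k)) s"
    by (simp add: pderiv_smult pderiv_diff pderiv_mult pderiv_pCons algebra_simps)
  have "(real k + 2) * poly (pderiv (?G (Suc (Suc k)))) s =
     (real k + 2) * (s * poly (pderiv (?G (Suc k))) s + (real (Suc k) + 2 * lam) * poly (?G (Suc k)) s)"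
    unfolding of_nat_Suc using Suc.IH D by algebra
  then have 1: "poly (pderiv (?G (Suc (Suc k)))) s =
     s * poly (pderiv (?G (Suc k))) s + (real (Suc k) + 2 * lam) * poly (?G (Suc k)) s"
    by (simp del: of_nat_Suc)
  have "s * poly (pderiv (?G (Suc (Suc k)))) s - poly (pderiv (?G (Suc k))) s =
     (real (Suc k) + 1) * poly (?G (Suc (Suc k))) s"
    using Suc.IH 1 gegenbauer_rec_step[of k lam s] unfolding of_nat_Suc by algebra
  with 1 show ?case by blast
qed

lemma gegenbauer_rec_deriv:
  "(s\<^sup>2 - 1) * poly (pderiv (gegenbauer_rec lam (Suc k))) s =
     (real k + 1) * s * poly (gegenbauer_rec lam (Suc k)) s - (real k + 2 * lam) * poly (gegenbauer_rec lam k) s"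
  using gegenbauer_rec_deriv_aux[of lam k s] by algebra

lemma gegenbauer_rec_ode:
  "(1 - s\<^sup>2) * poly (pderiv (pderiv (gegenbauer_rec lam k))) s =
     (2 * lam + 1) * s * poly (pderiv (gegenbauer_rec lam k)) s
       - real k * (real k + 2 * lam) * poly (gegenbauer_rec lam k) s"
proof (cases k)
  case (Suc k)
  let ?G = "gegenbauer_rec lam"
  have "[:-1, 0, 1:] * pderiv (?G (Suc k)) =
    smult (real k + 1) ([:0, 1:] * ?G (Suc k)) - smult (real k + 2 * lam) (?G k)"
    using gegenbauer_rec_deriv[of _ lam k]
    by (simp add: poly_eq_poly_eq_iff[symmetric] fun_eq_iff algebra_simps power2_eq_square)
  then have "poly (pderiv ([:-1, 0, 1:] * pderiv (?G (Suc k)))) s =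
    poly (pderiv (smult (real k + 1) ([:0, 1:] * ?G (Suc k)) - smult (real k + 2 * lam) (?G k))) s"
    by simp
  then have "2 * s * poly (pderiv (?G (Suc k))) s + (s\<^sup>2 - 1) * poly (pderiv (pderiv (?G (Suc k)))) s
     = (real k + 1) * (poly (?G (Suc k)) s + s * poly (pderiv (?G (Suc k))) s)
       - (real k + 2 * lam) * poly (pderiv (?G k)) s"
    by (simp add: pderiv_smult pderiv_diff pderiv_mult pderiv_pCons algebra_simps power2_eq_square)
  then show ?thesis
    using gegenbauer_rec_deriv_aux[of lam k s] unfolding Suc of_nat_Suc by algebra
qed simp

lemma gegenbauer_rec_degree:
  assumes "lam > 0"
  shows "degree (gegenbauer_rec lam k) = k \<and> lead_coeff (gegenbauer_rec lam k) > 0"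
  using assms
proof (induction lam k rule: gegenbauer_rec.induct)
  case (3 lam k)
  let ?p = "smult (2 * (real k + 1 + lam)) ([:0, 1:] * gegenbauer_rec lam (Suc k))"
  let ?q = "smult (real k + 2 * lam) (gegenbauer_rec lam k)"
  have IH: "degree (gegenbauer_rec lam (Suc k)) = Suc k" "coeff (gegenbauer_rec lam (Suc k)) (Suc k) > 0"
    "degree (gegenbauer_rec lam k) = k"
    using 3 by auto
  have c: "coeff (?p - ?q) (Suc (Suc k)) > 0"
    using IH \<open>lam > 0\<close> by (simp add: coeff_eq_0)
  have "degree (?p - ?q) \<le> Suc (Suc k)"
    using IH by (intro degree_diff_le order.trans[OF degree_smult_le] order.trans[OF degree_mult_le]) auto
  then have "degree (?p - ?q) = Suc (Suc k)"
    using c by (intro antisym le_degree) auto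
  with c show ?case
    by (simp only: gegenbauer_rec.simps(3)) simp
qed auto

lemma gegenbauer_rec_at_1: "poly (gegenbauer_rec lam k) 1 = pochhammer (2 * lam) k / fact k"
proof (induction lam k rule: gegenbauer_rec.induct)
  case (3 lam k)
  have "(real k + 2) * poly (gegenbauer_rec lam (Suc (Suc k))) 1 =
    2 * (real k + 1 + lam) * (pochhammer (2 * lam) k * (2 * lam + real k) / (fact k * (real k + 1)))
     - (real k + 2 * lam) * (pochhammer (2 * lam) k / fact k)"
    using gegenbauer_rec_step[of k lam 1] 3 by (simp add: pochhammer_Suc algebra_simps)
  also have "\<dots> = pochhammer (2 * lam) k * (2 * lam + real k) * (2 * lam + real k + 1) / (fact k * (real k + 1))"
    (is "2 * (real k + 1 + lam) * (?P * _ / (?F * _)) - _ * (?P / ?F) = _")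
  proof -
    have "?F \<noteq> 0" by simp
    then show ?thesis by (simp add: divide_simps del: fact_nonzero) algebra
  qed
  also have "\<dots> = (real k + 2) * (pochhammer (2 * lam) (Suc (Suc k)) / fact (Suc (Suc k)))"
  proof -
    have fact_eq: "fact (Suc (Suc k)) = (real k + 2) * ((real k + 1) * fact k)"
      by (simp add: algebra_simps)
    have cancel: "(real k + 2) * (a / ((real k + 2) * b)) = a / b" for a b :: real
      by simp
    show ?thesis
      unfolding fact_eq cancel pochhammer_Suc of_nat_Suc by (simp add: mult_ac add_ac)
  qed
  finally have "(real k + 2) * poly (gegenbauer_rec lam (Suc (Suc k))) 1 =
    (real k + 2) * (pochhammer (2 * lam) (Suc (Suc k)) / fact (Suc (Suc k)))" .
  moreover have "real k + 2 \<noteq> 0" by simp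
  ultimately show ?case
    by (rule mult_left_cancel[THEN iffD1, rotated])
qed simp_all

context
  fixes \<mu> :: real
  assumes \<mu>: "\<mu> \<ge> 0"
begin

private abbreviation "\<Lambda> \<equiv> jacobi_functional \<mu> \<mu>"
private abbreviation "G \<equiv> gegenbauer_rec (\<mu> + 1/2)"

private lemma \<Lambda>_add: "\<Lambda> (p + q) = \<Lambda> p + \<Lambda> q"
  using \<mu> by (intro jacobi_functional_add) auto

private lemma \<Lambda>_diff: "\<Lambda> (p - q) = \<Lambda> p - \<Lambda> q"
  using \<Lambda>_add[of p "smult (-1) q"] jacobi_functional_smult[of \<mu> \<mu> "-1" q] by simp

text \<open>Sturm-Liouville argument: p is the Wronskian of the two polynomials and c the eigenvalue
  k (k + 2 \<lambda>) of the differential equation. The integrated Wronskian identity leaves the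
  difference of the eigenvalues times the inner product.\<close>

lemma gegenbauer_rec_orthogonal:
  assumes "k \<noteq> l"
  shows "\<Lambda> (G k * G l) = 0"
proof -
  define p where "p = pderiv (G k) * G l - G k * pderiv (G l)"
  define c where "c n = real n * (real n + 2 * (\<mu> + 1/2))" for n
  have "[:1, 0, -1:] * pderiv p - smult (2 * \<mu> + 2) ([:0, 1:] * p) = smult (c l - c k) (G k * G l)"
  proof (rule poly_eq_poly_eq_iff[THEN iffD1], rule ext)
    fix s
    have "poly (pderiv p) s = poly (pderiv (pderiv (G k))) s * poly (G l) s - poly (G k) s * poly (pderiv (pderiv (G l))) s"
      by (simp add: p_def pderiv_diff pderiv_mult)
    then show "poly ([:1, 0, -1:] * pderiv p - smult (2 * \<mu> + 2) ([:0, 1:] * p)) s = poly (smult (c l - c k) (G k * G l)) s"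
      using gegenbauer_rec_ode[of s "\<mu> + 1/2" k] gegenbauer_rec_ode[of s "\<mu> + 1/2" l]
      by (simp add: p_def c_def) algebra
  qed
  then have "(c l - c k) * \<Lambda> (G k * G l) = 0"
    using jacobi_functional_pearson[OF \<mu>, of p] by (simp add: jacobi_functional_smult)
  moreover have "c l - c k = (real l - real k) * (real l + real k + 2 * (\<mu> + 1/2))"
    by (simp add: c_def algebra_simps)
  ultimately show ?thesis using assms \<mu> by auto
qed

text \<open>The mixed moment X is computed twice: from the recurrence multiplied by G k, and from
  the preceding one multiplied by G (k + 1). In each case orthogonality removes one term, and the
  two results link consecutive norms.\<close>

lemma gegenbauer_rec_norm:
  "\<Lambda> (G k * G k) = (\<mu> + 1/2) / (real k + \<mu> + 1/2) * poly (G k) 1 * \<Lambda> 1"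
proof (induction k)
  case 0
  show ?case using \<mu> by simp
next
  case (Suc k)
  define X where "X = \<Lambda> ([:0, 1:] * G k * G (Suc k))"
  define lam where "lam = \<mu> + 1/2"
  have lam: "lam > 0" using \<mu> by (simp add: lam_def)
  have A: "smult (real k + 2) (G (Suc (Suc k)) * G k) =
      smult (2 * (real k + 1 + lam)) ([:0, 1:] * G k * G (Suc k)) - smult (real k + 2 * lam) (G k * G k)"
    using arg_cong[OF gegenbauer_rec_step_poly[of k lam], of "\<lambda>p. p * G k"]
    by (simp add: lam_def algebra_simps)
  have 1: "2 * (real k + 1 + lam) * X = (real k + 2 * lam) * \<Lambda> (G k * G k)"
    using arg_cong[OF A, of \<Lambda>] gegenbauer_rec_orthogonal[of "Suc (Suc k)" k]
    by (simp only: \<Lambda>_diff jacobi_functional_smult X_def)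
  have 2: "(real k + 1) * \<Lambda> (G (Suc k) * G (Suc k)) = 2 * (real k + lam) * X"
  proof (cases k)
    case 0
    have "G (Suc 0) * G (Suc 0) = smult (2 * lam) ([:0, 1:] * G 0 * G (Suc 0))"
      by (simp add: lam_def)
    then show ?thesis unfolding 0 X_def by (simp only: jacobi_functional_smult) simp
  next
    case (Suc j)
    have "smult (real j + 2) (G (Suc (Suc j)) * G (Suc (Suc j))) =
      smult (2 * (real j + 1 + lam)) ([:0, 1:] * G (Suc j) * G (Suc (Suc j))) - smult (real j + 2 * lam) (G j * G (Suc (Suc j)))"
      using arg_cong[OF gegenbauer_rec_step_poly[of j lam], of "\<lambda>p. p * G (Suc (Suc j))"]
      by (simp add: lam_def algebra_simps)
    from arg_cong[OF this, of \<Lambda>] show ?thesis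
      using gegenbauer_rec_orthogonal[of j "Suc (Suc j)"]
      unfolding Suc X_def by (simp only: \<Lambda>_diff jacobi_functional_smult) (simp add: algebra_simps)
  qed
  have at1: "poly (G (Suc k)) 1 = poly (G k) 1 * (real k + 2 * lam) / (real k + 1)"
    by (simp add: gegenbauer_rec_at_1 pochhammer_Suc lam_def field_simps)
  have "X = (real k + 2 * lam) * \<Lambda> (G k * G k) / (2 * (real k + 1 + lam))"
    using 1 lam by (simp add: field_simps)
  also have "\<Lambda> (G k * G k) = lam / (real k + lam) * poly (G k) 1 * \<Lambda> 1"
    using Suc.IH by (simp add: lam_def add.assoc)
  finally have X: "X = (real k + 2 * lam) * (lam / (real k + lam) * poly (G k) 1 * \<Lambda> 1) / (2 * (real k + 1 + lam))" .
  have "\<Lambda> (G (Suc k) * G (Suc k)) = 2 * (real k + lam) * X / (real k + 1)"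
    using 2 by (simp add: field_simps)
  also have "\<dots> = lam / (real k + 1 + lam) * poly (G (Suc k)) 1 * \<Lambda> 1"
    using lam unfolding X at1 by (simp add: divide_simps) (simp add: algebra_simps)
  finally show ?case by (simp add: lam_def add_ac)
qed

text \<open>Orthogonality determines each polynomial up to a scalar. The prescribed value at 1 is
  positive, so it rules out zero polynomials and fixes the scalar.\<close>

lemma gegenbauer_eq_rec: "gegenbauer (\<mu> + 1/2) = G"
proof -
  have orth: "(LINT s:{-1..1}|lebesgue. poly p s * poly q s * (1 - s\<^sup>2) powr (\<mu> + 1/2 - 1/2)) = \<Lambda> (p * q)" for p q
    unfolding jacobi_functional_def
  proof (rule set_lebesgue_integral_cong)
    show "\<forall>s. s \<in> {-1..1} \<longrightarrow> poly p s * poly q s * (1 - s\<^sup>2) powr (\<mu> + 1/2 - 1/2) = poly (p * q) s * jacobi_weight \<mu> \<mu> s"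
      by (auto simp: jacobi_weight_def powr_mult[symmetric] algebra_simps power2_eq_square)
  qed simp
  have pos: "poly (G k) 1 > 0" for k
    using \<mu> by (simp add: gegenbauer_rec_at_1 pochhammer_pos)
  have deg: "degree (G k) = k" for k
    using gegenbauer_rec_degree[of "\<mu> + 1/2" k] \<mu> by simp
  show ?thesis
    unfolding gegenbauer_def
  proof (rule the_equality)
    show "\<forall>k. degree (G k) = k \<and> poly (G k) 1 = pochhammer (2 * (\<mu> + 1/2)) k / fact k \<and>
        (\<forall>l. l \<noteq> k \<longrightarrow> (LINT s:{-1..1}|lebesgue. poly (G k) s * poly (G l) s * (1 - s\<^sup>2) powr (\<mu> + 1/2 - 1/2)) = 0)"
      unfolding orth using deg gegenbauer_rec_at_1 gegenbauer_rec_orthogonal by auto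
    fix C :: "nat \<Rightarrow> real poly"
    assume C: "\<forall>k. degree (C k) = k \<and> poly (C k) 1 = pochhammer (2 * (\<mu> + 1/2)) k / fact k \<and>
        (\<forall>l. l \<noteq> k \<longrightarrow> (LINT s:{-1..1}|lebesgue. poly (C k) s * poly (C l) s * (1 - s\<^sup>2) powr (\<mu> + 1/2 - 1/2)) = 0)"
    have at1: "poly (C k) 1 = poly (G k) 1" for k
      using C by (simp add: gegenbauer_rec_at_1)
    show "C = G"
    proof
      fix k
      have C_eq: "C k = smult (lead_coeff (C k) / lead_coeff (G k)) (G k)" (is "_ = smult ?c _")
      proof (rule orthogonal_family_unique[where \<Lambda>=\<Lambda>])
        show "G n \<noteq> 0" for n using pos[of n] by auto
        show "C n \<noteq> 0" for n using pos[of n] at1[of n] by auto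
        show "\<Lambda> (G n * G n) \<noteq> 0" for n
          using gegenbauer_rec_norm[of n] pos[of n] jacobi_functional_pos[of \<mu> \<mu>] \<mu> by simp
        show "\<Lambda> (C m * C n) = 0" if "m \<noteq> n" for m n
          using C that unfolding orth by metis
      qed (use C deg \<Lambda>_add jacobi_functional_smult gegenbauer_rec_orthogonal in auto)
      have "?c = 1"
        using arg_cong[OF C_eq, of "\<lambda>p. poly p 1"] at1[of k] pos[of k]
        by (metis less_irrefl mult_cancel_right1 poly_smult)
      with C_eq show "C k = G k" by simp
    qed
  qed
qed

end

section \<open>Jacobi polynomials\<close>

text \<open>Written with \<open>pochhammer (- real l) i\<close>, the alternating factorials give a
  terminating hypergeometric series at 1, which the Chu-Vandermonde identity evaluates.\<close>

lemma alternating_pochhammer_sum: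
  fixes a c :: real
  assumes "\<And>i. i < l \<Longrightarrow> c \<noteq> - real i"
  shows "(\<Sum>i\<le>l. (-1) ^ (l - i) * pochhammer a i / (fact (l - i) * fact i * pochhammer c i))
    = (-1) ^ l / fact l * (pochhammer (c - a) l / pochhammer c l)"
proof -
  have "(-1) ^ (l - i) * pochhammer a i / (fact (l - i) * fact i * pochhammer c i) =
      (-1) ^ l / fact l * ((pochhammer a i * pochhammer (- real l) i) / (fact i * pochhammer c i))"
    if "i \<le> l" for i
  proof -
    have "pochhammer (- real l) i = (-1) ^ i * fact i * (real l gchoose i)"
      by (simp add: gbinomial_pochhammer mult.assoc[symmetric] power_mult_distrib[symmetric])
    also have "(real l gchoose i) = fact l / (fact i * fact (l - i))"
      using that by (simp add: binomial_gbinomial[symmetric] binomial_fact)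
    finally have *: "pochhammer (- real l) i = (-1) ^ i * (fact l / fact (l - i))"
      by simp
    have "(-1 :: real) ^ l * (-1) ^ i = (-1) ^ (l - i)"
      using that by (simp add: power_add[symmetric] minus_one_power_iff)
    then show ?thesis unfolding * by (simp add: field_simps)
  qed
  then have "(\<Sum>i\<le>l. (-1) ^ (l - i) * pochhammer a i / (fact (l - i) * fact i * pochhammer c i))
    = (-1) ^ l / fact l * (\<Sum>i\<in>{0..l}. (pochhammer a i * pochhammer (- real l) i) / (fact i * pochhammer c i))"
    by (simp add: sum_distrib_left atMost_atLeast0)
  also have "(\<Sum>i\<in>{0..l}. (pochhammer a i * pochhammer (- real l) i) / (fact i * pochhammer c i))
      = pochhammer (c - a) l / pochhammer c l"
    using Vandermonde_pochhammer[of l c a] assms by simp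
  finally show ?thesis .
qed

text \<open>The hypergeometric Jacobi polynomial in powers of \<open>(1 + t) / 2\<close>: in this basis moments
  against \<open>(1 - t) ^ q\<close> are Beta values, and orthogonality, norm and value at 1 are all instances
  of the Chu-Vandermonde sum.\<close>

definition jacobi_coeff :: "real \<Rightarrow> real \<Rightarrow> nat \<Rightarrow> nat \<Rightarrow> real" where
  "jacobi_coeff \<alpha> \<beta> l i = (-1) ^ (l - i) * pochhammer (\<beta> + 1) l * pochhammer (real l + \<alpha> + \<beta> + 1) i /
     (fact (l - i) * fact i * pochhammer (\<beta> + 1) i)"

definition jacobi_std :: "real \<Rightarrow> real \<Rightarrow> nat \<Rightarrow> real poly" where
  "jacobi_std \<alpha> \<beta> l = (\<Sum>i\<le>l. smult (jacobi_coeff \<alpha> \<beta> l i) ([:1/2, 1/2:] ^ i))"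

text \<open>Squared norm of \<open>jacobi_std\<close> divided by the mass of the weight, that is,
  the squared norm for the normalised weight in \<open>jacobi\<close>.\<close>

definition jacobi_norm2 :: "real \<Rightarrow> real \<Rightarrow> nat \<Rightarrow> real" where
  "jacobi_norm2 \<alpha> \<beta> l = pochhammer (real l + \<alpha> + \<beta> + 1) l * pochhammer (\<alpha> + 1) l * pochhammer (\<beta> + 1) l /
     (fact l * pochhammer (\<alpha> + \<beta> + 2) (2 * l))"

context
  fixes \<alpha> \<beta> :: real
  assumes ab: "\<alpha> > -1" "\<beta> > -1"
begin

private abbreviation "JF \<equiv> jacobi_functional \<alpha> \<beta>"
private abbreviation "P \<equiv> jacobi_std \<alpha> \<beta>"
private abbreviation "X \<equiv> [:1/2, 1/2:] :: real poly"
private abbreviation "Y \<equiv> [:1/2, - (1/2):] :: real poly"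

private lemma JF_add: "JF (p + q) = JF p + JF q"
  using ab by (intro jacobi_functional_add) auto

private lemma JF_0: "JF 0 = 0"
  using jacobi_functional_smult[of \<alpha> \<beta> 0 0] by simp

private lemma JF_sum: "JF (\<Sum>i\<in>A. f i) = (\<Sum>i\<in>A. JF (f i))"
  by (induction A rule: infinite_finite_induct) (simp_all add: JF_add JF_0)

lemma jacobi_std_at_1: "poly (P l) 1 = pochhammer (\<alpha> + 1) l / fact l"
proof -
  have nz: "pochhammer (\<beta> + 1) l \<noteq> 0" using ab pochhammer_pos[of "\<beta> + 1" l] by simp
  have "poly (P l) 1 = pochhammer (\<beta> + 1) l * (\<Sum>i\<le>l. (-1) ^ (l - i) * pochhammer (real l + \<alpha> + \<beta> + 1) i /
      (fact (l - i) * fact i * pochhammer (\<beta> + 1) i))"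
    by (simp add: jacobi_std_def jacobi_coeff_def poly_sum sum_distrib_left mult_ac)
  also have "\<dots> = pochhammer (\<beta> + 1) l * ((-1) ^ l / fact l *
      (pochhammer ((\<beta> + 1) - (real l + \<alpha> + \<beta> + 1)) l / pochhammer (\<beta> + 1) l))"
    using ab by (subst alternating_pochhammer_sum) auto
  also have "(\<beta> + 1) - (real l + \<alpha> + \<beta> + 1) = - (real l + \<alpha>)" by simp
  also have "pochhammer (- (real l + \<alpha>)) l = (-1) ^ l * pochhammer (\<alpha> + 1) l"
    by (subst pochhammer_minus) (simp add: add.commute)
  finally show ?thesis using nz by (simp add: power_mult_distrib[symmetric] mult.assoc[symmetric])
qed

lemma jacobi_std_moment:
  "JF (P l * Y ^ q) = (if q < l then 0 else
     (-1) ^ l * pochhammer (real (q - l) + 1) l / fact l * 2 powr (\<alpha> + \<beta> + 1) * pochhammer (\<beta> + 1) l *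
       Gamma (\<beta> + 1) * Gamma (\<alpha> + 1 + real q) / Gamma (\<alpha> + \<beta> + 2 + real q + real l))"
proof -
  define c where "c = \<alpha> + \<beta> + 2 + real q"
  have c: "c > 0" using ab by (simp add: c_def)
  have Gc: "Gamma (c + real i) = Gamma c * pochhammer c i" for i
    using c by (simp add: pochhammer_Gamma Gamma_real_pos[THEN less_imp_neq, symmetric] nonpos_Ints_of_int
        nonpos_Ints_def)
  have Gb: "Gamma (\<beta> + 1 + real i) = Gamma (\<beta> + 1) * pochhammer (\<beta> + 1) i" for i
    using ab by (simp add: pochhammer_Gamma Gamma_real_pos[THEN less_imp_neq, symmetric] nonpos_Ints_of_int
        nonpos_Ints_def)
  have pb: "pochhammer (\<beta> + 1) i \<noteq> 0" for i
    using ab pochhammer_pos[of "\<beta> + 1" i] by simp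
  define K where "K = 2 powr (\<alpha> + \<beta> + 1) * pochhammer (\<beta> + 1) l * Gamma (\<beta> + 1) * Gamma (\<alpha> + 1 + real q) / Gamma c"
  have "JF (P l * Y ^ q) = (\<Sum>i\<le>l. jacobi_coeff \<alpha> \<beta> l i * JF (X ^ i * Y ^ q))"
    by (simp add: jacobi_std_def sum_distrib_right JF_sum jacobi_functional_smult)
  also have "\<dots> = (\<Sum>i\<le>l. K * ((-1) ^ (l - i) * pochhammer (real l + \<alpha> + \<beta> + 1) i / (fact (l - i) * fact i * pochhammer c i)))"
  proof (rule sum.cong[OF refl])
    fix i
    have "JF (X ^ i * Y ^ q) = 2 powr (\<alpha> + \<beta> + 1) *
        (Gamma (\<beta> + 1 + real i) * Gamma (\<alpha> + 1 + real q) / Gamma (c + real i))"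
      by (simp add: jacobi_functional_moment[OF ab] Beta_def c_def algebra_simps)
    then have e: "JF (X ^ i * Y ^ q) = 2 powr (\<alpha> + \<beta> + 1) *
        (Gamma (\<beta> + 1) * pochhammer (\<beta> + 1) i * Gamma (\<alpha> + 1 + real q) / (Gamma c * pochhammer c i))"
      unfolding Gc Gb .
    show "jacobi_coeff \<alpha> \<beta> l i * JF (X ^ i * Y ^ q) =
      K * ((-1) ^ (l - i) * pochhammer (real l + \<alpha> + \<beta> + 1) i / (fact (l - i) * fact i * pochhammer c i))"
      using pb[of i]
      unfolding e by (simp add: jacobi_coeff_def K_def mult_ac)
  qed
  also have "\<dots> = K * ((-1) ^ l / fact l * (pochhammer (c - (real l + \<alpha> + \<beta> + 1)) l / pochhammer c l))"
    using c by (subst sum_distrib_left[symmetric], subst alternating_pochhammer_sum) auto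
  also have "c - (real l + \<alpha> + \<beta> + 1) = real q + 1 - real l" by (simp add: c_def)
  finally have *: "JF (P l * Y ^ q) = K * ((-1) ^ l / fact l * (pochhammer (real q + 1 - real l) l / pochhammer c l))" .
  show ?thesis
  proof (cases "q < l")
    case True
    \<comment> \<open>The factors of this Pochhammer symbol run from q + 1 - l up to q; for q < l
      they pass through zero.\<close>
    then have "real q + 1 - real l = - real (l - Suc q)" by (simp add: of_nat_diff)
    then have "pochhammer (real q + 1 - real l) l = 0"
      using True by (simp only:) (simp add: pochhammer_of_nat_eq_0_iff del: of_nat_diff)
    then show ?thesis using * True by simp
  next
    case False
    then have q: "real q + 1 - real l = real (q - l) + 1" by simp
    have G: "Gamma (\<alpha> + \<beta> + 2 + real q + real l) = Gamma c * pochhammer c l"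
      using Gc[of l] by (simp only: c_def)
    show ?thesis
      using False unfolding * q K_def G by (simp del: of_nat_diff add: mult_ac)
  qed
qed

lemma jacobi_std_degree: "degree (P l) = l" "lead_coeff (P l) > 0"
  and jacobi_std_lead: "lead_coeff (P l) = pochhammer (real l + \<alpha> + \<beta> + 1) l / fact l / 2 ^ l"
proof -
  have lin: "degree (X ^ i) = i" "coeff (X ^ i) i = 1 / 2 ^ i" for i
  proof -
    show 1: "degree (X ^ i) = i" by (simp add: degree_power_eq)
    have "lead_coeff (X ^ i) = (1/2) ^ i" by (subst lead_coeff_power) simp
    then show "coeff (X ^ i) i = 1 / 2 ^ i" unfolding 1 by (simp add: power_one_over)
  qed
  have "coeff (P l) l = (\<Sum>i\<le>l. if i = l then jacobi_coeff \<alpha> \<beta> l l / 2 ^ l else 0)"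
    unfolding jacobi_std_def coeff_sum
    by (intro sum.cong) (auto simp: lin coeff_eq_0)
  also have "\<dots> = jacobi_coeff \<alpha> \<beta> l l / 2 ^ l" by simp
  also have "jacobi_coeff \<alpha> \<beta> l l = pochhammer (real l + \<alpha> + \<beta> + 1) l / fact l"
    using ab pochhammer_pos[of "\<beta> + 1" l] by (simp add: jacobi_coeff_def)
  finally have c: "coeff (P l) l = pochhammer (real l + \<alpha> + \<beta> + 1) l / fact l / 2 ^ l" .
  \<comment> \<open>For l = 0 the base \<alpha> + \<beta> + 1 may be negative, but then the product
    is empty.\<close>
  have pos: "pochhammer (real l + \<alpha> + \<beta> + 1) l > 0"
    using ab by (cases l) (auto intro!: pochhammer_pos)
  have "degree (P l) \<le> l"
    unfolding jacobi_std_def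
    by (intro degree_sum_le order.trans[OF degree_smult_le]) (auto simp: lin)
  then show d: "degree (P l) = l"
    using c pos by (intro antisym le_degree) auto
  show "lead_coeff (P l) > 0" "lead_coeff (P l) = pochhammer (real l + \<alpha> + \<beta> + 1) l / fact l / 2 ^ l"
    using c pos by (auto simp: d)
qed

lemma Y_power_coeff: "degree (Y ^ i) = i" "coeff (Y ^ i) i = (-1) ^ i / 2 ^ i"
proof -
  show 1: "degree (Y ^ i) = i" by (simp add: degree_power_eq)
  have "lead_coeff (Y ^ i) = (- (1/2)) ^ i" by (subst lead_coeff_power) simp
  also have "\<dots> = (-1) ^ i / 2 ^ i" by (simp add: power_divide[symmetric])
  finally show "coeff (Y ^ i) i = (-1) ^ i / 2 ^ i" unfolding 1 .
qed

text \<open>The powers of (1 - t) / 2 serve as the triangular family: they need not be mutually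
  orthogonal, and their moments with \<open>jacobi_std\<close> are explicit.\<close>

lemma jacobi_std_orthogonal_lower:
  assumes "\<And>i. i \<ge> l \<Longrightarrow> coeff p i = 0"
  shows "JF (P l * p) = 0"
proof (rule orthogonal_to_lower_degree[where G="\<lambda>n. Y ^ n" and k=l])
  show "JF (P l * Y ^ n) = 0" if "n < l" for n
    using that by (simp add: jacobi_std_moment)
qed (use assms JF_add jacobi_functional_smult Y_power_coeff(1) in auto)

lemma jacobi_std_orthogonal: "k \<noteq> l \<Longrightarrow> JF (P k * P l) = 0"
proof (induction k l rule: linorder_wlog)
  case (le a b)
  then have "JF (P b * P a) = 0"
    by (intro jacobi_std_orthogonal_lower) (auto simp: coeff_eq_0 jacobi_std_degree)
  then show ?case by (simp add: mult.commute)
qed (simp add: mult.commute)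

lemma jacobi_norm2_pos: "jacobi_norm2 \<alpha> \<beta> l > 0"
proof -
  have "pochhammer (real l + \<alpha> + \<beta> + 1) l > 0"
    using ab by (cases l) (auto intro!: pochhammer_pos)
  then show ?thesis
    using ab by (auto simp: jacobi_norm2_def intro!: divide_pos_pos mult_pos_pos pochhammer_pos)
qed

lemma jacobi_std_norm: "JF (P l * P l) = jacobi_norm2 \<alpha> \<beta> l * JF 1"
proof -
  \<comment> \<open>Quotient of the leading coefficients of P l and Y ^ l. Replacing one factor P l
    by c Y ^ l changes it only in degrees below l, which are orthogonal to the other factor.\<close>
  define c where "c = pochhammer (real l + \<alpha> + \<beta> + 1) l / fact l * (-1) ^ l"
  have "JF (P l * (P l - smult c (Y ^ l))) = 0"
  proof (rule jacobi_std_orthogonal_lower)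
    fix i assume "l \<le> i"
    then show "coeff (P l - smult c (Y ^ l)) i = 0"
      using jacobi_std_lead[of l]
      by (cases "i = l") (auto simp: coeff_eq_0 jacobi_std_degree Y_power_coeff c_def)
  qed
  then have "JF (P l * P l) = c * JF (P l * Y ^ l)"
    using JF_add[of "P l * (P l - smult c (Y ^ l))" "smult c (P l * Y ^ l)"]
    by (simp add: algebra_simps jacobi_functional_smult)
  also have "\<dots> = pochhammer (real l + \<alpha> + \<beta> + 1) l / fact l * (2 powr (\<alpha> + \<beta> + 1) * pochhammer (\<beta> + 1) l *
      Gamma (\<beta> + 1) * Gamma (\<alpha> + 1 + real l) / Gamma (\<alpha> + \<beta> + 2 + real (2 * l)))"
    by (simp add: jacobi_std_moment c_def pochhammer_fact[symmetric] add_ac)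
  also have "Gamma (\<alpha> + 1 + real l) = Gamma (\<alpha> + 1) * pochhammer (\<alpha> + 1) l"
    using ab by (simp add: pochhammer_Gamma Gamma_real_pos[THEN less_imp_neq, symmetric] nonpos_Ints_def)
  also have "Gamma (\<alpha> + \<beta> + 2 + real (2 * l)) = Gamma (\<alpha> + \<beta> + 2) * pochhammer (\<alpha> + \<beta> + 2) (2 * l)"
    using ab by (simp add: pochhammer_Gamma Gamma_real_pos[THEN less_imp_neq, symmetric] nonpos_Ints_def)
  finally have "JF (P l * P l) = jacobi_norm2 \<alpha> \<beta> l *
      (2 powr (\<alpha> + \<beta> + 1) * (Gamma (\<beta> + 1) * Gamma (\<alpha> + 1) / Gamma (\<alpha> + \<beta> + 2)))"
    by (simp add: jacobi_norm2_def mult_ac)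
  also have "2 powr (\<alpha> + \<beta> + 1) * (Gamma (\<beta> + 1) * Gamma (\<alpha> + 1) / Gamma (\<alpha> + \<beta> + 2)) = JF 1"
    using jacobi_functional_moment[OF ab, of 0 0] by (simp add: Beta_def add_ac)
  finally show ?thesis .
qed

text \<open>Uniqueness up to scalars applies; unit norm and a positive leading coefficient then
  force the scalar to be 1.\<close>

lemma jacobi_eq: "jacobi \<alpha> \<beta> l = smult (1 / sqrt (jacobi_norm2 \<alpha> \<beta> l)) (P l)"
proof -
  have L1: "JF 1 > 0" by (rule jacobi_functional_pos) (use ab in auto)
  define w where "w = (\<lambda>t. jacobi_weight \<alpha> \<beta> t / (LINT u:{-1..1}|lebesgue. jacobi_weight \<alpha> \<beta> u))"
  have L1_eq: "(LINT u:{-1..1}|lebesgue. jacobi_weight \<alpha> \<beta> u) = JF 1"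
    by (simp add: jacobi_functional_def)
  have orth: "(LINT z:{-1..1}|lebesgue. poly p z * poly q z * w z) = JF (p * q) / JF 1" for p q
    unfolding w_def L1_eq by (simp add: jacobi_functional_def)
  define J where "J l = smult (1 / sqrt (jacobi_norm2 \<alpha> \<beta> l)) (P l)" for l
  have N: "jacobi_norm2 \<alpha> \<beta> l > 0" for l by (rule jacobi_norm2_pos)
  have J: "degree (J l) = l" "lead_coeff (J l) > 0" "JF (J l * J l) = JF 1" for l
    using N[of l] jacobi_std_degree[of l] jacobi_std_norm[of l]
    by (auto simp: J_def jacobi_functional_smult)
  have J_orth: "JF (J k * J l) = 0" if "k \<noteq> l" for k l
    using that by (simp add: J_def jacobi_functional_smult jacobi_std_orthogonal)
  have "jacobi \<alpha> \<beta> = J"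
    unfolding jacobi_def orthonormal_polys_def w_def[symmetric] orth
  proof (rule the_equality)
    show "\<forall>k. degree (J k) = k \<and> 0 < lead_coeff (J k) \<and>
        (\<forall>l. JF (J k * J l) / JF 1 = (if k = l then 1 else 0))"
      using J J_orth L1 by auto
    fix p assume p: "\<forall>k. degree (p k) = k \<and> 0 < lead_coeff (p k) \<and>
        (\<forall>l. JF (p k * p l) / JF 1 = (if k = l then 1 else 0))"
    have p_orth: "JF (p k * p l) = (if k = l then JF 1 else 0)" for k l
      using p L1 by (metis divide_eq_0_iff divide_eq_1_iff less_irrefl)
    show "p = J"
    proof
      fix k
      define c where "c = lead_coeff (p k) / lead_coeff (J k)"
      have eq: "p k = smult c (J k)"
        unfolding c_def
      proof (rule orthogonal_family_unique[where \<Lambda>=JF])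
        show "J n \<noteq> 0" "p n \<noteq> 0" for n using J(2)[of n] p by (metis leading_coeff_0_iff less_irrefl)+
      qed (use JF_add jacobi_functional_smult J J_orth p p_orth L1 in auto)
      have c: "c > 0" unfolding c_def using p J(2)[of k] by (metis divide_pos_pos)
      have "JF (p k * p k) = c * (c * JF (J k * J k))"
        by (subst (1 2) eq) (simp add: jacobi_functional_smult)
      then have "c * c = 1" using p_orth[of k k] J(3)[of k] L1 by simp
      with c have "c = 1" using square_eq_1_iff[of c] by linarith
      with eq show "p k = J k" by simp
    qed
  qed
  then show ?thesis by (simp add: J_def)
qed

end

section \<open>Discrete orthogonality on the circle\<close>

text \<open>The coefficient of (2 s)^(k - 2 i) in the Gegenbauer polynomial. It is set to zero past
  the last power, so that sums may run up to k and truncated exponents do no harm.\<close>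

definition gegenbauer_coeff :: "real \<Rightarrow> nat \<Rightarrow> nat \<Rightarrow> real" where
  "gegenbauer_coeff lam k i =
    (if 2 * i \<le> k then (-1) ^ i * pochhammer lam (k - i) / (fact i * fact (k - 2 * i)) else 0)"

lemma gegenbauer_coeff_rec:
  "(real k + 2) * gegenbauer_coeff lam (k + 2) i = (real k + 1 + lam) * gegenbauer_coeff lam (k + 1) i
     - (real k + 2 * lam) * (if i = 0 then 0 else gegenbauer_coeff lam k (i - 1))"
proof (cases i)
  case 0
  have "(real k + 2) * (pochhammer lam (k + 2) / fact (k + 2)) = pochhammer lam (k + 2) / fact (k + 1)"
    by (simp add: divide_simps)
  then show ?thesis using 0 by (simp add: gegenbauer_coeff_def pochhammer_Suc add_ac)
next
  case (Suc j)
  show ?thesis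
  proof (cases "2 * j \<le> k")
    case True
    then obtain n where k: "k = 2 * j + n" using le_Suc_ex by blast
    have p: "pochhammer lam (k + 2 - i) = pochhammer lam (j + n) * (lam + real j + real n)"
      "pochhammer lam (k + 1 - i) = pochhammer lam (j + n)" "pochhammer lam (k - j) = pochhammer lam (j + n)"
      using k Suc pochhammer_Suc[of lam "j + n"] by (simp_all add: algebra_simps)
    have c2: "gegenbauer_coeff lam (k + 2) i = (-1) ^ Suc j * (pochhammer lam (j + n) * (lam + real j + real n)) / ((real j + 1) * fact j * fact n)"
      unfolding gegenbauer_coeff_def p using k Suc by (simp add: add_ac)
    have c0: "gegenbauer_coeff lam k (i - 1) = (-1) ^ j * pochhammer lam (j + n) / (fact j * fact n)"
      using k Suc p(3) by (simp add: gegenbauer_coeff_def)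
    have c1: "gegenbauer_coeff lam (k + 1) i = (-1) ^ Suc j * pochhammer lam (j + n) * real n / ((real j + 1) * fact j * fact n)"
    \<comment> \<open>For n = 0 the left side is zero because 2 i = k + 2 exceeds k + 1, the right
      side because of the factor \<open>real n\<close>. The formula thus covers the end of the
      coefficient range.\<close>
    proof (cases n)
      case 0
      then show ?thesis using k Suc by (simp add: gegenbauer_coeff_def)
    next
      case (Suc n')
      have "gegenbauer_coeff lam (k + 1) i = (-1) ^ Suc j * pochhammer lam (j + n) / ((real j + 1) * fact j * fact n')"
        unfolding gegenbauer_coeff_def p using k \<open>i = Suc j\<close> Suc by (simp add: add_ac)
      also have "\<dots> = (-1) ^ Suc j * pochhammer lam (j + n) * real n / ((real j + 1) * fact j * fact n)"
        unfolding Suc fact_Suc by (simp del: of_nat_Suc)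
      finally show ?thesis .
    qed
    have rk: "real k = 2 * real j + real n" using k by simp
    have "i \<noteq> 0" using Suc by simp
    have "real j + 1 \<noteq> 0" by simp
    then show ?thesis
      unfolding c2 c1 c0 rk if_not_P[OF \<open>i \<noteq> 0\<close>]
      by (simp add: divide_simps) (simp add: algebra_simps)
  next
    case False
    then show ?thesis using Suc by (simp add: gegenbauer_coeff_def)
  qed
qed

lemma gegenbauer_rec_eq_sum:
  "poly (gegenbauer_rec lam k) s = (\<Sum>i\<le>k. gegenbauer_coeff lam k i * (2 * s) ^ (k - 2 * i))"
proof (induction lam k rule: gegenbauer_rec.induct)
  case (3 lam k)
  have "(real k + 2) * (\<Sum>i\<le>k+2. gegenbauer_coeff lam (k+2) i * (2 * s) ^ (k + 2 - 2 * i)) =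
     (\<Sum>i\<le>k+2. (real k + 1 + lam) * (gegenbauer_coeff lam (k+1) i * (2 * s) ^ (k + 2 - 2 * i))) -
     (\<Sum>i\<le>k+2. (real k + 2 * lam) * ((if i = 0 then 0 else gegenbauer_coeff lam k (i - 1)) * (2 * s) ^ (k + 2 - 2 * i)))"
    unfolding sum_distrib_left sum_subtractf[symmetric]
    by (intro sum.cong refl) (simp only: mult.assoc[symmetric] gegenbauer_coeff_rec left_diff_distrib)
  also have "(\<Sum>i\<le>k+2. (real k + 1 + lam) * (gegenbauer_coeff lam (k+1) i * (2 * s) ^ (k + 2 - 2 * i)))
      = (\<Sum>i\<le>k+1. (real k + 1 + lam) * (gegenbauer_coeff lam (k+1) i * (2 * s) ^ (k + 2 - 2 * i)))"
    by (simp add: gegenbauer_coeff_def)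
  also have "\<dots> = 2 * (real k + 1 + lam) * s * poly (gegenbauer_rec lam (Suc k)) s"
  proof -
    \<comment> \<open>The truncated exponent drops by one only for 2 i \<le> k + 1; beyond that the
      coefficient is zero.\<close>
    have "gegenbauer_coeff lam (k+1) i * (2 * s) ^ (k + 2 - 2 * i) = 2 * s * (gegenbauer_coeff lam (k+1) i * (2 * s) ^ (k + 1 - 2 * i))" for i
    proof (cases "2 * i \<le> k + 1")
      case True
      then have "k + 2 - 2 * i = Suc (k + 1 - 2 * i)" by simp
      then show ?thesis by simp
    qed (simp add: gegenbauer_coeff_def)
    then have "(real k + 1 + lam) * (gegenbauer_coeff lam (k+1) i * (2 * s) ^ (k + 2 - 2 * i)) =
       2 * (real k + 1 + lam) * s * (gegenbauer_coeff lam (k+1) i * (2 * s) ^ (k + 1 - 2 * i))" for i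
      by (simp only: mult_ac)
    then show ?thesis unfolding 3(1) sum_distrib_left by (simp only: Suc_eq_plus1)
  qed
  also have "(\<Sum>i\<le>k+2. (real k + 2 * lam) * ((if i = 0 then 0 else gegenbauer_coeff lam k (i - 1)) * (2 * s) ^ (k + 2 - 2 * i)))
      = (\<Sum>i\<le>Suc k. (real k + 2 * lam) * (gegenbauer_coeff lam k i * (2 * s) ^ (k - 2 * i)))"
    by (subst add_2_eq_Suc', subst sum.atMost_Suc_shift) (simp del: sum.atMost_Suc)
  also have "\<dots> = (real k + 2 * lam) * poly (gegenbauer_rec lam k) s"
    unfolding 3(2) by (simp add: gegenbauer_coeff_def sum_distrib_left)
  finally have "(real k + 2) * (\<Sum>i\<le>k+2. gegenbauer_coeff lam (k+2) i * (2 * s) ^ (k + 2 - 2 * i))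
     = (real k + 2) * poly (gegenbauer_rec lam (Suc (Suc k))) s"
    unfolding gegenbauer_rec_step .
  moreover have "real k + 2 \<noteq> 0" by simp
  ultimately have "(\<Sum>i\<le>k+2. gegenbauer_coeff lam (k+2) i * (2 * s) ^ (k + 2 - 2 * i))
     = poly (gegenbauer_rec lam (Suc (Suc k))) s"
    by (rule mult_left_cancel[THEN iffD1, rotated])
  then show ?case unfolding add_2_eq_Suc' by (rule sym)
qed (simp_all add: gegenbauer_coeff_def)

lemma cos_power_expansion:
  "(2 * cos \<theta>) ^ n / fact n = (\<Sum>a\<le>n. cos ((real n - 2 * real a) * \<theta>) / (fact a * fact (n - a)))"
proof -
  have "complex_of_real ((2 * cos \<theta>) ^ n) = (cis (- \<theta>) + cis \<theta>) ^ n"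
    by (simp add: complex_eq_iff flip: of_real_power)
  also have "\<dots> = (\<Sum>a\<le>n. of_nat (n choose a) * cis ((real n - 2 * real a) * \<theta>))"
    unfolding binomial_ring
  proof (intro sum.cong refl)
    fix a assume "a \<in> {..n}"
    then have "cis (- \<theta>) ^ a * cis \<theta> ^ (n - a) = cis ((real n - 2 * real a) * \<theta>)"
      by (simp add: Complex.DeMoivre cis_mult of_nat_diff algebra_simps)
    then show "of_nat (n choose a) * cis (- \<theta>) ^ a * cis \<theta> ^ (n - a) = of_nat (n choose a) * cis ((real n - 2 * real a) * \<theta>)"
      by simp
  qed
  finally have "(2 * cos \<theta>) ^ n = Re (\<Sum>a\<le>n. of_nat (n choose a) * cis ((real n - 2 * real a) * \<theta>))"
    by (metis Re_complex_of_real)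
  also have "\<dots> = (\<Sum>a\<le>n. real (n choose a) * cos ((real n - 2 * real a) * \<theta>))"
    by simp
  also have "\<dots> = (\<Sum>a\<le>n. fact n * (cos ((real n - 2 * real a) * \<theta>) / (fact a * fact (n - a))))"
    by (auto simp: binomial_fact intro!: sum.cong)
  finally have "(2 * cos \<theta>) ^ n = fact n * (\<Sum>a\<le>n. cos ((real n - 2 * real a) * \<theta>) / (fact a * fact (n - a)))"
    unfolding sum_distrib_left[symmetric] .
  then show ?thesis by simp
qed

text \<open>The coefficient of cos ((k - 2 l) \<theta>) in the Gegenbauer polynomial at r cos
  \<theta>. As l runs up to k, every nonzero frequency occurs twice, with opposite signs, which
  gives the symmetry under l to k - l.\<close>

definition ridge_radial :: "real \<Rightarrow> nat \<Rightarrow> nat \<Rightarrow> real \<Rightarrow> real" where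
  "ridge_radial lam k l r = (\<Sum>i\<le>k. (if i \<le> l \<and> i + l \<le> k then
     (-1) ^ i * pochhammer lam (k - i) / (fact i * fact (l - i) * fact (k - l - i)) else 0) * r ^ (k - 2 * i))"

lemma ridge_radial_sym: "l \<le> k \<Longrightarrow> ridge_radial lam k (k - l) r = ridge_radial lam k l r"
  unfolding ridge_radial_def by (intro sum.cong refl) (auto simp: mult_ac)

lemma gegenbauer_ridge_expansion:
  "poly (gegenbauer_rec lam k) (r * cos \<theta>) = (\<Sum>l\<le>k. ridge_radial lam k l r * cos ((real k - 2 * real l) * \<theta>))"
proof -
  define b where "b i l = (if i \<le> l \<and> i + l \<le> k then
     (-1) ^ i * pochhammer lam (k - i) / (fact i * fact (l - i) * fact (k - l - i)) else 0)" for i l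
  have "gegenbauer_coeff lam k i * (2 * (r * cos \<theta>)) ^ (k - 2 * i)
    = (\<Sum>l\<le>k. b i l * r ^ (k - 2 * i) * cos ((real k - 2 * real l) * \<theta>))" (is "?L = ?R") for i
  proof (cases "2 * i \<le> k")
    case True
    have "?R = (\<Sum>l\<in>{i..k-i}. b i l * r ^ (k - 2 * i) * cos ((real k - 2 * real l) * \<theta>))"
      using True by (intro sum.mono_neutral_right) (auto simp: b_def)
    \<comment> \<open>The shift l = a + i lines up the terms with the expansion of the power k - 2 i
      of 2 cos \<theta>.\<close>
    also have "\<dots> = (\<Sum>a\<le>k - 2 * i. b i (a + i) * r ^ (k - 2 * i) * cos ((real k - 2 * real (a + i)) * \<theta>))"
      using True by (intro sum.reindex_bij_witness[of _ "\<lambda>a. a + i" "\<lambda>l. l - i"]) auto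
    also have "\<dots> = (\<Sum>a\<le>k - 2 * i. (-1) ^ i * pochhammer lam (k - i) / fact i * r ^ (k - 2 * i) *
        (cos ((real (k - 2 * i) - 2 * real a) * \<theta>) / (fact a * fact (k - 2 * i - a))))"
    proof (intro sum.cong refl)
      fix a assume "a \<in> {..k - 2 * i}"
      then have e: "i \<le> a + i \<and> i + (a + i) \<le> k" "k - (a + i) - i = k - 2 * i - a"
        "real k - 2 * real (a + i) = real (k - 2 * i) - 2 * real a"
        using True by auto
      show "b i (a + i) * r ^ (k - 2 * i) * cos ((real k - 2 * real (a + i)) * \<theta>) =
        (-1) ^ i * pochhammer lam (k - i) / fact i * r ^ (k - 2 * i) *
        (cos ((real (k - 2 * i) - 2 * real a) * \<theta>) / (fact a * fact (k - 2 * i - a)))"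
        unfolding b_def if_P[OF e(1)] e(2,3) by simp
    qed
    also have "\<dots> = (-1) ^ i * pochhammer lam (k - i) / fact i * r ^ (k - 2 * i) * ((2 * cos \<theta>) ^ (k - 2 * i) / fact (k - 2 * i))"
      unfolding cos_power_expansion sum_distrib_left ..
    also have "\<dots> = ?L"
      using True by (simp add: gegenbauer_coeff_def power_mult_distrib)
    finally show ?thesis by simp
  next
    case False
    then have "b i l = 0" for l by (auto simp: b_def)
    then show ?thesis using False by (simp add: gegenbauer_coeff_def)
  qed
  then have "poly (gegenbauer_rec lam k) (r * cos \<theta>) =
     (\<Sum>i\<le>k. \<Sum>l\<le>k. b i l * r ^ (k - 2 * i) * cos ((real k - 2 * real l) * \<theta>))"
    unfolding gegenbauer_rec_eq_sum by simp
  also have "\<dots> = (\<Sum>l\<le>k. ridge_radial lam k l r * cos ((real k - 2 * real l) * \<theta>))"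
    unfolding ridge_radial_def b_def[symmetric] sum_distrib_right by (rule sum.swap)
  finally show ?thesis .
qed

lemma fact_add_pochhammer: "fact (j + l) = (fact j * pochhammer (real j + 1) l :: real)"
  using pochhammer_product'[of "1::real" j l] by (simp add: pochhammer_fact add.commute)

text \<open>Reversing the sum by i to l - i produces the powers r^(k - 2 l + 2 i), and (1 + t) / 2 =
  r^2 at t = 2 r^2 - 1 matches the powers in which \<open>jacobi_std\<close> is written. This is the
  origin of the parameters \<mu> - 1/2 = lam - 1 and k - 2 l in \<open>disk_basis\<close>.\<close>

lemma ridge_radial_jacobi:
  assumes "2 * l \<le> k"
  shows "ridge_radial lam k l r = pochhammer lam (k - l) / fact (k - l) * r ^ (k - 2 * l) *
    poly (jacobi_std (lam - 1) (real (k - 2 * l)) l) (2 * r\<^sup>2 - 1)"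
proof -
  obtain j where k: "k = 2 * l + j" using assms le_Suc_ex by blast
  have j: "k - 2 * l = j" "k - l = j + l" using k by auto
  have "ridge_radial lam k l r = (\<Sum>i\<in>{..l}. (-1) ^ i * pochhammer lam (k - i) /
      (fact i * fact (l - i) * fact (k - l - i)) * r ^ (k - 2 * i))"
    unfolding ridge_radial_def using k by (intro sum.mono_neutral_cong_right) auto
  also have "\<dots> = (\<Sum>i\<le>l. (-1) ^ (l - i) * pochhammer lam (j + l + i) /
      (fact (l - i) * fact i * fact (j + i)) * r ^ (j + 2 * i))"
  proof (rule sum.reindex_bij_witness[of _ "\<lambda>i. l - i" "\<lambda>i. l - i"])
    fix i assume "i \<in> {..l}"
    then have "l - (l - i) = i" "j + l + (l - i) = k - i" "j + (l - i) = k - l - i" "j + 2 * (l - i) = k - 2 * i"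
      using k by auto
    then show "(-1) ^ (l - (l - i)) * pochhammer lam (j + l + (l - i)) / (fact (l - (l - i)) * fact (l - i) * fact (j + (l - i))) *
       r ^ (j + 2 * (l - i)) = (-1) ^ i * pochhammer lam (k - i) / (fact i * fact (l - i) * fact (k - l - i)) * r ^ (k - 2 * i)"
      by (simp only:)
  qed auto
  also have "\<dots> = (\<Sum>i\<le>l. pochhammer lam (j + l) / fact (j + l) * r ^ j * (jacobi_coeff (lam - 1) (real j) l i * (r\<^sup>2) ^ i))"
  proof (intro sum.cong refl)
    fix i
    have p: "pochhammer lam (j + l + i) = pochhammer lam (j + l) * pochhammer (real l + (lam - 1) + real j + 1) i"
      by (subst pochhammer_product') (simp add: add_ac)
    have "pochhammer (real j + 1) l \<noteq> 0" "pochhammer (real j + 1) i \<noteq> 0"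
      using pochhammer_pos[of "real j + 1" l] pochhammer_pos[of "real j + 1" i] by auto
    then show "(-1) ^ (l - i) * pochhammer lam (j + l + i) / (fact (l - i) * fact i * fact (j + i)) * r ^ (j + 2 * i) =
      pochhammer lam (j + l) / fact (j + l) * r ^ j * (jacobi_coeff (lam - 1) (real j) l i * (r\<^sup>2) ^ i)"
      unfolding p fact_add_pochhammer jacobi_coeff_def power_add power_mult by (simp add: mult_ac)
  qed
  also have "\<dots> = pochhammer lam (j + l) / fact (j + l) * r ^ j * poly (jacobi_std (lam - 1) (real j) l) (2 * r\<^sup>2 - 1)"
    by (simp add: jacobi_std_def poly_sum sum_distrib_left field_simps)
  finally show ?thesis by (simp add: j)
qed

section \<open>Sums over equidistant angles\<close>

definition equi_angle :: "nat \<Rightarrow> nat \<Rightarrow> real" where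
  "equi_angle m \<nu> = 2 * real \<nu> * pi / (2 * real m + 1)"

lemma sum_cis_equi_angle:
  fixes q :: int
  shows "(\<Sum>\<nu>=0..2*m. cis (of_int q * equi_angle m \<nu>)) = (if int (2 * m + 1) dvd q then of_nat (2 * m + 1) else 0)"
proof -
  define N where "N = 2 * m + 1"
  define z where "z = cis (2 * pi * of_int q / real N)"
  have N: "real N > 0" "2 * real m + 1 = real N" by (auto simp: N_def)
  have "(\<Sum>\<nu>=0..2*m. cis (of_int q * equi_angle m \<nu>)) = (\<Sum>\<nu><N. z ^ \<nu>)"
  proof (rule sum.cong)
    show "{0..2*m} = {..<N}" by (auto simp: N_def)
    show "cis (of_int q * equi_angle m \<nu>) = z ^ \<nu>" for \<nu>
      unfolding z_def Complex.DeMoivre equi_angle_def N(2) by (rule arg_cong[where f=cis]) (simp add: field_simps)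
  qed
  also have "\<dots> = (if int N dvd q then of_nat N else 0)"
  proof (cases "int N dvd q")
    case True
    then obtain c where "q = int N * c" by auto
    then have "z = cis (2 * pi * of_int c)" using N by (simp add: z_def field_simps)
    also have "\<dots> = 1" by (rule cis_multiple_2pi) simp
    finally show ?thesis using True by simp
  next
    case False
    have "z \<noteq> 1"
    proof
      assume "z = 1"
      then have "cos (2 * pi * of_int q / real N) = 1" by (metis z_def cis.sel(1) one_complex.sel(1))
      then obtain n :: int where "2 * pi * of_int q / real N = of_int n * 2 * pi"
        by (auto simp: cos_one_2pi_int)
      then have "of_int q = of_int n * real N" using N by (simp add: field_simps)
      then have "q = n * int N" by (metis of_int_eq_iff of_int_mult of_int_of_nat_eq)
      then show False using False by simp
    qed
    moreover have "z ^ N = 1"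
    proof -
      have "z ^ N = cis (2 * pi * of_int q)" using N by (simp add: z_def Complex.DeMoivre)
      then show ?thesis by (simp add: cis_multiple_2pi)
    qed
    ultimately show ?thesis using False by (simp add: geometric_sum)
  qed
  finally show ?thesis by (simp add: N_def)
qed

lemma sum_trig_equi_angle:
  fixes q :: int
  shows "(\<Sum>\<nu>=0..2*m. cos (\<alpha> - of_int q * equi_angle m \<nu>)) = (if int (2 * m + 1) dvd q then (2 * real m + 1) * cos \<alpha> else 0)"
    and "(\<Sum>\<nu>=0..2*m. sin (\<alpha> - of_int q * equi_angle m \<nu>)) = (if int (2 * m + 1) dvd q then (2 * real m + 1) * sin \<alpha> else 0)"
proof -
  have *: "(\<Sum>\<nu>=0..2*m. cis (\<alpha> - of_int q * equi_angle m \<nu>)) = cis \<alpha> * (if int (2 * m + 1) dvd q then of_nat (2 * m + 1) else 0)"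
    using sum_cis_equi_angle[of "-q" m, symmetric]
    by (simp add: sum_distrib_left cis_mult)
  show "(\<Sum>\<nu>=0..2*m. cos (\<alpha> - of_int q * equi_angle m \<nu>)) = (if int (2 * m + 1) dvd q then (2 * real m + 1) * cos \<alpha> else 0)"
    using arg_cong[OF *, of Re] by (auto split: if_splits)
  show "(\<Sum>\<nu>=0..2*m. sin (\<alpha> - of_int q * equi_angle m \<nu>)) = (if int (2 * m + 1) dvd q then (2 * real m + 1) * sin \<alpha> else 0)"
    using arg_cong[OF *, of Im] by (auto split: if_splits)
qed

text \<open>Only even frequencies of size at most \<open>4 * m\<close> occur below, and the odd number
  \<open>2 * m + 1\<close> divides none of them except 0.\<close>

lemma odd_dvd_twice_diff:
  assumes "l \<le> k" "i \<le> k" "k \<le> 2 * m"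
  shows "int (2 * m + 1) dvd 2 * (int i - int l) \<longleftrightarrow> i = l"
proof
  assume "int (2 * m + 1) dvd 2 * (int i - int l)"
  moreover have "coprime (int (2 * m + 1)) 2" by simp
  ultimately have "int (2 * m + 1) dvd int i - int l"
    using coprime_dvd_mult_right_iff by blast
  then have "int i - int l = 0"
    using assms dvd_imp_le_int[of "int i - int l" "int (2 * m + 1)"] by linarith
  then show "i = l" by simp
qed simp

text \<open>The product formulas leave frequencies q1 and q2, and only those equal to zero survive
  the summation: l = l0 or l = k - l0. The two conditions coincide for k = 2 * l0, where both must
  be counted. In the sine case the minus sign of the second term is absorbed by p = - j.\<close>

lemma sum_ridge_angular:
  assumes l: "l \<le> k" and l0: "2 * l0 \<le> k" and k: "k \<le> 2 * m"
  shows "(\<Sum>\<nu>=0..2*m. cos ((real k - 2 * real l) * (\<theta> - equi_angle m \<nu>)) * angular (k - 2 * l0) \<epsilon> (equi_angle m \<nu>))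
    = (2 * real m + 1) / 2 * ((if l = l0 then 1 else 0) + (if l = k - l0 then 1 else 0)) * angular (k - 2 * l0) \<epsilon> \<theta>"
proof -
  define p where "p = real k - 2 * real l"
  define j where "j = real (k - 2 * l0)"
  have j: "j = real k - 2 * real l0" using l0 by (simp add: j_def of_nat_diff)
  define q1 where "q1 = 2 * (int l0 - int l)"
  define q2 where "q2 = 2 * (int (k - l0) - int l)"
  have q: "p - j = of_int q1" "p + j = of_int q2"
    using l0 by (auto simp: p_def j q1_def q2_def of_nat_diff)
  have d: "int (2 * m + 1) dvd q1 \<longleftrightarrow> l = l0" "int (2 * m + 1) dvd q2 \<longleftrightarrow> l = k - l0"
    unfolding q1_def q2_def
    using odd_dvd_twice_diff[OF l, of l0] odd_dvd_twice_diff[OF l, of "k - l0"] l0 k by auto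
  have p_eq: "p = j" if "l = l0" using that by (simp add: p_def j)
  have p_eq': "p = - j" if "l = k - l0" using that l0 by (simp add: p_def j of_nat_diff)
  have c: "cos (p * (\<theta> - \<phi>)) * cos (j * \<phi>) = (cos (p * \<theta> - of_int q2 * \<phi>) + cos (p * \<theta> - of_int q1 * \<phi>)) / 2"
    and s: "cos (p * (\<theta> - \<phi>)) * sin (j * \<phi>) = (sin (p * \<theta> - of_int q1 * \<phi>) - sin (p * \<theta> - of_int q2 * \<phi>)) / 2" for \<phi>
  proof -
    have "p * \<theta> - of_int q2 * \<phi> = p * (\<theta> - \<phi>) - j * \<phi>" "p * \<theta> - of_int q1 * \<phi> = p * (\<theta> - \<phi>) + j * \<phi>"
      unfolding q[symmetric] by (simp_all add: algebra_simps)
    then show "cos (p * (\<theta> - \<phi>)) * cos (j * \<phi>) = (cos (p * \<theta> - of_int q2 * \<phi>) + cos (p * \<theta> - of_int q1 * \<phi>)) / 2"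
      "cos (p * (\<theta> - \<phi>)) * sin (j * \<phi>) = (sin (p * \<theta> - of_int q1 * \<phi>) - sin (p * \<theta> - of_int q2 * \<phi>)) / 2"
      by (simp_all add: cos_add cos_diff sin_add sin_diff)
  qed
  show ?thesis
  proof (cases "\<epsilon> = 0")
    case True
    have "(\<Sum>\<nu>=0..2*m. cos (p * (\<theta> - equi_angle m \<nu>)) * cos (j * equi_angle m \<nu>)) =
      ((if l = k - l0 then (2 * real m + 1) * cos (p * \<theta>) else 0) + (if l = l0 then (2 * real m + 1) * cos (p * \<theta>) else 0)) / 2"
      unfolding c sum_divide_distrib[symmetric] sum.distrib sum_trig_equi_angle d ..
    also have "\<dots> = (2 * real m + 1) / 2 * ((if l = l0 then 1 else 0) + (if l = k - l0 then 1 else 0)) * cos (j * \<theta>)"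
      using p_eq p_eq' by (auto simp: field_simps)
    finally show ?thesis using True by (simp add: angular_def p_def j_def)
  next
    case False
    have "(\<Sum>\<nu>=0..2*m. cos (p * (\<theta> - equi_angle m \<nu>)) * sin (j * equi_angle m \<nu>)) =
      ((if l = l0 then (2 * real m + 1) * sin (p * \<theta>) else 0) - (if l = k - l0 then (2 * real m + 1) * sin (p * \<theta>) else 0)) / 2"
      unfolding s sum_divide_distrib[symmetric] sum_subtractf sum_trig_equi_angle d ..
    also have "\<dots> = (2 * real m + 1) / 2 * ((if l = l0 then 1 else 0) + (if l = k - l0 then 1 else 0)) * sin (j * \<theta>)"
      using p_eq p_eq' by (auto simp: field_simps)
    finally show ?thesis using False by (simp add: angular_def p_def j_def)
  qed
qed

text \<open>The surviving indices l0 and k - l0 have the same radial part and each contributes one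
  half; the sum therefore has no case distinction at k = 2 * l0.\<close>

lemma sum_gegenbauer_angular:
  assumes l0: "2 * l0 \<le> k" and k: "k \<le> 2 * m"
  shows "(\<Sum>\<nu>=0..2*m. poly (gegenbauer_rec lam k) (r * cos (\<theta> - equi_angle m \<nu>)) * angular (k - 2 * l0) \<epsilon> (equi_angle m \<nu>))
    = (2 * real m + 1) * ridge_radial lam k l0 r * angular (k - 2 * l0) \<epsilon> \<theta>"
proof -
  let ?S = "angular (k - 2 * l0) \<epsilon>"
  have "(\<Sum>\<nu>=0..2*m. poly (gegenbauer_rec lam k) (r * cos (\<theta> - equi_angle m \<nu>)) * ?S (equi_angle m \<nu>))
    = (\<Sum>l\<le>k. ridge_radial lam k l r * (\<Sum>\<nu>=0..2*m. cos ((real k - 2 * real l) * (\<theta> - equi_angle m \<nu>)) * ?S (equi_angle m \<nu>)))"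
    unfolding gegenbauer_ridge_expansion sum_distrib_left sum_distrib_right
    by (subst sum.swap) (simp add: mult.assoc)
  also have "\<dots> = (\<Sum>l\<le>k. ridge_radial lam k l r *
      ((2 * real m + 1) / 2 * ((if l = l0 then 1 else 0) + (if l = k - l0 then 1 else 0)) * ?S \<theta>))"
    using sum_ridge_angular[OF _ l0 k] by (intro sum.cong refl) simp
  also have "\<dots> = (\<Sum>l\<le>k. (if l = l0 then (2 * real m + 1) / 2 * ridge_radial lam k l r * ?S \<theta> else 0)) +
      (\<Sum>l\<le>k. (if l = k - l0 then (2 * real m + 1) / 2 * ridge_radial lam k l r * ?S \<theta> else 0))"
    unfolding sum.distrib[symmetric] by (intro sum.cong refl) (auto simp: algebra_simps)
  also have "\<dots> = (2 * real m + 1) * ridge_radial lam k l0 r * ?S \<theta>"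
    using l0 ridge_radial_sym[of l0 k lam r] by (simp add: field_simps)
  finally show ?thesis .
qed

section \<open>The disk basis in polar coordinates\<close>

text \<open>Integer frequencies make the value independent of the branch of the angle, so the
  \<open>Arg\<close> in \<open>disk_basis\<close> may be replaced by any polar angle.\<close>

lemma angular_cis: "cis \<theta> = cis \<theta>' \<Longrightarrow> angular j \<epsilon> \<theta> = angular j \<epsilon> \<theta>'"
proof -
  assume "cis \<theta> = cis \<theta>'"
  then have "cis (real j * \<theta>) = cis (real j * \<theta>')" by (metis Complex.DeMoivre)
  then show ?thesis by (auto simp: angular_def complex_eq_iff)
qed

lemma disk_basis_polar:
  assumes "r \<ge> 0"
  shows "disk_basis \<mu> k l \<epsilon> (r * cos \<theta>, r * sin \<theta>) =
    disk_basis_coeff \<mu> l k * poly (jacobi (\<mu> - 1/2) (real (k - 2 * l)) l) (2 * r\<^sup>2 - 1) *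
       r ^ (k - 2 * l) * angular (k - 2 * l) \<epsilon> \<theta>"
proof -
  have "(r * cos \<theta>)\<^sup>2 + (r * sin \<theta>)\<^sup>2 = r\<^sup>2 * ((cos \<theta>)\<^sup>2 + (sin \<theta>)\<^sup>2)"
    by (simp only: power_mult_distrib distrib_left)
  then have n: "norm (r * cos \<theta>, r * sin \<theta>) = r"
    using assms by (simp add: norm_Pair)
  have "r ^ (k - 2 * l) * angular (k - 2 * l) \<epsilon> (Arg (Complex (r * cos \<theta>) (r * sin \<theta>))) =
      r ^ (k - 2 * l) * angular (k - 2 * l) \<epsilon> \<theta>"
  \<comment> \<open>At the origin the angle is arbitrary: a positive power of r kills the term, and
    for exponent 0 the angular part is constant.\<close>
  proof (cases "r = 0")
    case True
    then show ?thesis by (cases "k - 2 * l = 0") (auto simp: angular_def)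
  next
    case False
    have z: "Complex (r * cos \<theta>) (r * sin \<theta>) = of_real r * cis \<theta>"
      by (simp add: complex_eq_iff)
    have "cis (Arg (of_real r * cis \<theta>)) = sgn (of_real r * cis \<theta>)"
      using False by (intro cis_Arg) auto
    also have "\<dots> = cis \<theta>"
      using False assms by (simp add: sgn_mult sgn_of_real)
    finally show ?thesis unfolding z by (metis angular_cis)
  qed
  then show ?thesis
    by (simp add: disk_basis_def n Let_def mult.assoc)
qed

lemma polar_form:
  fixes v :: "real \<times> real"
  obtains r \<theta> where "r \<ge> 0" "v = (r * cos \<theta>, r * sin \<theta>)"
proof
  have "rcis (cmod (Complex (fst v) (snd v))) (Arg (Complex (fst v) (snd v))) = Complex (fst v) (snd v)"
    by (rule rcis_cmod_Arg)
  then show "v = (cmod (Complex (fst v) (snd v)) * cos (Arg (Complex (fst v) (snd v))), cmod (Complex (fst v) (snd v)) * sin (Arg (Complex (fst v) (snd v))))"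
    by (simp add: prod_eq_iff complex_eq_iff)
qed simp

text \<open>The ridge polynomial of the overview. Its leading factor inverts the factor of
  \<open>gegenbauer_rec_norm\<close>, so values on the circle are reproduced with constant 1;
  \<open>D_kernel\<close> contains the same factor.\<close>

definition ridge_poly :: "real \<Rightarrow> nat \<Rightarrow> real \<Rightarrow> real \<times> real \<Rightarrow> real" where
  "ridge_poly \<mu> k \<xi> v = (real k + \<mu> + 1/2) / (\<mu> + 1/2) *
     poly (gegenbauer (\<mu> + 1/2) k) (fst v * cos \<xi> + snd v * sin \<xi>)"

lemma ridge_poly_polar:
  assumes "\<mu> \<ge> 0"
  shows "ridge_poly \<mu> k \<xi> (r * cos \<theta>, r * sin \<theta>) =
    (real k + \<mu> + 1/2) / (\<mu> + 1/2) * poly (gegenbauer_rec (\<mu> + 1/2) k) (r * cos (\<theta> - \<xi>))"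
proof -
  have "r * cos \<theta> * cos \<xi> + r * sin \<theta> * sin \<xi> = r * cos (\<theta> - \<xi>)"
    by (simp add: cos_diff algebra_simps)
  then show ?thesis by (simp add: ridge_poly_def gegenbauer_eq_rec[OF assms])
qed

lemma disk_basis_eq_ridge_sum:
  assumes \<mu>: "\<mu> \<ge> 0" and l: "2 * l \<le> k" and k: "k \<le> 2 * m"
  shows "ridge_factor \<mu> l k * (1 / (2 * real m + 1)) *
      (\<Sum>\<nu>=0..2*m. ridge_poly \<mu> k (equi_angle m \<nu>) v *
        disk_basis \<mu> k l \<epsilon> (cos (equi_angle m \<nu>), sin (equi_angle m \<nu>))) = disk_basis \<mu> k l \<epsilon> v"
proof -
  obtain r \<theta> where r: "r \<ge> 0" and v: "v = (r * cos \<theta>, r * sin \<theta>)" using polar_form .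
  define lam where "lam = \<mu> + 1/2"
  have lam: "lam > 0" and al: "\<mu> - 1/2 + 1 = lam" using \<mu> by (auto simp: lam_def)
  define j where "j = k - 2 * l"
  define N where "N = jacobi_norm2 (\<mu> - 1/2) (real j) l"
  define P where "P = jacobi_std (\<mu> - 1/2) (real j) l"
  have J: "jacobi (\<mu> - 1/2) (real j) l = smult (1 / sqrt N) P"
    unfolding N_def P_def using \<mu> by (intro jacobi_eq) auto
  have P1: "poly P 1 = pochhammer lam l / fact l"
    unfolding P_def using jacobi_std_at_1[of "\<mu> - 1/2" "real j" l, unfolded al] \<mu> by simp
  define h where "h = disk_basis_coeff \<mu> l k / sqrt N"
  have e: "disk_basis \<mu> k l \<epsilon> (cos \<phi>, sin \<phi>) = h * poly P 1 * angular j \<epsilon> \<phi>" for \<phi>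
    using disk_basis_polar[of 1 \<mu> k l \<epsilon> \<phi>] by (simp add: j_def[symmetric] J h_def)
  have "(\<Sum>\<nu>=0..2*m. ridge_poly \<mu> k (equi_angle m \<nu>) v * disk_basis \<mu> k l \<epsilon> (cos (equi_angle m \<nu>), sin (equi_angle m \<nu>)))
    = (real k + lam) / lam * h * poly P 1 *
      (\<Sum>\<nu>=0..2*m. poly (gegenbauer_rec lam k) (r * cos (\<theta> - equi_angle m \<nu>)) * angular j \<epsilon> (equi_angle m \<nu>))"
    unfolding v ridge_poly_polar[OF \<mu>] e sum_distrib_left
    by (intro sum.cong refl) (simp add: lam_def add.assoc)
  also have "\<dots> = (real k + lam) / lam * h * poly P 1 * ((2 * real m + 1) * ridge_radial lam k l r * angular j \<epsilon> \<theta>)"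
    unfolding j_def sum_gegenbauer_angular[OF l k] ..
  finally have "ridge_factor \<mu> l k * (1 / (2 * real m + 1)) *
      (\<Sum>\<nu>=0..2*m. ridge_poly \<mu> k (equi_angle m \<nu>) v * disk_basis \<mu> k l \<epsilon> (cos (equi_angle m \<nu>), sin (equi_angle m \<nu>)))
    = (ridge_factor \<mu> l k * ((real k + lam) / lam) * poly P 1 * (pochhammer lam (k - l) / fact (k - l))) *
       (h * poly P (2 * r\<^sup>2 - 1) * r ^ j * angular j \<epsilon> \<theta>)"
    using ridge_radial_jacobi[OF l, of lam r] by (simp add: j_def P_def lam_def add_ac mult_ac)
  \<comment> \<open>This identity accounts for the form of \<open>ridge_factor\<close>: it is the
    inverse of the constants collected by averaging.\<close>
  also have "ridge_factor \<mu> l k * ((real k + lam) / lam) * poly P 1 * (pochhammer lam (k - l) / fact (k - l)) = 1"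
  proof -
    have rf: "ridge_factor \<mu> l k = fact l * fact (k - l) * (lam + real (k - l)) /
        (pochhammer lam l * pochhammer (lam + 1) (k - l) * (real k + lam))"
      by (simp add: ridge_factor_def lam_def add_ac)
    have p: "pochhammer lam (k - l) * (lam + real (k - l)) = lam * pochhammer (lam + 1) (k - l)"
      by (metis pochhammer_Suc pochhammer_rec)
    have "pochhammer lam l > 0" "pochhammer (lam + 1) (k - l) > 0" "real k + lam > 0"
      using lam by (auto intro: pochhammer_pos)
    then have "ridge_factor \<mu> l k * ((real k + lam) / lam) * poly P 1 * (pochhammer lam (k - l) / fact (k - l)) =
      pochhammer lam (k - l) * (lam + real (k - l)) / (lam * pochhammer (lam + 1) (k - l))"
      using lam unfolding rf P1 by (simp add: mult_ac)
    also have "\<dots> = 1"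
      unfolding p using lam \<open>pochhammer (lam + 1) (k - l) > 0\<close> by simp
    finally show ?thesis .
  qed
  also have "1 * (h * poly P (2 * r\<^sup>2 - 1) * r ^ j * angular j \<epsilon> \<theta>) = disk_basis \<mu> k l \<epsilon> v"
    unfolding v disk_basis_polar[OF r] j_def[symmetric] J by (simp add: h_def)
  finally show ?thesis .
qed

text \<open>Pairs l with k - l; only a middle index 2 l = k is its own partner. The multiplicities 2
  and 1 are the reciprocals of the constants d in \<open>disk_basis_coeff\<close>.\<close>

lemma fold_symmetric_sum:
  fixes f :: "nat \<Rightarrow> real"
  assumes "\<And>l. l \<le> k \<Longrightarrow> f (k - l) = f l"
  shows "(\<Sum>l\<le>k. f l) = (\<Sum>l | 2 * l \<le> k. (if 2 * l < k then 2 else 1) * f l)"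
proof -
  have fin: "finite {l. 2 * l \<le> k}" "finite {l. 2 * l < k}"
    by (auto intro: finite_subset[of _ "{..k}"])
  have "(\<Sum>l\<le>k. f l) = (\<Sum>l\<in>{l. 2 * l \<le> k} \<union> {l. l \<le> k \<and> k < 2 * l}. f l)"
    by (rule sum.cong) auto
  also have "\<dots> = (\<Sum>l | 2 * l \<le> k. f l) + (\<Sum>l | l \<le> k \<and> k < 2 * l. f l)"
    using fin by (intro sum.union_disjoint) auto
  also have "(\<Sum>l | l \<le> k \<and> k < 2 * l. f l) = (\<Sum>l | 2 * l < k. f l)"
    using assms by (intro sum.reindex_bij_witness[of _ "\<lambda>l. k - l" "\<lambda>l. k - l"]) auto
  also have "\<dots> = (\<Sum>l | 2 * l \<le> k. if 2 * l < k then f l else 0)"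
    using fin by (intro sum.mono_neutral_cong_left) auto
  also have "(\<Sum>l | 2 * l \<le> k. f l) + \<dots> = (\<Sum>l | 2 * l \<le> k. (if 2 * l < k then 2 else 1) * f l)"
    unfolding sum.distrib[symmetric] by (intro sum.cong) auto
  finally show ?thesis .
qed

lemma sum_disk_basis_index:
  fixes F :: "nat \<Rightarrow> nat \<Rightarrow> real"
  shows "(\<Sum>(l, \<epsilon>)\<in>disk_basis_index k. F l \<epsilon>) = (\<Sum>l | 2 * l \<le> k. F l 0 + (if 2 * l < k then F l 1 else 0))"
proof -
  have fin: "finite {l. 2 * l \<le> k}" "finite {l. 2 * l < k}"
    by (auto intro: finite_subset[of _ "{..k}"])
  have "disk_basis_index k = {l. 2 * l \<le> k} \<times> {0} \<union> {l. 2 * l < k} \<times> {1}"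
    by (auto simp: disk_basis_index_def)
  then have "(\<Sum>(l, \<epsilon>)\<in>disk_basis_index k. F l \<epsilon>) =
    (\<Sum>(l, \<epsilon>)\<in>{l. 2 * l \<le> k} \<times> {0}. F l \<epsilon>) + (\<Sum>(l, \<epsilon>)\<in>{l. 2 * l < k} \<times> {1}. F l \<epsilon>)"
    using fin by (simp only:) (intro sum.union_disjoint, auto)
  also have "\<dots> = (\<Sum>l | 2 * l \<le> k. F l 0) + (\<Sum>l | 2 * l < k. F l 1)"
    unfolding sum.cartesian_product[symmetric] by simp
  also have "(\<Sum>l | 2 * l < k. F l 1) = (\<Sum>l | 2 * l \<le> k. if 2 * l < k then F l 1 else 0)"
    using fin by (intro sum.mono_neutral_cong_left) auto
  finally show ?thesis by (simp add: sum.distrib)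
qed

text \<open>For fixed l the cosine and sine parts combine into the cosine of an angle difference.
  What remains is to check that the normalisation of the basis gives the constants of the folded
  cosine expansion of the ridge polynomial.\<close>

lemma disk_basis_addition_formula:
  assumes \<mu>: "\<mu> \<ge> 0"
  shows "(\<Sum>(l, \<epsilon>)\<in>disk_basis_index k. disk_basis \<mu> k l \<epsilon> v * disk_basis \<mu> k l \<epsilon> (cos \<xi>, sin \<xi>)) = ridge_poly \<mu> k \<xi> v"
proof -
  obtain r \<theta> where r: "r \<ge> 0" and v: "v = (r * cos \<theta>, r * sin \<theta>)" using polar_form .
  define lam where "lam = \<mu> + 1/2"
  have lam: "lam > 0" and al: "\<mu> - 1/2 + 1 = lam" using \<mu> by (auto simp: lam_def)
  have summand: "disk_basis \<mu> k l 0 v * disk_basis \<mu> k l 0 (cos \<xi>, sin \<xi>) +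
      (if 2 * l < k then disk_basis \<mu> k l 1 v * disk_basis \<mu> k l 1 (cos \<xi>, sin \<xi>) else 0) =
     (real k + lam) / lam * ((if 2 * l < k then 2 else 1) * (ridge_radial lam k l r * cos ((real k - 2 * real l) * (\<theta> - \<xi>))))"
    if l: "2 * l \<le> k" for l
  proof -
    obtain j where k: "k = 2 * l + j" using l le_Suc_ex by blast
    have j: "k - 2 * l = j" "k - l = j + l" "real k - 2 * real l = real j" using k by auto
    define N where "N = jacobi_norm2 (\<mu> - 1/2) (real j) l"
    have N: "N > 0" unfolding N_def using \<mu> by (intro jacobi_norm2_pos) auto
    define P where "P = jacobi_std (\<mu> - 1/2) (real j) l"
    have J: "jacobi (\<mu> - 1/2) (real j) l = smult (1 / sqrt N) P"
      unfolding N_def P_def using \<mu> by (intro jacobi_eq) auto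
    have P1: "poly P 1 = pochhammer lam l / fact l"
      unfolding P_def using jacobi_std_at_1[of "\<mu> - 1/2" "real j" l, unfolded al] \<mu> by simp
    \<comment> \<open>The reciprocal of the \<open>d\<close> in \<open>disk_basis_coeff\<close>,
      hence the multiplicity in the folded sum.\<close>
    define d where "d = (if 2 * l < k then 2 else 1 :: real)"
    define h where "h = disk_basis_coeff \<mu> l k"
    have h2: "h\<^sup>2 = d * pochhammer (lam + 1) j / fact j"
    proof -
      have "Gamma (real j + \<mu> + 3/2) / Gamma (\<mu> + 3/2) = pochhammer (\<mu> + 3/2) j"
        using \<mu> by (subst pochhammer_Gamma) (auto simp: nonpos_Ints_def add_ac)
      then have "Gamma (real j + \<mu> + 3/2) / (Gamma (\<mu> + 3/2) * Gamma (real j + 1)) = pochhammer (\<mu> + 3/2) j / Gamma (real j + 1)"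
        by (metis divide_divide_eq_left)
      also have "\<dots> = pochhammer (lam + 1) j / fact j"
        using Gamma_fact[of j, where 'a=real] by (simp add: lam_def add_ac)
      finally have "Gamma (real j + \<mu> + 3/2) / (Gamma (\<mu> + 3/2) * Gamma (real j + 1)) = pochhammer (lam + 1) j / fact j" .
      then have "h = sqrt (d * (pochhammer (lam + 1) j / fact j))"
        by (simp add: h_def disk_basis_coeff_def j d_def)
      moreover have "pochhammer (lam + 1) j \<ge> 0" using lam by (intro pochhammer_nonneg) auto
      ultimately show ?thesis by (simp add: d_def)
    qed
    have b: "disk_basis \<mu> k l \<epsilon> v = h * poly P (2 * r\<^sup>2 - 1) / sqrt N * r ^ j * angular j \<epsilon> \<theta>"
      "disk_basis \<mu> k l \<epsilon> (cos \<xi>, sin \<xi>) = h * poly P 1 / sqrt N * angular j \<epsilon> \<xi>" for \<epsilon>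
      using disk_basis_polar[OF r, of \<mu> k l \<epsilon> \<theta>] disk_basis_polar[of 1 \<mu> k l \<epsilon> \<xi>]
      by (simp_all add: v j J h_def)
    have a: "angular j 0 \<theta> * angular j 0 \<xi> + (if 2 * l < k then angular j 1 \<theta> * angular j 1 \<xi> else 0) = cos (real j * (\<theta> - \<xi>))"
      using k by (auto simp: angular_def cos_diff right_diff_distrib)
    have "disk_basis \<mu> k l 0 v * disk_basis \<mu> k l 0 (cos \<xi>, sin \<xi>) +
      (if 2 * l < k then disk_basis \<mu> k l 1 v * disk_basis \<mu> k l 1 (cos \<xi>, sin \<xi>) else 0) =
      h * poly P (2 * r\<^sup>2 - 1) / sqrt N * r ^ j * (h * poly P 1 / sqrt N) *
        (angular j 0 \<theta> * angular j 0 \<xi> + (if 2 * l < k then angular j 1 \<theta> * angular j 1 \<xi> else 0))"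
      unfolding b by (auto simp: algebra_simps add_divide_distrib)
    also have "\<dots> = (h\<^sup>2 * poly P 1 / N) * (poly P (2 * r\<^sup>2 - 1) * r ^ j * cos (real j * (\<theta> - \<xi>)))"
      unfolding a using N by (simp add: power2_eq_square real_sqrt_mult[symmetric])
    \<comment> \<open>The symbols on base lam + 1 multiply to (lam + 1)_k, a shift of the base turns
      this into (lam)_k (lam + k) / lam, and (lam)_k splits after k - l factors; the last piece
      cancels against the norm.\<close>
    also have "h\<^sup>2 * poly P 1 / N = (real k + lam) / lam * (d * (pochhammer lam (j + l) / fact (j + l)))"
    proof -
      have N_eq: "N = pochhammer (lam + real (j + l)) l * pochhammer lam l * pochhammer (real j + 1) l /
          (fact l * pochhammer (lam + 1 + real j) (2 * l))"
        by (simp add: N_def jacobi_norm2_def lam_def add_ac)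
      have 1: "pochhammer (lam + 1) j * pochhammer (lam + 1 + real j) (2 * l) = pochhammer (lam + 1) k"
        unfolding k by (subst pochhammer_product'[symmetric]) (simp add: add.commute)
      have 2: "lam * pochhammer (lam + 1) k = pochhammer lam k * (lam + real k)"
        by (metis pochhammer_Suc pochhammer_rec)
      have 3: "pochhammer lam k = pochhammer lam (j + l) * pochhammer (lam + real (j + l)) l"
        unfolding k by (subst pochhammer_product'[symmetric]) (simp add: add_ac mult_2)
      have pos: "pochhammer (lam + real (j + l)) l > 0" "pochhammer lam l > 0" "pochhammer (real j + 1) l > 0"
        "pochhammer (lam + 1 + real j) (2 * l) > 0"
        using lam by (auto intro!: pochhammer_pos)
      have "h\<^sup>2 * poly P 1 / N = d * (pochhammer (lam + 1) j * pochhammer (lam + 1 + real j) (2 * l)) /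
          (fact j * pochhammer (real j + 1) l * pochhammer (lam + real (j + l)) l)"
        unfolding h2 P1 N_eq using pos by simp
      also have "\<dots> = d * (pochhammer lam k * (lam + real k) / lam) / (fact (j + l) * pochhammer (lam + real (j + l)) l)"
        unfolding 1 fact_add_pochhammer 2[symmetric] using lam by simp
      also have "\<dots> = (real k + lam) / lam * (d * (pochhammer lam (j + l) / fact (j + l)))"
        unfolding 3 using pos lam by (simp add: add.commute)
      finally show ?thesis .
    qed
    also have "(real k + lam) / lam * (d * (pochhammer lam (j + l) / fact (j + l))) *
        (poly P (2 * r\<^sup>2 - 1) * r ^ j * cos (real j * (\<theta> - \<xi>))) =
        (real k + lam) / lam * (d * (ridge_radial lam k l r * cos (real j * (\<theta> - \<xi>))))"
    proof -
      have "lam - 1 = \<mu> - 1/2" by (simp add: lam_def)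
      then have "ridge_radial lam k l r = pochhammer lam (j + l) / fact (j + l) * r ^ j * poly P (2 * r\<^sup>2 - 1)"
        using ridge_radial_jacobi[OF l, of lam r] by (simp only: j P_def)
      then show ?thesis by (simp add: mult_ac)
    qed
    finally show ?thesis unfolding j(3) d_def .
  qed
  have "(\<Sum>(l, \<epsilon>)\<in>disk_basis_index k. disk_basis \<mu> k l \<epsilon> v * disk_basis \<mu> k l \<epsilon> (cos \<xi>, sin \<xi>)) =
     (real k + lam) / lam * (\<Sum>l | 2 * l \<le> k. (if 2 * l < k then 2 else 1) * (ridge_radial lam k l r * cos ((real k - 2 * real l) * (\<theta> - \<xi>))))"
    unfolding sum_disk_basis_index sum_distrib_left by (intro sum.cong refl summand) auto
  also have "\<dots> = (real k + lam) / lam * (\<Sum>l\<le>k. ridge_radial lam k l r * cos ((real k - 2 * real l) * (\<theta> - \<xi>)))"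
  proof (subst fold_symmetric_sum)
    fix l assume "l \<le> k"
    then have "real k - 2 * real (k - l) = - (real k - 2 * real l)" by (simp add: of_nat_diff)
    then show "ridge_radial lam k (k - l) r * cos ((real k - 2 * real (k - l)) * (\<theta> - \<xi>)) =
      ridge_radial lam k l r * cos ((real k - 2 * real l) * (\<theta> - \<xi>))"
      using ridge_radial_sym[OF \<open>l \<le> k\<close>] by (simp only: mult_minus_left cos_minus)
  qed simp
  also have "\<dots> = ridge_poly \<mu> k \<xi> v"
    unfolding v ridge_poly_polar[OF \<mu>] gegenbauer_ridge_expansion lam_def by (simp add: add.assoc)
  finally show ?thesis .
qed

section \<open>Bivariate polynomials\<close>

text \<open>Coefficients on a full square that vanish above the degree give polynomials with
  different bounds a common index range, so that closure properties become coefficientwise.\<close>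

lemma bipolys_iff:
  assumes "n \<le> N"
  shows "f \<in> bipolys n \<longleftrightarrow> (\<exists>c. (\<forall>i j. n < i + j \<longrightarrow> c i j = 0) \<and>
    f = (\<lambda>v. \<Sum>i\<le>N. \<Sum>j\<le>N. c i j * fst v ^ i * snd v ^ j))"
proof -
  have eq: "(\<Sum>i\<le>N. \<Sum>j\<le>N. c i j * x ^ i * y ^ j) = (\<Sum>i\<le>n. \<Sum>j\<le>n - i. c i j * x ^ i * y ^ j)"
    if c: "\<forall>i j. n < i + j \<longrightarrow> c i j = 0" for c :: "nat \<Rightarrow> nat \<Rightarrow> real" and x y
  proof -
    have "(\<Sum>i\<le>N. \<Sum>j\<le>N. c i j * x ^ i * y ^ j) = (\<Sum>i\<le>n. \<Sum>j\<le>N. c i j * x ^ i * y ^ j)"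
      using assms c by (intro sum.mono_neutral_right) auto
    also have "\<dots> = (\<Sum>i\<le>n. \<Sum>j\<le>n - i. c i j * x ^ i * y ^ j)"
      using assms c by (intro sum.cong refl sum.mono_neutral_right) auto
    finally show ?thesis .
  qed
  show ?thesis
  proof
    assume "f \<in> bipolys n"
    then obtain c where f: "f = (\<lambda>(x, y). \<Sum>i\<le>n. \<Sum>j\<le>n - i. c i j * x ^ i * y ^ j)"
      by (auto simp: bipolys_def)
    define d where "d i j = (if i + j \<le> n then c i j else 0)" for i j
    have "f = (\<lambda>v. \<Sum>i\<le>N. \<Sum>j\<le>N. d i j * fst v ^ i * snd v ^ j)"
      by (subst eq) (auto simp: f d_def fun_eq_iff intro!: sum.cong)
    moreover have "\<forall>i j. n < i + j \<longrightarrow> d i j = 0" by (auto simp: d_def)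
    ultimately show "\<exists>c. (\<forall>i j. n < i + j \<longrightarrow> c i j = 0) \<and>
       f = (\<lambda>v. \<Sum>i\<le>N. \<Sum>j\<le>N. c i j * fst v ^ i * snd v ^ j)"
      by blast
  next
    assume "\<exists>c. (\<forall>i j. n < i + j \<longrightarrow> c i j = 0) \<and>
       f = (\<lambda>v. \<Sum>i\<le>N. \<Sum>j\<le>N. c i j * fst v ^ i * snd v ^ j)"
    then obtain c where c: "\<forall>i j. n < i + j \<longrightarrow> c i j = 0"
      and f: "f = (\<lambda>v. \<Sum>i\<le>N. \<Sum>j\<le>N. c i j * fst v ^ i * snd v ^ j)" by blast
    show "f \<in> bipolys n"
      unfolding bipolys_def f eq[OF c] case_prod_unfold by blast
  qed
qed

lemma bipolysE:
  assumes "f \<in> bipolys n"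
  obtains c :: "nat \<Rightarrow> nat \<Rightarrow> real" where "f = (\<lambda>v. \<Sum>i\<le>n. \<Sum>j\<le>n - i. c i j * fst v ^ i * snd v ^ j)"
  using assms unfolding bipolys_def case_prod_unfold by blast

lemma bipolys_mono:
  assumes "f \<in> bipolys m" "m \<le> n"
  shows "f \<in> bipolys n"
proof -
  obtain c where c: "\<forall>i j. m < i + j \<longrightarrow> c i j = 0"
    and f: "f = (\<lambda>v. \<Sum>i\<le>n. \<Sum>j\<le>n. c i j * fst v ^ i * snd v ^ j)"
    using assms bipolys_iff[of m n f] by blast
  have "\<forall>i j. n < i + j \<longrightarrow> c i j = 0" using c \<open>m \<le> n\<close> by auto
  with f show ?thesis unfolding bipolys_iff[OF order.refl] by blast
qed

lemma bipolys_add: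
  assumes "f \<in> bipolys n" "g \<in> bipolys n"
  shows "(\<lambda>v. f v + g v) \<in> bipolys n"
proof -
  obtain c d where c: "\<forall>i j. n < i + j \<longrightarrow> c i j = 0" "\<forall>i j. n < i + j \<longrightarrow> d i j = 0"
    and f: "f = (\<lambda>v. \<Sum>i\<le>n. \<Sum>j\<le>n. c i j * fst v ^ i * snd v ^ j)"
    and g: "g = (\<lambda>v. \<Sum>i\<le>n. \<Sum>j\<le>n. d i j * fst v ^ i * snd v ^ j)"
    using assms unfolding bipolys_iff[OF order.refl] by blast
  show ?thesis
    unfolding bipolys_iff[OF order.refl] f g
    by (rule exI[of _ "\<lambda>i j. c i j + d i j"]) (use c in \<open>auto simp: sum.distrib distrib_right\<close>)
qed

lemma bipolys_scale:
  assumes "f \<in> bipolys n"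
  shows "(\<lambda>v. a * f v) \<in> bipolys n"
proof -
  obtain c where c: "\<forall>i j. n < i + j \<longrightarrow> c i j = 0"
    and f: "f = (\<lambda>v. \<Sum>i\<le>n. \<Sum>j\<le>n. c i j * fst v ^ i * snd v ^ j)"
    using assms unfolding bipolys_iff[OF order.refl] by blast
  show ?thesis
    unfolding bipolys_iff[OF order.refl] f
    by (rule exI[of _ "\<lambda>i j. a * c i j"]) (use c in \<open>auto simp: sum_distrib_left mult.assoc\<close>)
qed

lemma bipolys_const: "(\<lambda>v. a) \<in> bipolys n"
  by (rule bipolys_mono[of _ 0]) (auto simp: bipolys_def split_beta intro!: exI[of _ "\<lambda>i j. a"])

lemma bipolys_sum: "(\<And>i. i \<in> I \<Longrightarrow> f i \<in> bipolys n) \<Longrightarrow> (\<lambda>v. \<Sum>i\<in>I. f i v) \<in> bipolys n"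
  by (induction I rule: infinite_finite_induct) (auto intro: bipolys_const bipolys_add)

lemma bipolys_mult_coordinate:
  assumes "f \<in> bipolys n"
  shows "(\<lambda>v. fst v * f v) \<in> bipolys (Suc n)" "(\<lambda>v. snd v * f v) \<in> bipolys (Suc n)"
proof -
  obtain c where c: "\<forall>i j. n < i + j \<longrightarrow> c i j = 0"
    and f: "f = (\<lambda>v. \<Sum>i\<le>n. \<Sum>j\<le>n. c i j * fst v ^ i * snd v ^ j)"
    using assms unfolding bipolys_iff[OF order.refl] by blast
  have 1: "(\<Sum>i\<le>Suc n. \<Sum>j\<le>Suc n. (if i = 0 then 0 else c (i - 1) j) * x ^ i * y ^ j)
      = x * (\<Sum>i\<le>n. \<Sum>j\<le>n. c i j * x ^ i * y ^ j)" for x y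
  proof -
    have "(\<Sum>i\<le>Suc n. \<Sum>j\<le>Suc n. (if i = 0 then 0 else c (i - 1) j) * x ^ i * y ^ j)
      = (\<Sum>i\<le>n. \<Sum>j\<le>Suc n. c i j * x ^ Suc i * y ^ j)"
      by (subst sum.atMost_Suc_shift) (simp del: sum.atMost_Suc)
    also have "\<dots> = x * (\<Sum>i\<le>n. \<Sum>j\<le>n. c i j * x ^ i * y ^ j)"
      using c by (simp add: sum_distrib_left mult_ac)
    finally show ?thesis .
  qed
  have 2: "(\<Sum>i\<le>Suc n. \<Sum>j\<le>Suc n. (if j = 0 then 0 else c i (j - 1)) * x ^ i * y ^ j)
      = y * (\<Sum>i\<le>n. \<Sum>j\<le>n. c i j * x ^ i * y ^ j)" for x y
  proof -
    have "(\<Sum>j\<le>Suc n. (if j = 0 then 0 else c i (j - 1)) * x ^ i * y ^ j)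
      = (\<Sum>j\<le>n. c i j * x ^ i * y ^ Suc j)" for i
      by (subst sum.atMost_Suc_shift) (simp del: sum.atMost_Suc)
    then have "(\<Sum>i\<le>Suc n. \<Sum>j\<le>Suc n. (if j = 0 then 0 else c i (j - 1)) * x ^ i * y ^ j)
      = (\<Sum>i\<le>Suc n. \<Sum>j\<le>n. c i j * x ^ i * y ^ Suc j)"
      by (simp only:)
    also have "\<dots> = y * (\<Sum>i\<le>n. \<Sum>j\<le>n. c i j * x ^ i * y ^ j)"
      using c by (simp add: sum_distrib_left mult_ac)
    finally show ?thesis .
  qed
  show "(\<lambda>v. fst v * f v) \<in> bipolys (Suc n)"
    unfolding bipolys_iff[OF order.refl] f 1[symmetric]
    by (rule exI[of _ "\<lambda>i j. if i = 0 then 0 else c (i - 1) j"]) (use c in auto)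
  show "(\<lambda>v. snd v * f v) \<in> bipolys (Suc n)"
    unfolding bipolys_iff[OF order.refl] f 2[symmetric]
    by (rule exI[of _ "\<lambda>i j. if j = 0 then 0 else c i (j - 1)"]) (use c in auto)
qed

lemma bipolys_mult_linear:
  assumes "f \<in> bipolys n"
  shows "(\<lambda>v. (a * fst v + b * snd v) * f v) \<in> bipolys (Suc n)"
  using bipolys_add[OF bipolys_scale[OF bipolys_mult_coordinate(1)[OF assms], of a]
      bipolys_scale[OF bipolys_mult_coordinate(2)[OF assms], of b]]
  by (simp add: algebra_simps)

lemma bipolys_linear_powers:
  "(\<lambda>v. (a * fst v + b * snd v) ^ i * (c * fst v + d * snd v) ^ j) \<in> bipolys (i + j)"
proof (induction i)
  case 0
  show ?case
  proof (induction j)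
    case (Suc j)
    then show ?case using bipolys_mult_linear[OF Suc, of c d] by (simp add: mult_ac)
  qed (simp add: bipolys_const)
next
  case (Suc i)
  then show ?case using bipolys_mult_linear[OF Suc, of a b] by (simp add: mult_ac)
qed

lemma bipolys_monomial: "(\<lambda>v. fst v ^ i * snd v ^ j) \<in> bipolys (i + j)"
  using bipolys_linear_powers[of 1 0 i 0 1 j] by simp

lemma bipolys_compose_linear:
  assumes "f \<in> bipolys n"
  shows "(\<lambda>v. f (a * fst v + b * snd v, c * fst v + d * snd v)) \<in> bipolys n"
proof -
  obtain e where f: "f = (\<lambda>v. \<Sum>i\<le>n. \<Sum>j\<le>n - i. e i j * fst v ^ i * snd v ^ j)"
    using assms by (rule bipolysE)
  show ?thesis
    unfolding f fst_conv snd_conv mult.assoc[of "e _ _"]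
    by (intro bipolys_sum bipolys_scale bipolys_mono[OF bipolys_linear_powers]) auto
qed

lemma bipolys_rotation: "f \<in> bipolys n \<Longrightarrow> (\<lambda>v. f (plane_rotation \<theta> v)) \<in> bipolys n"
  using bipolys_compose_linear[of f n "cos \<theta>" "- sin \<theta>" "sin \<theta>" "cos \<theta>"]
  by (simp add: plane_rotation_def split_beta mult.commute)

lemma bipolys_ridge:
  assumes "degree p \<le> n"
  shows "(\<lambda>v. poly p (fst v * a + snd v * b)) \<in> bipolys n"
  unfolding poly_altdef
proof (intro bipolys_sum bipolys_scale)
  fix i assume "i \<in> {..degree p}"
  then show "(\<lambda>v. (fst v * a + snd v * b) ^ i) \<in> bipolys n"
    using bipolys_mono[OF bipolys_linear_powers[of a b i 0 0 0], of n] assms by (simp add: mult.commute)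
qed

lemma bipolys_continuous: "f \<in> bipolys n \<Longrightarrow> continuous_on S f"
  by (erule bipolysE) (auto intro!: continuous_intros)

text \<open>Restricted to the line through 0 and v, f is a univariate polynomial with infinitely
  many zeros near 0. The bound 1 / (1 + norm v) also covers v = 0.\<close>

lemma bipolys_zero_on_ball:
  assumes f: "f \<in> bipolys n" and z: "\<And>v. norm v < 1 \<Longrightarrow> f v = 0"
  shows "f v = 0"
proof -
  obtain c where f: "f = (\<lambda>v. \<Sum>i\<le>n. \<Sum>j\<le>n - i. c i j * fst v ^ i * snd v ^ j)"
    using f by (rule bipolysE)
  define p where "p = (\<Sum>i\<le>n. \<Sum>j\<le>n - i. monom (c i j * fst v ^ i * snd v ^ j) (i + j))"
  have p: "poly p t = f (t *\<^sub>R v)" for t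
    by (simp add: p_def f poly_sum poly_monom power_mult_distrib power_add mult_ac)
  have "poly p t = 0" if "t \<in> {0<..<1 / (1 + norm v)}" for t
  proof -
    have "t * (1 + norm v) < 1" "t > 0"
      using that by (auto simp: field_simps add_pos_nonneg)
    then have "norm (t *\<^sub>R v) < 1" by (simp add: distrib_left)
    then show ?thesis unfolding p by (rule z)
  qed
  moreover have "infinite {0<..<1 / (1 + norm v)}"
    by (simp add: infinite_Ioo add_pos_nonneg)
  ultimately have "infinite {t. poly p t = 0}"
    by (metis (mono_tags, lifting) infinite_super mem_Collect_eq subsetI)
  then have "p = 0" using poly_roots_finite by blast
  then show ?thesis using p[of 1] by simp
qed

text \<open>Possible quotients of a polynomial of degree at most \<open>n\<close> by \<open>1 - x\<^sup>2 - y\<^sup>2\<close>; for \<open>n < 2\<close> the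
  truncated \<open>n - 2\<close> would wrongly admit constants.\<close>

definition circle_quotients :: "nat \<Rightarrow> (real \<times> real \<Rightarrow> real) set" where
  "circle_quotients n = {R. if n < 2 then R = (\<lambda>_. 0) else R \<in> bipolys (n - 2)}"

lemma circle_quotients_closed:
  "(\<lambda>_. 0) \<in> circle_quotients n"
  "R \<in> circle_quotients n \<Longrightarrow> S \<in> circle_quotients n \<Longrightarrow> (\<lambda>v. R v + S v) \<in> circle_quotients n"
  "R \<in> circle_quotients n \<Longrightarrow> (\<lambda>v. a * R v) \<in> circle_quotients n"
  "R \<in> circle_quotients m \<Longrightarrow> m \<le> n \<Longrightarrow> R \<in> circle_quotients n"
  by (auto simp: circle_quotients_def intro: bipolys_const bipolys_add bipolys_scale bipolys_mono split: if_splits)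

text \<open>Replacing y^2 by 1 - x^2 minus the divisor lowers the power of y by two and raises that
  of x by two; hence the induction in steps of two with i generalised. The total degree does not
  grow, which bounds the quotient.\<close>

lemma circle_division_monomial:
  "\<exists>A B R. R \<in> circle_quotients (i + j) \<and> (\<forall>v. fst v ^ i * snd v ^ j =
     poly A (fst v) + snd v * poly B (fst v) + (1 - (fst v)\<^sup>2 - (snd v)\<^sup>2) * R v)"
proof (induction j arbitrary: i rule: nat_induct2)
  case 0
  show ?case
    by (intro exI[of _ "monom 1 i"] exI[of _ 0] exI[of _ "\<lambda>_. 0"])
      (auto simp: circle_quotients_closed poly_monom)
next
  case 1
  show ?case
    by (intro exI[of _ 0] exI[of _ "monom 1 i"] exI[of _ "\<lambda>_. 0"])
      (auto simp: circle_quotients_closed poly_monom)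
next
  case (step j)
  obtain A B R where 1: "R \<in> circle_quotients (i + j)" "\<And>v. fst v ^ i * snd v ^ j =
     poly A (fst v) + snd v * poly B (fst v) + (1 - (fst v)\<^sup>2 - (snd v)\<^sup>2) * R v"
    using step[of i] by blast
  obtain A' B' R' where 2: "R' \<in> circle_quotients (i + 2 + j)" "\<And>v. fst v ^ (i + 2) * snd v ^ j =
     poly A' (fst v) + snd v * poly B' (fst v) + (1 - (fst v)\<^sup>2 - (snd v)\<^sup>2) * R' v"
    using step[of "i + 2"] by blast
  define S where "S = (\<lambda>v. R v + ((-1) * R' v + (-1) * (fst v ^ i * snd v ^ j)))"
  have "(\<lambda>v. fst v ^ i * snd v ^ j) \<in> circle_quotients (i + (j + 2))"
    using bipolys_monomial[of i j] by (simp add: circle_quotients_def)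
  then have "S \<in> circle_quotients (i + (j + 2))"
    unfolding S_def using 1(1) 2(1)
    by (intro circle_quotients_closed(2,3)) (auto intro: circle_quotients_closed(4) simp: add_ac)
  moreover have "fst v ^ i * snd v ^ (j + 2) =
     poly (A - A') (fst v) + snd v * poly (B - B') (fst v) + (1 - (fst v)\<^sup>2 - (snd v)\<^sup>2) * S v" for v :: "real \<times> real"
  proof -
    have gen: "M * y\<^sup>2 = a - a' + y * (b - b') + (1 - x\<^sup>2 - y\<^sup>2) * (r + ((-1) * r' + (-1) * M))"
      if "M = a + y * b + (1 - x\<^sup>2 - y\<^sup>2) * r" "M * x\<^sup>2 = a' + y * b' + (1 - x\<^sup>2 - y\<^sup>2) * r'"
      for M x y a a' b b' r r' :: real
      using that by algebra
    have e1: "fst v ^ i * snd v ^ (j + 2) = (fst v ^ i * snd v ^ j) * (snd v)\<^sup>2"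
      by (simp add: power_add power2_eq_square)
    have e2: "(fst v ^ i * snd v ^ j) * (fst v)\<^sup>2 = fst v ^ (i + 2) * snd v ^ j"
      by (simp add: power_add power2_eq_square)
    show ?thesis
      unfolding S_def poly_diff e1 by (rule gen[OF 1(2)[of v] trans[OF e2 2(2)[of v]]])
  qed
  ultimately show ?case by blast
qed

lemma circle_division:
  assumes "f \<in> bipolys n"
  obtains A B R where "R \<in> circle_quotients n" "\<And>v. f v =
     poly A (fst v) + snd v * poly B (fst v) + (1 - (fst v)\<^sup>2 - (snd v)\<^sup>2) * R v"
proof -
  obtain c where f: "f = (\<lambda>v. \<Sum>i\<le>n. \<Sum>j\<le>n - i. c i j * fst v ^ i * snd v ^ j)"
    using assms by (rule bipolysE)
  have "\<forall>i j. \<exists>A B R. R \<in> circle_quotients (i + j) \<and> (\<forall>v. fst v ^ i * snd v ^ j =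
     poly A (fst v) + snd v * poly B (fst v) + (1 - (fst v)\<^sup>2 - (snd v)\<^sup>2) * R v)"
    using circle_division_monomial by blast
  then obtain A B R where R: "\<And>i j. R i j \<in> circle_quotients (i + j)"
    and eq: "\<And>i j v. fst v ^ i * snd v ^ j =
     poly (A i j) (fst v) + snd v * poly (B i j) (fst v) + (1 - (fst v)\<^sup>2 - (snd v)\<^sup>2) * R i j v"
    by metis
  have sum_closed: "(\<lambda>v. \<Sum>i\<in>I. g i v) \<in> circle_quotients n" if "\<And>i. i \<in> I \<Longrightarrow> g i \<in> circle_quotients n" for I :: "nat set" and g
    using that by (induction I rule: infinite_finite_induct) (auto intro: circle_quotients_closed)
  show thesis
  proof
    show "(\<lambda>v. \<Sum>i\<le>n. \<Sum>j\<le>n - i. c i j * R i j v) \<in> circle_quotients n"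
      by (intro sum_closed circle_quotients_closed(3) circle_quotients_closed(4)[OF R]) auto
    show "f v = poly (\<Sum>i\<le>n. \<Sum>j\<le>n - i. smult (c i j) (A i j)) (fst v)
       + snd v * poly (\<Sum>i\<le>n. \<Sum>j\<le>n - i. smult (c i j) (B i j)) (fst v)
       + (1 - (fst v)\<^sup>2 - (snd v)\<^sup>2) * (\<Sum>i\<le>n. \<Sum>j\<le>n - i. c i j * R i j v)" for v
      unfolding f mult.assoc eq
      by (simp add: poly_sum sum_distrib_left sum.distrib[symmetric] sum_subtractf[symmetric] algebra_simps)
  qed
qed

lemma poly_zero_on_interval:
  fixes p :: "real poly"
  assumes "\<And>x. -1 < x \<Longrightarrow> x < 1 \<Longrightarrow> poly p x = 0"
  shows "p = 0"
proof (rule ccontr)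
  assume "p \<noteq> 0"
  then have "finite {x. poly p x = 0}" by (rule poly_roots_finite)
  moreover have "{-1<..<1} \<subseteq> {x. poly p x = 0}" using assms by auto
  ultimately have "finite {-1<..<1::real}" by (rule finite_subset[rotated])
  then show False using infinite_Ioo[of "-1::real" 1] by simp
qed

text \<open>At the two circle points above the same x the remainder A + y B vanishes for both signs
  of y, and y is nonzero for x strictly between -1 and 1; so A and B vanish there and are zero
  polynomials.\<close>

lemma vanishing_on_circle:
  assumes f: "f \<in> bipolys n" and z: "\<And>\<xi>. f (cos \<xi>, sin \<xi>) = 0"
  obtains R where "R \<in> circle_quotients n" "\<And>v. f v = (1 - (fst v)\<^sup>2 - (snd v)\<^sup>2) * R v"
proof -
  obtain R A B where R: "R \<in> circle_quotients n" and eq: "\<And>v. f v =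
     poly A (fst v) + snd v * poly B (fst v) + (1 - (fst v)\<^sup>2 - (snd v)\<^sup>2) * R v"
    by (rule circle_division[OF f], rule that)
  have *: "poly A x = 0 \<and> poly B x = 0" if x: "-1 < x" "x < 1" for x
  proof -
    have s: "sin (arccos x) > 0"
      using x arccos_lt_bounded[of x] by (intro sin_gt_zero) auto
    have c: "1 - x\<^sup>2 - (sin (arccos x))\<^sup>2 = 0"
      using sin_cos_squared_add[of "arccos x"] x by simp
    have "poly A x + sin (arccos x) * poly B x = 0"
      using eq[of "(x, sin (arccos x))"] z[of "arccos x"] x by (simp add: c)
    moreover have "poly A x - sin (arccos x) * poly B x = 0"
      using eq[of "(x, - sin (arccos x))"] z[of "- arccos x"] x by (simp add: c)
    ultimately have "poly A x = 0" "sin (arccos x) * poly B x = 0" by linarith+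
    then show ?thesis using s by auto
  qed
  have "A = 0" "B = 0"
    by (rule poly_zero_on_interval, use * in blast)+
  then show thesis using that[OF R] eq by simp
qed

section \<open>Integration over the disk\<close>

lemma ridge_rotation:
  "fst (plane_rotation \<xi> (t, s)) * cos \<xi> + snd (plane_rotation \<xi> (t, s)) * sin \<xi> = t"
proof -
  have "fst (plane_rotation \<xi> (t, s)) * cos \<xi> + snd (plane_rotation \<xi> (t, s)) * sin \<xi> =
    t * ((sin \<xi>)\<^sup>2 + (cos \<xi>)\<^sup>2)"
    unfolding plane_rotation_def prod.case fst_conv snd_conv by algebra
  then show ?thesis by simp
qed

lemma norm_plane_rotation: "(norm (plane_rotation \<theta> (t, s)))\<^sup>2 = t\<^sup>2 + s\<^sup>2"
proof -
  have "(norm (plane_rotation \<theta> (t, s)))\<^sup>2 = (t * cos \<theta> - s * sin \<theta>)\<^sup>2 + (t * sin \<theta> + s * cos \<theta>)\<^sup>2"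
    by (simp add: plane_rotation_def norm_Pair)
  also have "\<dots> = (t\<^sup>2 + s\<^sup>2) * ((sin \<theta>)\<^sup>2 + (cos \<theta>)\<^sup>2)" by algebra
  finally show ?thesis by simp
qed

lemma disk_weight_norm: "disk_weight \<mu> v = (1 - (norm v)\<^sup>2) powr (\<mu> - 1/2)"
  by (simp add: disk_weight_def split_beta norm_prod_def algebra_simps)

lemma disk_weight_rotation: "disk_weight \<mu> (plane_rotation \<theta> (t, s)) = (1 - s\<^sup>2 - t\<^sup>2) powr (\<mu> - 1/2)"
  by (simp add: disk_weight_norm norm_plane_rotation algebra_simps)

lemma rotation_mem_disk:
  "plane_rotation \<theta> (t, s) \<in> cball 0 1 \<longleftrightarrow> t \<in> {-1..1} \<and> s \<in> {- sqrt (1 - t\<^sup>2)..sqrt (1 - t\<^sup>2)}"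
proof -
  have "plane_rotation \<theta> (t, s) \<in> cball 0 1 \<longleftrightarrow> (norm (plane_rotation \<theta> (t, s)))\<^sup>2 \<le> 1"
    by (simp add: power_le_one_iff abs_square_le_1[of "norm _", simplified])
  also have "\<dots> \<longleftrightarrow> t\<^sup>2 + s\<^sup>2 \<le> 1" by (simp only: norm_plane_rotation)
  also have "\<dots> \<longleftrightarrow> t\<^sup>2 \<le> 1 \<and> \<bar>s\<bar> \<le> sqrt (1 - t\<^sup>2)"
  proof
    assume *: "t\<^sup>2 + s\<^sup>2 \<le> 1"
    then have "\<bar>s\<bar> \<le> sqrt (1 - t\<^sup>2)" by (intro real_le_rsqrt) simp
    moreover have "t\<^sup>2 \<le> 1" using * zero_le_power2[of s] by linarith
    ultimately show "t\<^sup>2 \<le> 1 \<and> \<bar>s\<bar> \<le> sqrt (1 - t\<^sup>2)" by simp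
  next
    assume *: "t\<^sup>2 \<le> 1 \<and> \<bar>s\<bar> \<le> sqrt (1 - t\<^sup>2)"
    then have "\<bar>s\<bar>\<^sup>2 \<le> (sqrt (1 - t\<^sup>2))\<^sup>2" by (intro power_mono) auto
    then show "t\<^sup>2 + s\<^sup>2 \<le> 1" using * by simp
  qed
  also have "\<dots> \<longleftrightarrow> t \<in> {-1..1} \<and> s \<in> {- sqrt (1 - t\<^sup>2)..sqrt (1 - t\<^sup>2)}"
    by (auto simp: abs_square_le_1 abs_le_iff)
  finally show ?thesis .
qed

lemma indicator_disk_rotation:
  "indicator (cball 0 1) (plane_rotation \<theta> (t, s)) =
    (indicator {-1..1} t * indicator {- sqrt (1 - t\<^sup>2)..sqrt (1 - t\<^sup>2)} s :: real)"
  using rotation_mem_disk[of \<theta> t s] by (auto simp: indicator_def)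

lemma disk_integral_rotated:
  assumes "set_integrable lebesgue (cball 0 1) (\<lambda>v. F v * disk_weight \<mu> v)"
  shows "(LINT v:cball 0 1|lebesgue. F v * disk_weight \<mu> v) =
    (LINT t:{-1..1}|lebesgue. LINT s:{- sqrt (1 - t\<^sup>2)..sqrt (1 - t\<^sup>2)}|lebesgue.
       F (plane_rotation \<theta> (t, s)) * (1 - s\<^sup>2 - t\<^sup>2) powr (\<mu> - 1/2))"
  using lebesgue_integral_plane_rotation[OF assms[unfolded set_integrable_def], of \<theta>]
  unfolding set_lebesgue_integral_def indicator_disk_rotation disk_weight_rotation real_scaleR_def mult.assoc
  by simp

lemma jacobi_weight_symmetric: "u \<in> {-1..1} \<Longrightarrow> jacobi_weight a a u = (1 - u\<^sup>2) powr a"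
  by (simp add: jacobi_weight_def powr_mult[symmetric] algebra_simps power2_eq_square)

lemma set_lebesgue_integral_sum:
  fixes f :: "'i \<Rightarrow> 'a \<Rightarrow> real"
  assumes "\<And>i. i \<in> I \<Longrightarrow> set_integrable M A (f i)"
  shows "set_integrable M A (\<lambda>x. \<Sum>i\<in>I. f i x)"
    and "(LINT x:A|M. (\<Sum>i\<in>I. f i x)) = (\<Sum>i\<in>I. LINT x:A|M. f i x)"
  using assms unfolding set_integrable_def set_lebesgue_integral_def scaleR_sum_right
  by (auto intro: integral_sum)

text \<open>Put s = \<rho> u with \<rho> = sqrt (1 - t^2). The powers of \<rho> from ds and from the
  weight combine to (1 - t^2)^\<mu>, so integrating out s turns the disk weight into the Gegenbauer
  weight of index \<mu> + 1/2.\<close>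

lemma slice_moment:
  assumes \<mu>: "\<mu> \<ge> 0" and t: "t \<in> {-1..1}"
  shows "set_integrable lebesgue {- sqrt (1 - t\<^sup>2)..sqrt (1 - t\<^sup>2)} (\<lambda>s. s ^ b * (1 - s\<^sup>2 - t\<^sup>2) powr (\<mu> - 1/2))"
    and "(LINT s:{- sqrt (1 - t\<^sup>2)..sqrt (1 - t\<^sup>2)}|lebesgue. s ^ b * (1 - s\<^sup>2 - t\<^sup>2) powr (\<mu> - 1/2))
      = sqrt (1 - t\<^sup>2) ^ b * jacobi_functional (\<mu> - 1/2) (\<mu> - 1/2) (monom 1 b) * jacobi_weight \<mu> \<mu> t"
proof -
  define \<rho> where "\<rho> = sqrt (1 - t\<^sup>2)"
  define g where "g s = indicator {-\<rho>..\<rho>} s * (s ^ b * (1 - s\<^sup>2 - t\<^sup>2) powr (\<mu> - 1/2))" for s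
  have t2: "t\<^sup>2 \<le> 1" using t by (auto simp: abs_square_le_1 abs_le_iff)
  have \<rho>2: "\<rho>\<^sup>2 = 1 - t\<^sup>2" using t2 by (simp add: \<rho>_def)
  have "integrable lebesgue g \<and> integral\<^sup>L lebesgue g =
     \<rho> ^ b * jacobi_functional (\<mu> - 1/2) (\<mu> - 1/2) (monom 1 b) * jacobi_weight \<mu> \<mu> t"
  proof (cases "\<rho> = 0")
    case True
    \<comment> \<open>At t = 1 or t = -1 the slice is a single point, and both sides vanish because
      \<open>0 powr a = 0\<close> for every exponent, including a = 0.\<close>
    have z: "g s = 0" for s
    proof (cases "s = 0")
      case True
      have "1 - t\<^sup>2 = 0" using \<open>\<rho> = 0\<close> \<rho>2 by simp
      then show ?thesis using True by (simp add: g_def)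
    qed (simp add: g_def True)
    then have "g = (\<lambda>_. 0)" by auto
    moreover have "jacobi_weight \<mu> \<mu> t = 0"
      using True \<rho>2 by (simp add: jacobi_weight_symmetric[OF t])
    ultimately show ?thesis by simp
  next
    case False
    then have \<rho>: "\<rho> > 0" using t2 by (simp add: \<rho>_def)
    have g: "g (0 + \<rho> * u) = \<rho> ^ b * (\<rho>\<^sup>2) powr (\<mu> - 1/2) *
        (indicator {-1..1} u * (poly (monom 1 b) u * jacobi_weight (\<mu> - 1/2) (\<mu> - 1/2) u))" for u
    proof (cases "u \<in> {-1..1}")
      case True
      have "u\<^sup>2 \<le> 1" using True by (auto simp: abs_square_le_1 abs_le_iff)
      have "1 - (\<rho> * u)\<^sup>2 - t\<^sup>2 = \<rho>\<^sup>2 * (1 - u\<^sup>2)"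
        unfolding power_mult_distrib \<rho>2 by algebra
      then have "(1 - (\<rho> * u)\<^sup>2 - t\<^sup>2) powr (\<mu> - 1/2) = (\<rho>\<^sup>2) powr (\<mu> - 1/2) * (1 - u\<^sup>2) powr (\<mu> - 1/2)"
        using \<open>u\<^sup>2 \<le> 1\<close> by (simp add: powr_mult)
      moreover have "\<rho> * u \<in> {-\<rho>..\<rho>}"
        using True \<rho> mult_left_mono[of u 1 \<rho>] mult_left_mono[of "-1" u \<rho>] by auto
      ultimately show ?thesis
        using True by (simp add: g_def jacobi_weight_symmetric poly_monom power_mult_distrib)
    next
      case False
      have "\<rho> * u \<notin> {-\<rho>..\<rho>}"
      proof
        assume "\<rho> * u \<in> {-\<rho>..\<rho>}"
        then have "\<rho> * u \<le> \<rho> * 1" "\<rho> * (-1) \<le> \<rho> * u" by auto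
        then show False using False \<rho> by (simp only: mult_le_cancel_left_pos) auto
      qed
      then show ?thesis using False by (simp add: g_def)
    qed
    have int: "integrable lebesgue (\<lambda>u. indicator {-1..1} u * (poly (monom 1 b) u * jacobi_weight (\<mu> - 1/2) (\<mu> - 1/2) u))"
      using jacobi_functional_integrable[of "\<mu> - 1/2" "\<mu> - 1/2" "monom 1 b"] \<mu>
      by (simp add: set_integrable_def)
    have "integrable lebesgue (\<lambda>u. g (0 + \<rho> * u))"
      unfolding g by (intro integrable_mult_right int)
    then have 1: "integrable lebesgue g"
      using False lebesgue_integrable_real_affine_iff[of \<rho> g 0] by simp
    have "integral\<^sup>L lebesgue g = \<rho> * (\<integral>u. g (0 + \<rho> * u) \<partial>lebesgue)"
      using False \<rho> lebesgue_integral_real_affine[of \<rho> g 0] by simp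
    also have "\<dots> = \<rho> * (\<rho> ^ b * (\<rho>\<^sup>2) powr (\<mu> - 1/2) * jacobi_functional (\<mu> - 1/2) (\<mu> - 1/2) (monom 1 b))"
      unfolding g by (simp add: jacobi_functional_def set_lebesgue_integral_def)
    also have "\<rho> = (\<rho>\<^sup>2) powr (1/2)" using \<rho> by (simp add: powr_half_sqrt)
    then have "\<rho> * (\<rho>\<^sup>2) powr (\<mu> - 1/2) = (\<rho>\<^sup>2) powr \<mu>"
      by (metis powr_add add.commute diff_add_cancel)
    then have "\<rho> * (\<rho> ^ b * (\<rho>\<^sup>2) powr (\<mu> - 1/2) * jacobi_functional (\<mu> - 1/2) (\<mu> - 1/2) (monom 1 b))
      = \<rho> ^ b * jacobi_functional (\<mu> - 1/2) (\<mu> - 1/2) (monom 1 b) * jacobi_weight \<mu> \<mu> t"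
      unfolding jacobi_weight_symmetric[OF t] \<rho>2[symmetric] by (simp add: mult_ac)
    finally have "integral\<^sup>L lebesgue g = \<rho> ^ b * jacobi_functional (\<mu> - 1/2) (\<mu> - 1/2) (monom 1 b) * jacobi_weight \<mu> \<mu> t" .
    with 1 show ?thesis by simp
  qed
  then show "set_integrable lebesgue {- sqrt (1 - t\<^sup>2)..sqrt (1 - t\<^sup>2)} (\<lambda>s. s ^ b * (1 - s\<^sup>2 - t\<^sup>2) powr (\<mu> - 1/2))"
    "(LINT s:{- sqrt (1 - t\<^sup>2)..sqrt (1 - t\<^sup>2)}|lebesgue. s ^ b * (1 - s\<^sup>2 - t\<^sup>2) powr (\<mu> - 1/2))
      = sqrt (1 - t\<^sup>2) ^ b * jacobi_functional (\<mu> - 1/2) (\<mu> - 1/2) (monom 1 b) * jacobi_weight \<mu> \<mu> t"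
    by (simp_all add: g_def[abs_def] set_integrable_def set_lebesgue_integral_def \<rho>_def)
qed

lemma jacobi_functional_odd_moment:
  assumes "odd b"
  shows "jacobi_functional a a (monom 1 b) = 0"
proof -
  have "jacobi_functional a a (monom 1 b) =
    (\<integral>u. indicator {-1..1} (0 + (-1) * u) * (poly (monom 1 b) (0 + (-1) * u) * jacobi_weight a a (0 + (-1) * u)) \<partial>lebesgue)"
    unfolding jacobi_functional_def set_lebesgue_integral_def real_scaleR_def
    by (subst lebesgue_integral_real_affine[where c="-1" and t=0]) auto
  also have "\<dots> = (\<integral>u. - (indicator {-1..1} u * (poly (monom 1 b) u * jacobi_weight a a u)) \<partial>lebesgue)"
    using assms
    by (intro Bochner_Integration.integral_cong) (auto simp: poly_monom jacobi_weight_def indicator_def mult_ac)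
  also have "\<dots> = - jacobi_functional a a (monom 1 b)"
    by (simp add: jacobi_functional_def set_lebesgue_integral_def)
  finally show ?thesis by simp
qed

text \<open>For \<mu> < 1/2 the weight is unbounded near the circle. The slices are handled by
  \<open>slice_moment\<close> with b = 0, and their integrals are a multiple of an integrable Jacobi
  weight, so Tonelli applies.\<close>

lemma disk_weight_integrable:
  assumes \<mu>: "\<mu> \<ge> 0"
  shows "set_integrable lebesgue (cball 0 1) (disk_weight \<mu>)"
proof -
  define w where "w v = indicator (cball 0 1) v * disk_weight \<mu> v" for v
  have "(\<lambda>v::real\<times>real. 1 - (norm v)\<^sup>2) \<in> borel_measurable borel"
    by measurable
  then have w: "w \<in> borel_measurable borel"
    unfolding w_def[abs_def] disk_weight_norm by (intro borel_measurable_times powr_real_measurable borel_measurable_indicator) auto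
  have w_nonneg: "w v \<ge> 0" for v by (simp add: w_def disk_weight_norm)
  have w_eq: "w (t, s) = indicator {-1..1} t * (indicator {- sqrt (1 - t\<^sup>2)..sqrt (1 - t\<^sup>2)} s * (s ^ 0 * (1 - s\<^sup>2 - t\<^sup>2) powr (\<mu> - 1/2)))" for t s
    using indicator_disk_rotation[of 0 t s] disk_weight_rotation[of \<mu> 0 t s]
    by (simp add: w_def plane_rotation_def)
  have slice: "(\<lambda>s. w (t, s)) \<in> borel_measurable borel" for t
    by (rule slice_measurable(1)[OF w])
  have slice_int: "integrable lborel (\<lambda>s. w (t, s))" for t
  proof (cases "t \<in> {-1..1}")
    case True
    then have "integrable lebesgue (\<lambda>s. w (t, s))"
      using slice_moment(1)[OF \<mu> True, of 0] by (simp add: w_eq set_integrable_def)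
    then show ?thesis using integrable_completion[of "\<lambda>s. w (t, s)" lborel] slice by simp
  qed (simp add: w_eq)
  define K where "K = jacobi_functional (\<mu> - 1/2) (\<mu> - 1/2) (monom 1 0)"
  have val: "(\<integral>s. w (t, s) \<partial>lborel) = indicator {-1..1} t * (K * jacobi_weight \<mu> \<mu> t)" for t
  proof (cases "t \<in> {-1..1}")
    case True
    have "(\<integral>s. w (t, s) \<partial>lborel) = (\<integral>s. w (t, s) \<partial>lebesgue)"
      by (rule integral_completion[symmetric]) (use slice in simp)
    also have "\<dots> = K * jacobi_weight \<mu> \<mu> t"
      using slice_moment(2)[OF \<mu> True, of 0] True by (simp add: w_eq set_lebesgue_integral_def K_def)
    finally show ?thesis using True by simp
  qed (simp add: w_eq)
  have "integrable (lborel \<Otimes>\<^sub>M lborel) w"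
  proof (rule lborel_pair.Fubini_integrable)
    show "w \<in> borel_measurable (lborel \<Otimes>\<^sub>M lborel)" using w by (simp add: lborel_prod)
    have "integrable lebesgue (\<lambda>t. indicator {-1..1} t * (K * jacobi_weight \<mu> \<mu> t))"
      using jacobi_functional_integrable[of \<mu> \<mu> "[:K:]"] \<mu> by (simp add: set_integrable_def)
    then have "integrable lborel (\<lambda>t. indicator {-1..1} t * (K * jacobi_weight \<mu> \<mu> t))"
      by (subst (asm) integrable_completion) (simp_all add: jacobi_weight_def)
    then show "integrable lborel (\<lambda>t. \<integral>s. norm (w (t, s)) \<partial>lborel)"
      using w_nonneg by (simp add: val)
  qed (use slice_int in auto)
  then have "integrable lborel w" by (simp add: lborel_prod)
  then have "integrable lebesgue w" using w by (simp add: integrable_completion)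
  then show ?thesis by (simp add: set_integrable_def w_def[abs_def])
qed

lemma disk_integrable:
  assumes "\<mu> \<ge> 0" "continuous_on (cball 0 1) F"
  shows "set_integrable lebesgue (cball 0 1) (\<lambda>v. F v * disk_weight \<mu> v)"
  by (rule set_integrable_continuous_mult[OF disk_weight_integrable[OF assms(1)] assms(2)]) simp

text \<open>The mass of the disk weight is the product of two Beta values, one from a rescaled slice
  and one from the remaining variable. Legendre's duplication formula at z = \<mu> + 1/2 evaluates
  this product.\<close>

lemma disk_const_eq:
  assumes \<mu>: "\<mu> \<ge> 0"
  shows "disk_const \<mu> * jacobi_functional (\<mu> - 1/2) (\<mu> - 1/2) 1 * jacobi_functional \<mu> \<mu> 1 = 1"
proof -
  define z where "z = \<mu> + 1/2"
  have z: "z > 0" using \<mu> by (simp add: z_def)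
  have "Gamma (complex_of_real z) * Gamma (complex_of_real z + 1/2) =
     exp ((1 - 2 * complex_of_real z) * of_real (ln 2)) * of_real (sqrt pi) * Gamma (2 * complex_of_real z)"
    using z by (intro Gamma_legendre_duplication)
      (auto simp: nonpos_Ints_def complex_eq_iff)
  also have "complex_of_real z + 1/2 = of_real (z + 1/2)" by simp
  also have "2 * complex_of_real z = of_real (2 * z)" by simp
  also have "(1 - of_real (2 * z)) * complex_of_real (ln 2) = of_real ((1 - 2 * z) * ln 2)" by simp
  finally have "complex_of_real (Gamma z * Gamma (z + 1/2)) =
     complex_of_real (exp ((1 - 2 * z) * ln 2) * sqrt pi * Gamma (2 * z))"
    by (simp only: Gamma_complex_of_real exp_of_real of_real_mult[symmetric])
  then have "Gamma z * Gamma (z + 1/2) = exp ((1 - 2 * z) * ln 2) * sqrt pi * Gamma (2 * z)"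
    by (simp only: of_real_eq_iff)
  also have "exp ((1 - 2 * z) * ln 2) = 2 powr (1 - 2 * z)" by (simp add: powr_def)
  finally have leg: "Gamma z * Gamma (z + 1/2) = 2 powr (1 - 2 * z) * sqrt pi * Gamma (2 * z)" .
  have G: "Gamma (2 * z + 1) = 2 * z * Gamma (2 * z)"
    using z Gamma_plus1[of "2 * z"] by (auto simp: nonpos_Ints_def)
  have "Gamma (2 * z) > 0" using z by (simp add: Gamma_real_pos)
  then have pos: "Gamma (2 * z) \<noteq> 0" by linarith
  have a: "jacobi_functional (\<mu> - 1/2) (\<mu> - 1/2) 1 = 2 powr (2 * z - 1) * (Gamma z * Gamma z / Gamma (2 * z))"
  proof -
    have e: "\<mu> - 1/2 + (\<mu> - 1/2) + 1 = 2 * z - 1" "\<mu> - 1/2 + 1 + real 0 = z" "z + z = 2 * z"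
      by (simp_all add: z_def)
    show ?thesis
      using jacobi_functional_moment[of "\<mu> - 1/2" "\<mu> - 1/2" 0 0] \<mu> unfolding Beta_def e by simp
  qed
  have b: "jacobi_functional \<mu> \<mu> 1 = 2 powr (2 * z) * (Gamma (z + 1/2) * Gamma (z + 1/2) / (2 * z * Gamma (2 * z)))"
  proof -
    have e: "\<mu> + \<mu> + 1 = 2 * z" "\<mu> + 1 + real 0 = z + 1/2" "z + 1/2 + (z + 1/2) = 2 * z + 1"
      by (simp_all add: z_def)
    show ?thesis
      using jacobi_functional_moment[of \<mu> \<mu> 0 0] \<mu> unfolding Beta_def e G by simp
  qed
  have p2: "2 powr (2 * z - 1) * 2 powr (1 - 2 * z) = 1" "2 powr (2 * z) * 2 powr (1 - 2 * z) = (2::real)"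
    by (simp_all add: powr_add[symmetric])
  have "disk_const \<mu> * jacobi_functional (\<mu> - 1/2) (\<mu> - 1/2) 1 * jacobi_functional \<mu> \<mu> 1 =
    z / pi * (2 powr (2 * z - 1) * 2 powr (2 * z)) * (Gamma z * Gamma (z + 1/2)) * (Gamma z * Gamma (z + 1/2)) / (2 * z * Gamma (2 * z) * Gamma (2 * z))"
    unfolding a b disk_const_def z_def[symmetric] by (simp add: mult_ac)
  also have "\<dots> = z / pi * ((2 powr (2 * z - 1) * 2 powr (1 - 2 * z)) * (2 powr (2 * z) * 2 powr (1 - 2 * z))) *
      (sqrt pi * sqrt pi) * (Gamma (2 * z) * Gamma (2 * z)) / (2 * z * Gamma (2 * z) * Gamma (2 * z))"
    unfolding leg by (simp only: mult_ac)
  also have "\<dots> = 1"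
    unfolding p2 using z pos by simp
  finally show ?thesis .
qed

text \<open>The power (1 - t^2)^(j/2) as a polynomial. For odd j it is set to zero, matching the
  vanishing odd moments of a symmetric weight.\<close>

definition even_slice_poly :: "nat \<Rightarrow> real poly" where
  "even_slice_poly j = (if even j then [:1, 0, -1:] ^ (j div 2) else 0)"

lemma even_slice_poly:
  assumes "t \<in> {-1..1}"
  shows "sqrt (1 - t\<^sup>2) ^ j * jacobi_functional a a (monom 1 j) = jacobi_functional a a (monom 1 j) * poly (even_slice_poly j) t"
proof (cases "even j")
  case True
  then obtain i where j: "j = 2 * i" by auto
  have "t\<^sup>2 \<le> 1" using assms by (auto simp: abs_square_le_1 abs_le_iff)
  then have "sqrt (1 - t\<^sup>2) ^ j = (1 - t\<^sup>2) ^ i" by (simp add: j power_mult)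
  moreover have "1 - t * t = 1 - t\<^sup>2" by (simp add: power2_eq_square)
  ultimately show ?thesis by (simp add: even_slice_poly_def j)
qed (simp add: jacobi_functional_odd_moment)

text \<open>The polynomial \<open>q\<close> is \<open>Q\<close> with the direction orthogonal to the ridge integrated out.\<close>

lemma disk_inner_ridge:
  assumes \<mu>: "\<mu> \<ge> 0" and Q: "Q \<in> bipolys n"
  obtains q where "degree q \<le> n" "poly q 1 = Q (cos \<xi>, sin \<xi>)"
    "\<And>p. disk_inner \<mu> (\<lambda>v. poly p (fst v * cos \<xi> + snd v * sin \<xi>)) Q =
      jacobi_functional \<mu> \<mu> (p * q) / jacobi_functional \<mu> \<mu> 1"
proof -
  obtain c where c: "(\<lambda>v. Q (plane_rotation \<xi> v)) = (\<lambda>v. \<Sum>i\<le>n. \<Sum>j\<le>n - i. c i j * fst v ^ i * snd v ^ j)"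
    using bipolysE[OF bipolys_rotation[OF Q, of \<xi>]] .
  have Qc: "Q (plane_rotation \<xi> (t, s)) = (\<Sum>i\<le>n. \<Sum>j\<le>n - i. c i j * t ^ i * s ^ j)" for t s
    using fun_cong[OF c, of "(t, s)"] by simp
  define K where "K j = jacobi_functional (\<mu> - 1/2) (\<mu> - 1/2) (monom 1 j)" for j
  have K0: "K 0 > 0" using jacobi_functional_pos[of "\<mu> - 1/2" "\<mu> - 1/2"] \<mu> by (simp add: K_def)
  define q where "q = (\<Sum>i\<le>n. \<Sum>j\<le>n - i. smult (c i j * K j / K 0) (monom 1 i * even_slice_poly j))"
  show thesis
  proof
    have deg: "degree (even_slice_poly j) \<le> j" for j
    proof -
      have "degree ([:1, 0, -1:] ^ (j div 2) :: real poly) \<le> degree [:1, 0, -1 :: real:] * (j div 2)"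
        by (rule degree_power_le)
      also have "degree [:1, 0, -1 :: real:] * (j div 2) \<le> j" by simp
      finally show ?thesis by (simp add: even_slice_poly_def)
    qed
    have deg': "degree (smult a (monom 1 i * even_slice_poly j)) \<le> n" if "i \<le> n" "j \<le> n - i" for a :: real and i j
    proof -
      have "degree (monom 1 i * even_slice_poly j) \<le> i + degree (even_slice_poly j)"
        using degree_mult_le[of "monom 1 i" "even_slice_poly j"] by (simp add: degree_monom_eq)
      then show ?thesis
        using degree_smult_le[of a "monom 1 i * even_slice_poly j"] deg[of j] that by linarith
    qed
    show "degree q \<le> n"
      unfolding q_def by (intro degree_sum_le deg') auto
    \<comment> \<open>At t = 1 the slice shrinks to the point e_\<xi> on the circle: only the terms
      with j = 0 survive, and the division by \<open>K 0\<close> gives them weight one.\<close>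
    have e1: "poly (even_slice_poly j) 1 = (if j = 0 then 1 else 0)" for j
      by (auto simp: even_slice_poly_def power_0_left)
    have "poly q 1 = (\<Sum>i\<le>n. \<Sum>j\<le>n - i. if j = 0 then c i 0 else 0)"
      using K0 unfolding q_def poly_sum poly_smult poly_mult poly_monom e1
      by (intro sum.cong refl) auto
    also have "\<dots> = Q (plane_rotation \<xi> (1, 0))"
      unfolding Qc by (intro sum.cong) (auto simp: power_0_left)
    finally show "poly q 1 = Q (cos \<xi>, sin \<xi>)" by (simp add: plane_rotation_def)
    fix p
    let ?F = "\<lambda>v. poly p (fst v * cos \<xi> + snd v * sin \<xi>) * Q v"
    have inner: "(LINT s:{- sqrt (1 - t\<^sup>2)..sqrt (1 - t\<^sup>2)}|lebesgue. ?F (plane_rotation \<xi> (t, s)) * (1 - s\<^sup>2 - t\<^sup>2) powr (\<mu> - 1/2))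
      = K 0 * (poly (p * q) t * jacobi_weight \<mu> \<mu> t)" (is "?L = ?R") if t: "t \<in> {-1..1}" for t
    proof -
      let ?S = "{- sqrt (1 - t\<^sup>2)..sqrt (1 - t\<^sup>2)}"
      let ?w = "\<lambda>s. (1 - s\<^sup>2 - t\<^sup>2) powr (\<mu> - 1/2)"
      note I = slice_moment(1)[OF \<mu> t] and V = slice_moment(2)[OF \<mu> t, folded K_def]
      have "?L = (LINT s:?S|lebesgue. (\<Sum>i\<le>n. \<Sum>j\<le>n - i. (poly p t * c i j * t ^ i) * (s ^ j * ?w s)))"
        unfolding ridge_rotation Qc by (simp add: sum_distrib_left sum_distrib_right mult_ac)
      also have "\<dots> = (\<Sum>i\<le>n. \<Sum>j\<le>n - i. (poly p t * c i j * t ^ i) * (LINT s:?S|lebesgue. s ^ j * ?w s))"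
        using I by (simp add: set_lebesgue_integral_sum)
      also have "\<dots> = (\<Sum>i\<le>n. \<Sum>j\<le>n - i. (poly p t * c i j * t ^ i) * (K j * poly (even_slice_poly j) t * jacobi_weight \<mu> \<mu> t))"
        unfolding V even_slice_poly[OF t, where a="\<mu> - 1/2", folded K_def] ..
      also have "\<dots> = ?R"
        using K0 by (simp add: q_def poly_sum poly_monom sum_distrib_left sum_distrib_right mult_ac)
      finally show ?thesis .
    qed
    have "set_integrable lebesgue (cball 0 1) (\<lambda>v. ?F v * disk_weight \<mu> v)"
      by (intro disk_integrable[OF \<mu>] continuous_intros bipolys_continuous[OF Q])
    then have "disk_inner \<mu> (\<lambda>v. poly p (fst v * cos \<xi> + snd v * sin \<xi>)) Q = disk_const \<mu> *
      (LINT t:{-1..1}|lebesgue. LINT s:{- sqrt (1 - t\<^sup>2)..sqrt (1 - t\<^sup>2)}|lebesgue.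
        ?F (plane_rotation \<xi> (t, s)) * (1 - s\<^sup>2 - t\<^sup>2) powr (\<mu> - 1/2))"
      unfolding disk_inner_def by (subst disk_integral_rotated[of _ _ \<xi>]) auto
    also have "\<dots> = disk_const \<mu> * (LINT t:{-1..1}|lebesgue. K 0 * (poly (p * q) t * jacobi_weight \<mu> \<mu> t))"
      by (intro arg_cong[where f="(*) _"] set_lebesgue_integral_cong) (use inner in auto)
    also have "\<dots> = disk_const \<mu> * K 0 * jacobi_functional \<mu> \<mu> (p * q)"
      by (simp add: jacobi_functional_def)
    also have "disk_const \<mu> * K 0 = 1 / jacobi_functional \<mu> \<mu> 1"
      using disk_const_eq[OF \<mu>] jacobi_functional_pos[of \<mu> \<mu>] \<mu> by (simp add: K_def field_simps)
    finally show "disk_inner \<mu> (\<lambda>v. poly p (fst v * cos \<xi> + snd v * sin \<xi>)) Q =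
      jacobi_functional \<mu> \<mu> (p * q) / jacobi_functional \<mu> \<mu> 1" by simp
  qed
qed

lemma disk_inner_commute: "disk_inner \<mu> P Q = disk_inner \<mu> Q P"
  by (simp add: disk_inner_def mult.commute)

lemma disk_inner_sum:
  assumes \<mu>: "\<mu> \<ge> 0" and f: "\<And>i. i \<in> I \<Longrightarrow> f i \<in> bipolys n" and Q: "Q \<in> bipolys n'"
  shows "disk_inner \<mu> (\<lambda>v. \<Sum>i\<in>I. c i * f i v) Q = (\<Sum>i\<in>I. c i * disk_inner \<mu> (f i) Q)"
proof (cases "finite I")
  case True
  have I: "set_integrable lebesgue (cball 0 1) (\<lambda>v. c i * (f i v * Q v * disk_weight \<mu> v))" if "i \<in> I" for i
    by (intro set_integrable_mult_right disk_integrable[OF \<mu>] continuous_intros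
        bipolys_continuous[OF f[OF that]] bipolys_continuous[OF Q])
  have "(LINT v:cball 0 1|lebesgue. (\<Sum>i\<in>I. c i * f i v) * Q v * disk_weight \<mu> v) =
    (LINT v:cball 0 1|lebesgue. (\<Sum>i\<in>I. c i * (f i v * Q v * disk_weight \<mu> v)))"
    by (simp add: sum_distrib_right mult.assoc)
  also have "\<dots> = (\<Sum>i\<in>I. LINT v:cball 0 1|lebesgue. c i * (f i v * Q v * disk_weight \<mu> v))"
    using I by (rule set_lebesgue_integral_sum)
  finally show ?thesis
    by (simp add: disk_inner_def sum_distrib_left mult.left_commute)
qed (simp add: disk_inner_def)

text \<open>A nonnegative integrand with zero integral vanishes almost everywhere. The weight is
  positive on the open disk, and the zero set of g is closed, so there the conclusion holds
  everywhere.\<close>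

lemma disk_integral_zero:
  assumes \<mu>: "\<mu> \<ge> 0" and g: "continuous_on UNIV g" and nonneg: "\<And>v. v \<in> cball 0 1 \<Longrightarrow> g v \<ge> 0"
    and zero: "(LINT v:cball 0 1|lebesgue. g v * disk_weight \<mu> v) = 0" and v: "norm v < 1"
  shows "g v = 0"
proof -
  have I: "integrable lebesgue (\<lambda>v. indicator (cball 0 1) v *\<^sub>R (g v * disk_weight \<mu> v))"
    using disk_integrable[OF \<mu> continuous_on_subset[OF g]] by (simp add: set_integrable_def)
  have "AE v in lebesgue. indicator (cball 0 1) v *\<^sub>R (g v * disk_weight \<mu> v) = 0"
    using zero nonneg
    by (subst integral_nonneg_eq_0_iff_AE[OF I, symmetric])
      (auto simp: set_lebesgue_integral_def disk_weight_norm indicator_def)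
  then have "AE v\<in>ball 0 1 in lebesgue. v \<in> {v. g v = 0}"
  proof eventually_elim
    case (elim v)
    show ?case
    proof
      assume v: "v \<in> ball 0 1"
      then have "(norm v)\<^sup>2 < 1" by (simp add: abs_square_less_1)
      then have "disk_weight \<mu> v \<noteq> 0" by (simp add: disk_weight_norm)
      moreover have "v \<in> cball 0 1" using v by auto
      ultimately show "v \<in> {v. g v = 0}" using elim by simp
    qed
  qed
  moreover have "closed {v. g v = 0}"
    using continuous_closed_preimage_constant[OF g closed_UNIV, of 0] by simp
  ultimately have "v \<in> {v. g v = 0}"
    using v mem_closed_if_AE_lebesgue_open[OF open_ball, of "{v. g v = 0}" 0 1 v] by simp
  then show ?thesis by simp
qed

lemma disk_inner_definite:
  assumes "\<mu> \<ge> 0" "f \<in> bipolys n" "disk_inner \<mu> f f = 0"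
  shows "f = (\<lambda>_. 0)"
proof
  fix v
  have "disk_const \<mu> \<noteq> 0" using assms(1) by (simp add: disk_const_def)
  then have "(LINT v:cball 0 1|lebesgue. f v * f v * disk_weight \<mu> v) = 0"
    using assms(3) by (simp add: disk_inner_def)
  moreover have "continuous_on UNIV (\<lambda>v. f v * f v)"
    by (intro continuous_intros bipolys_continuous[OF assms(2)])
  ultimately have "f v * f v = 0" if "norm v < 1" for v
    using disk_integral_zero[OF assms(1), of "\<lambda>v. f v * f v" v] that by simp
  then have "f v = 0" if "norm v < 1" for v
    using that by simp
  then show "f v = 0"
    by (rule bipolys_zero_on_ball[OF assms(2)])
qed

section \<open>Reproducing kernels\<close>

text \<open>An f of degree at most j < k that is orthogonal to \<open>bipolys j\<close> is
  orthogonal to itself and hence zero; so orthogonality already forces the exact degree.\<close>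

lemma disk_orth_polys_iff:
  assumes \<mu>: "\<mu> \<ge> 0"
  shows "f \<in> disk_orth_polys \<mu> k \<longleftrightarrow> f \<in> bipolys k \<and> (\<forall>j<k. \<forall>Q\<in>bipolys j. disk_inner \<mu> f Q = 0)"
proof
  assume "f \<in> disk_orth_polys \<mu> k"
  then show "f \<in> bipolys k \<and> (\<forall>j<k. \<forall>Q\<in>bipolys j. disk_inner \<mu> f Q = 0)"
    by (auto simp: disk_orth_polys_def has_total_degree_def bipolys_const)
next
  assume f: "f \<in> bipolys k \<and> (\<forall>j<k. \<forall>Q\<in>bipolys j. disk_inner \<mu> f Q = 0)"
  have "f = (\<lambda>_. 0)" if "j < k" "f \<in> bipolys j" for j
    using disk_inner_definite[OF \<mu> that(2)] f that by blast
  then show "f \<in> disk_orth_polys \<mu> k"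
    using f by (auto simp: disk_orth_polys_def has_total_degree_def)
qed

lemma disk_orth_polys_sum:
  assumes \<mu>: "\<mu> \<ge> 0" and f: "\<And>i. i \<in> I \<Longrightarrow> f i \<in> disk_orth_polys \<mu> k"
  shows "(\<lambda>v. \<Sum>i\<in>I. c i * f i v) \<in> disk_orth_polys \<mu> k"
  unfolding disk_orth_polys_iff[OF \<mu>]
proof (intro conjI allI impI ballI)
  have fb: "f i \<in> bipolys k" if "i \<in> I" for i
    using f[OF that] by (simp add: disk_orth_polys_iff[OF \<mu>])
  show "(\<lambda>v. \<Sum>i\<in>I. c i * f i v) \<in> bipolys k"
    by (intro bipolys_sum bipolys_scale fb)
  fix j Q assume "j < k" "Q \<in> bipolys j"
  then show "disk_inner \<mu> (\<lambda>v. \<Sum>i\<in>I. c i * f i v) Q = 0"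
    using f by (subst disk_inner_sum[OF \<mu> fb]) (auto simp: disk_orth_polys_iff[OF \<mu>])
qed

lemma gegenbauer_rec_orthogonal_lower:
  assumes \<mu>: "\<mu> \<ge> 0" and p: "\<And>i. i \<ge> k \<Longrightarrow> coeff p i = 0"
  shows "jacobi_functional \<mu> \<mu> (gegenbauer_rec (\<mu> + 1/2) k * p) = 0"
proof (rule orthogonal_to_lower_degree[where G="gegenbauer_rec (\<mu> + 1/2)" and k=k])
  show "jacobi_functional \<mu> \<mu> (p + q) = jacobi_functional \<mu> \<mu> p + jacobi_functional \<mu> \<mu> q" for p q
    using \<mu> by (intro jacobi_functional_add) auto
  show "degree (gegenbauer_rec (\<mu> + 1/2) n) = n" for n
    using \<mu> gegenbauer_rec_degree[of "\<mu> + 1/2" n] by simp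
  show "gegenbauer_rec (\<mu> + 1/2) n \<noteq> 0" for n
    using \<mu> gegenbauer_rec_degree[of "\<mu> + 1/2" n] by auto
  show "jacobi_functional \<mu> \<mu> (gegenbauer_rec (\<mu> + 1/2) k * gegenbauer_rec (\<mu> + 1/2) n) = 0" if "n < k" for n
    using gegenbauer_rec_orthogonal[OF \<mu>, of k n] that by simp
qed (use p jacobi_functional_smult in auto)

lemma ridge_poly_eq:
  assumes "\<mu> \<ge> 0"
  shows "ridge_poly \<mu> k \<xi> = (\<lambda>v. poly (smult ((real k + \<mu> + 1/2) / (\<mu> + 1/2)) (gegenbauer_rec (\<mu> + 1/2) k))
    (fst v * cos \<xi> + snd v * sin \<xi>))"
  by (simp add: ridge_poly_def[abs_def] gegenbauer_eq_rec[OF assms])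

lemma ridge_poly_orth:
  assumes \<mu>: "\<mu> \<ge> 0"
  shows "ridge_poly \<mu> k \<xi> \<in> disk_orth_polys \<mu> k"
  unfolding disk_orth_polys_iff[OF \<mu>]
proof (intro conjI allI impI ballI)
  let ?p = "smult ((real k + \<mu> + 1/2) / (\<mu> + 1/2)) (gegenbauer_rec (\<mu> + 1/2) k)"
  show "ridge_poly \<mu> k \<xi> \<in> bipolys k"
    unfolding ridge_poly_eq[OF \<mu>] using gegenbauer_rec_degree[of "\<mu> + 1/2" k] \<mu>
    by (intro bipolys_ridge) auto
  fix j Q assume j: "j < k" "Q \<in> bipolys j"
  obtain q where q: "degree q \<le> j" "\<And>p. disk_inner \<mu> (\<lambda>v. poly p (fst v * cos \<xi> + snd v * sin \<xi>)) Q =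
      jacobi_functional \<mu> \<mu> (p * q) / jacobi_functional \<mu> \<mu> 1"
    by (rule disk_inner_ridge[OF \<mu> j(2), of \<xi>], rule that)
  have "jacobi_functional \<mu> \<mu> (gegenbauer_rec (\<mu> + 1/2) k * q) = 0"
    using q(1) j by (intro gegenbauer_rec_orthogonal_lower[OF \<mu>]) (simp add: coeff_eq_0)
  then show "disk_inner \<mu> (ridge_poly \<mu> k \<xi>) Q = 0"
    unfolding ridge_poly_eq[OF \<mu>] q(2) by (simp add: jacobi_functional_smult)
qed

text \<open>Ridge polynomials of lower degree are orthogonal to Q, so the slice polynomial q is
  orthogonal to all lower degrees and is a multiple of the Gegenbauer polynomial. The norm formula
  then returns q(1), the value of Q at e_\<xi>.\<close>

lemma ridge_poly_reproducing:
  assumes \<mu>: "\<mu> \<ge> 0" and Q: "Q \<in> disk_orth_polys \<mu> k"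
  shows "disk_inner \<mu> (ridge_poly \<mu> k \<xi>) Q = Q (cos \<xi>, sin \<xi>)"
proof -
  let ?\<Lambda> = "jacobi_functional \<mu> \<mu>" and ?G = "gegenbauer_rec (\<mu> + 1/2)"
  have Qb: "Q \<in> bipolys k" and Qo: "\<And>j R. j < k \<Longrightarrow> R \<in> bipolys j \<Longrightarrow> disk_inner \<mu> Q R = 0"
    using Q by (auto simp: disk_orth_polys_iff[OF \<mu>])
  have L1: "?\<Lambda> 1 > 0" using jacobi_functional_pos[of \<mu> \<mu>] \<mu> by simp
  have add: "?\<Lambda> (p + q) = ?\<Lambda> p + ?\<Lambda> q" for p q
    using \<mu> by (intro jacobi_functional_add) auto
  have deg: "degree (?G n) = n" "lead_coeff (?G n) > 0" for n
    using \<mu> gegenbauer_rec_degree[of "\<mu> + 1/2" n] by auto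
  have G1: "poly (?G n) 1 > 0" for n
    using \<mu> by (simp add: gegenbauer_rec_at_1 pochhammer_pos)
  obtain q where q: "degree q \<le> k" "poly q 1 = Q (cos \<xi>, sin \<xi>)"
    and in_q: "\<And>p. disk_inner \<mu> (\<lambda>v. poly p (fst v * cos \<xi> + snd v * sin \<xi>)) Q = ?\<Lambda> (p * q) / ?\<Lambda> 1"
    by (rule disk_inner_ridge[OF \<mu> Qb, of \<xi>], rule that)
  have q_orth: "?\<Lambda> (p * q) = 0" if "degree p < k" for p
  proof -
    have "disk_inner \<mu> (\<lambda>v. poly p (fst v * cos \<xi> + snd v * sin \<xi>)) Q = 0"
      using Qo[OF that bipolys_ridge[OF order.refl]] by (simp add: disk_inner_commute[of \<mu> _ Q])
    then show ?thesis using in_q[of p] L1 by simp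
  qed
  define c where "c = coeff q k / lead_coeff (?G k)"
  have "q - smult c (?G k) = 0"
  proof (rule zero_if_orthogonal[where \<Lambda>="?\<Lambda>" and G="?G" and k=k, OF add jacobi_functional_smult])
    show "?G n \<noteq> 0" for n using deg(2)[of n] by auto
    show "?\<Lambda> (?G n * ?G n) \<noteq> 0" for n
      using gegenbauer_rec_norm[OF \<mu>, of n] G1[of n] L1 \<mu> by simp
    show "coeff (q - smult c (?G k)) i = 0" if "k \<le> i" for i
    proof (cases "i = k")
      case True
      then show ?thesis using deg[of k] by (simp add: c_def)
    next
      case False
      then show ?thesis using that q(1) deg(1)[of k] by (simp add: coeff_eq_0)
    qed
    show "?\<Lambda> ((q - smult c (?G k)) * ?G n) = 0" if "n < k" for n
    proof -
      have "(q - smult c (?G k)) * ?G n = ?G n * q + smult (- c) (?G k * ?G n)"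
        by (simp add: algebra_simps)
      then show ?thesis
        using that q_orth[of "?G n"] deg(1)[of n] gegenbauer_rec_orthogonal[OF \<mu>, of k n]
        by (simp only: add jacobi_functional_smult)
    qed
  qed (use deg(1) gegenbauer_rec_orthogonal[OF \<mu>] in auto)
  then have q_eq: "q = smult c (?G k)" by simp
  have "disk_inner \<mu> (ridge_poly \<mu> k \<xi>) Q = (real k + \<mu> + 1/2) / (\<mu> + 1/2) * (c * ?\<Lambda> (?G k * ?G k)) / ?\<Lambda> 1"
    unfolding ridge_poly_eq[OF \<mu>] in_q by (simp add: q_eq jacobi_functional_smult)
  also have "\<dots> = c * poly (?G k) 1"
    unfolding gegenbauer_rec_norm[OF \<mu>] using L1 \<mu> by (simp add: divide_simps)
  also have "\<dots> = Q (cos \<xi>, sin \<xi>)"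
    using q(2) by (simp add: q_eq)
  finally show ?thesis .
qed

text \<open>The quotient R has degree at most k - 2, so Q is orthogonal to it; but that inner
  product integrates (1 - norm^2) R^2, which is nonnegative on the disk.\<close>

lemma disk_orth_vanishing_on_circle:
  assumes \<mu>: "\<mu> \<ge> 0" and Q: "Q \<in> disk_orth_polys \<mu> k" and z: "\<And>\<xi>. Q (cos \<xi>, sin \<xi>) = 0"
  shows "Q v = 0"
proof -
  have Qb: "Q \<in> bipolys k" and Qo: "\<And>j R. j < k \<Longrightarrow> R \<in> bipolys j \<Longrightarrow> disk_inner \<mu> Q R = 0"
    using Q by (auto simp: disk_orth_polys_iff[OF \<mu>])
  obtain R where R: "R \<in> circle_quotients k" and eq: "\<And>v. Q v = (1 - (fst v)\<^sup>2 - (snd v)\<^sup>2) * R v"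
    by (rule vanishing_on_circle[OF Qb z], rule that)
  have "R v = 0"
  proof (cases "k < 2")
    case True
    then show ?thesis using R by (simp add: circle_quotients_def)
  next
    case False
    then have Rb: "R \<in> bipolys (k - 2)" using R by (simp add: circle_quotients_def)
    have nrm: "1 - (fst v)\<^sup>2 - (snd v)\<^sup>2 = 1 - (norm v)\<^sup>2" for v :: "real \<times> real"
      by (simp add: norm_prod_def)
    have "disk_inner \<mu> Q R = 0" using False by (intro Qo[OF _ Rb]) simp
    moreover have "disk_const \<mu> \<noteq> 0" using \<mu> by (simp add: disk_const_def)
    ultimately have zero: "(LINT v:cball 0 1|lebesgue. Q v * R v * disk_weight \<mu> v) = 0"
      by (simp add: disk_inner_def)
    have cont: "continuous_on UNIV (\<lambda>v. Q v * R v)"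
      by (intro continuous_intros bipolys_continuous[OF Qb] bipolys_continuous[OF Rb])
    have QR: "Q v * R v = (1 - (norm v)\<^sup>2) * (R v)\<^sup>2" for v
      unfolding eq nrm by (simp add: power2_eq_square)
    have nonneg: "Q v * R v \<ge> 0" if "v \<in> cball 0 1" for v
      using that unfolding QR by (intro mult_nonneg_nonneg) (auto simp: abs_square_le_1)
    have "R v = 0" if v: "norm v < 1" for v
    proof -
      have "Q v * R v = 0" by (rule disk_integral_zero[OF \<mu> cont nonneg zero v])
      moreover have "(norm v)\<^sup>2 < 1" using v by (simp add: abs_square_less_1)
      ultimately show ?thesis by (simp add: QR)
    qed
    then show ?thesis by (rule bipolys_zero_on_ball[OF Rb])
  qed
  then show ?thesis by (simp add: eq)
qed

text \<open>Through \<open>norm\<close> and \<open>Arg\<close> not even polynomiality of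
  \<open>disk_basis\<close> is visible. It is inherited from the ridge polynomials.\<close>

lemma disk_basis_orth:
  assumes \<mu>: "\<mu> \<ge> 0" and l: "2 * l \<le> k"
  shows "disk_basis \<mu> k l \<epsilon> \<in> disk_orth_polys \<mu> k"
proof -
  \<comment> \<open>The averaging formula is used with k in place of m, which is admissible because
    k \<le> 2 * k.\<close>
  define c where "c \<nu> = ridge_factor \<mu> l k * (1 / (2 * real k + 1)) *
    disk_basis \<mu> k l \<epsilon> (cos (equi_angle k \<nu>), sin (equi_angle k \<nu>))" for \<nu>
  have "(\<lambda>v. \<Sum>\<nu>\<in>{0..2*k}. c \<nu> * ridge_poly \<mu> k (equi_angle k \<nu>) v) \<in> disk_orth_polys \<mu> k"
    by (rule disk_orth_polys_sum[OF \<mu> ridge_poly_orth[OF \<mu>]])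
  also have "(\<lambda>v. \<Sum>\<nu>\<in>{0..2*k}. c \<nu> * ridge_poly \<mu> k (equi_angle k \<nu>) v) = disk_basis \<mu> k l \<epsilon>"
  proof
    fix v
    show "(\<Sum>\<nu>\<in>{0..2*k}. c \<nu> * ridge_poly \<mu> k (equi_angle k \<nu>) v) = disk_basis \<mu> k l \<epsilon> v"
      using disk_basis_eq_ridge_sum[OF \<mu> l, of k v \<epsilon>]
      by (simp add: c_def sum_distrib_left mult_ac)
  qed
  finally show ?thesis .
qed

lemma disk_basis_expansion:
  assumes \<mu>: "\<mu> \<ge> 0" and Q: "Q \<in> disk_orth_polys \<mu> k"
  shows "(\<Sum>i\<in>disk_basis_index k. disk_inner \<mu> (disk_basis \<mu> k (fst i) (snd i)) Q * disk_basis \<mu> k (fst i) (snd i) x) = Q x"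
proof -
  define b where "b i = disk_basis \<mu> k (fst i) (snd i)" for i
  have b: "b i \<in> disk_orth_polys \<mu> k" if "i \<in> disk_basis_index k" for i
    using that unfolding b_def by (intro disk_basis_orth[OF \<mu>]) (auto simp: disk_basis_index_def)
  have Qb: "Q \<in> bipolys k" and bb: "\<And>i. i \<in> disk_basis_index k \<Longrightarrow> b i \<in> bipolys k"
    using Q b by (auto simp: disk_orth_polys_iff[OF \<mu>])
  define R where "R x = (\<Sum>i\<in>disk_basis_index k. disk_inner \<mu> (b i) Q * b i x)" for x
  have R: "R \<in> disk_orth_polys \<mu> k"
    unfolding R_def[abs_def] by (rule disk_orth_polys_sum[OF \<mu> b])
  \<comment> \<open>The difference R - Q as a two-term linear combination, so that
    \<open>disk_orth_polys_sum\<close> covers it.\<close>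
  have "(\<lambda>v. \<Sum>t\<in>{True, False}. (if t then 1 else -1) * (if t then R else Q) v) \<in> disk_orth_polys \<mu> k"
    by (rule disk_orth_polys_sum[OF \<mu>]) (use R Q in auto)
  then have D: "(\<lambda>v. R v - Q v) \<in> disk_orth_polys \<mu> k" by simp
  have "R (cos \<xi>, sin \<xi>) = Q (cos \<xi>, sin \<xi>)" for \<xi>
  proof -
    have "R (cos \<xi>, sin \<xi>) = disk_inner \<mu> (\<lambda>v. \<Sum>i\<in>disk_basis_index k. b i (cos \<xi>, sin \<xi>) * b i v) Q"
      unfolding R_def by (subst disk_inner_sum[OF \<mu> bb Qb]) (auto simp: mult.commute)
    also have "(\<lambda>v. \<Sum>i\<in>disk_basis_index k. b i (cos \<xi>, sin \<xi>) * b i v) = ridge_poly \<mu> k \<xi>"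
      using disk_basis_addition_formula[OF \<mu>, of k _ \<xi>]
      by (simp add: b_def split_beta mult.commute fun_eq_iff)
    also have "disk_inner \<mu> (ridge_poly \<mu> k \<xi>) Q = Q (cos \<xi>, sin \<xi>)"
      by (rule ridge_poly_reproducing[OF \<mu> Q])
    finally show ?thesis .
  qed
  then have "R x - Q x = 0"
    using disk_orth_vanishing_on_circle[OF \<mu> D, of x] by simp
  then show ?thesis by (simp add: R_def b_def)
qed

text \<open>As a function of v the left side lies in the space spanned by P. Its coefficient at P j
  is an inner product, which \<open>disk_basis_expansion\<close> evaluates to P j x.\<close>

lemma reproducing_kernel_eq:
  assumes \<mu>: "\<mu> \<ge> 0" and P: "disk_orthonormal_basis \<mu> k P"
  shows "(\<Sum>i\<in>disk_basis_index k. disk_basis \<mu> k (fst i) (snd i) v * disk_basis \<mu> k (fst i) (snd i) x) = (\<Sum>j\<le>k. P j v * P j x)"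
proof -
  define b where "b i = disk_basis \<mu> k (fst i) (snd i)" for i
  have b: "b i \<in> disk_orth_polys \<mu> k" if "i \<in> disk_basis_index k" for i
    using that unfolding b_def by (intro disk_basis_orth[OF \<mu>]) (auto simp: disk_basis_index_def)
  have PV: "P j \<in> disk_orth_polys \<mu> k" if "j \<le> k" for j
    using P that by (simp add: disk_orthonormal_basis_def)
  have bb: "b i \<in> bipolys k" if "i \<in> disk_basis_index k" for i
    using b[OF that] by (simp add: disk_orth_polys_iff[OF \<mu>])
  have Pb: "P j \<in> bipolys k" if "j \<le> k" for j
    using PV[OF that] by (simp add: disk_orth_polys_iff[OF \<mu>])
  define K where "K = (\<lambda>v. \<Sum>i\<in>disk_basis_index k. b i x * b i v)"
  have "K \<in> disk_orth_polys \<mu> k"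
    unfolding K_def by (rule disk_orth_polys_sum[OF \<mu> b])
  then obtain c where c: "K = (\<lambda>v. \<Sum>j\<le>k. c j * P j v)"
    using P unfolding disk_orthonormal_basis_def by blast
  have "c j = P j x" if j: "j \<le> k" for j
  proof -
    have "c j = (\<Sum>i\<le>k. c i * disk_inner \<mu> (P i) (P j))"
      using P j by (simp add: disk_orthonormal_basis_def if_distrib[of "(*) _"] cong: if_cong)
    also have "\<dots> = disk_inner \<mu> K (P j)"
      unfolding c by (rule disk_inner_sum[OF \<mu> Pb Pb[OF j], symmetric]) simp
    also have "\<dots> = (\<Sum>i\<in>disk_basis_index k. b i x * disk_inner \<mu> (b i) (P j))"
      unfolding K_def by (rule disk_inner_sum[OF \<mu> bb Pb[OF j]])
    also have "\<dots> = P j x"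
      using disk_basis_expansion[OF \<mu> PV[OF j], of x] by (simp add: b_def mult.commute)
    finally show ?thesis .
  qed
  then have "K v = (\<Sum>j\<le>k. P j v * P j x)"
    unfolding c by (intro sum.cong) auto
  then show ?thesis by (simp add: K_def b_def mult.commute)
qed

lemma discrete_ridge_kernel:
  assumes \<mu>: "\<mu> \<ge> 0" and k: "k \<le> 2 * m" and P: "disk_orthonormal_basis \<mu> k P"
  shows "1 / (2 * real m + 1) * (\<Sum>\<nu>=0..2*m. ridge_poly \<mu> k (equi_angle m \<nu>) v * D_angle \<mu> k (equi_angle m \<nu>) x)
    = (\<Sum>j\<le>k. P j v * P j x)"
proof -
  define b where "b i = disk_basis \<mu> k (fst i) (snd i)" for i
  define e where "e \<nu> = (cos (equi_angle m \<nu>), sin (equi_angle m \<nu>))" for \<nu>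
  have "1 / (2 * real m + 1) * (\<Sum>\<nu>=0..2*m. ridge_poly \<mu> k (equi_angle m \<nu>) v * D_angle \<mu> k (equi_angle m \<nu>) x) =
    (\<Sum>\<nu>=0..2*m. \<Sum>i\<in>disk_basis_index k. ridge_factor \<mu> (fst i) k * (1 / (2 * real m + 1)) *
       (ridge_poly \<mu> k (equi_angle m \<nu>) v * b i (e \<nu>)) * b i x)"
    unfolding D_angle_def b_def e_def by (simp add: sum_distrib_left split_beta mult_ac)
  also have "\<dots> = (\<Sum>i\<in>disk_basis_index k. (ridge_factor \<mu> (fst i) k * (1 / (2 * real m + 1)) *
       (\<Sum>\<nu>=0..2*m. ridge_poly \<mu> k (equi_angle m \<nu>) v * b i (e \<nu>))) * b i x)"
    by (subst sum.swap) (simp add: sum_distrib_left sum_distrib_right)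
  also have "\<dots> = (\<Sum>i\<in>disk_basis_index k. b i v * b i x)"
  proof (rule sum.cong[OF refl])
    fix i assume "i \<in> disk_basis_index k"
    then have "2 * fst i \<le> k" by (auto simp: disk_basis_index_def)
    then show "ridge_factor \<mu> (fst i) k * (1 / (2 * real m + 1)) *
       (\<Sum>\<nu>=0..2*m. ridge_poly \<mu> k (equi_angle m \<nu>) v * b i (e \<nu>)) * b i x = b i v * b i x"
      unfolding b_def e_def by (subst disk_basis_eq_ridge_sum[OF \<mu> _ k]) auto
  qed
  also have "\<dots> = (\<Sum>j\<le>k. P j v * P j x)"
    unfolding b_def by (rule reproducing_kernel_eq[OF \<mu> P])
  finally show ?thesis .
qed

section \<open>Integration over the cylinder\<close>

lemma cylinder_weight_integrable:
  assumes \<mu>: "\<mu> \<ge> 0" and W: "weight_function_on 0 L W"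
  shows "set_integrable lebesgue (cylinder L) (cylinder_weight \<mu> W)"
proof -
  have "integrable lebesgue (\<lambda>z. indicator {0..L} z *\<^sub>R (z ^ 0 * W z))"
    using W unfolding weight_function_on_def set_integrable_def by blast
  then have "integrable lebesgue (\<lambda>u. (indicator (cball 0 1) (fst u) *\<^sub>R disk_weight \<mu> (fst u)) *
      (indicator {0..L} (snd u) *\<^sub>R (snd u ^ 0 * W (snd u))))"
    using disk_weight_integrable[OF \<mu>]
    by (intro lebesgue_integrable_times) (simp_all add: set_integrable_def)
  then show ?thesis
    unfolding set_integrable_def
    by (rule back_subst[of "integrable lebesgue"])
      (auto simp: cylinder_def cylinder_weight_def indicator_def fun_eq_iff)
qed

lemma compact_cylinder: "compact (cylinder L)"
  unfolding cylinder_def by (intro compact_Times) auto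

text \<open>Since |f| \<le> f^2 + 1 and the weight has finite mass, f is integrable against the
  weight; a continuous factor is bounded on the compact cylinder.\<close>

lemma cylinder_L2_integrable:
  assumes \<mu>: "\<mu> \<ge> 0" and W: "weight_function_on 0 L W" and f: "f \<in> cylinder_L2 \<mu> L W"
    and \<psi>: "continuous_on (cylinder L) \<psi>"
  shows "set_integrable lebesgue (cylinder L) (\<lambda>u. f u * \<psi> u * cylinder_weight \<mu> W u)"
proof -
  let ?w = "cylinder_weight \<mu> W"
  note w = cylinder_weight_integrable[OF \<mu> W]
  have w_nonneg: "?w u \<ge> 0" if "u \<in> cylinder L" for u
    using that W by (cases u) (auto simp: cylinder_weight_def cylinder_def weight_function_on_def disk_weight_norm)
  have C: "cylinder L \<in> sets lebesgue"
    using compact_cylinder by (simp add: compact_imp_closed)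
  have fm: "f \<in> borel_measurable (lebesgue_on (cylinder L))"
    and f2: "set_integrable lebesgue (cylinder L) (\<lambda>u. (f u)\<^sup>2 * ?w u)"
    using f by (auto simp: cylinder_L2_def)
  have "(\<lambda>u. indicator (cylinder L) u *\<^sub>R f u) \<in> borel_measurable lebesgue"
    using fm C by (simp add: borel_measurable_restrict_space_iff)
  moreover have "(\<lambda>u. indicator (cylinder L) u *\<^sub>R ?w u) \<in> borel_measurable lebesgue"
    using w unfolding set_integrable_def by (rule borel_measurable_integrable)
  ultimately have "(\<lambda>u. (indicator (cylinder L) u *\<^sub>R f u) * (indicator (cylinder L) u *\<^sub>R ?w u)) \<in> borel_measurable lebesgue"
    by (rule borel_measurable_times)
  also have "(\<lambda>u. (indicator (cylinder L) u *\<^sub>R f u) * (indicator (cylinder L) u *\<^sub>R ?w u)) =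
      (\<lambda>u. indicator (cylinder L) u *\<^sub>R (f u * ?w u))"
    by (auto simp: indicator_def fun_eq_iff)
  finally have meas: "(\<lambda>u. indicator (cylinder L) u *\<^sub>R (f u * ?w u)) \<in> borel_measurable lebesgue" .
  have "set_integrable lebesgue (cylinder L) (\<lambda>u. (f u)\<^sup>2 * ?w u + ?w u)"
    using f2 w by (rule set_integral_add)
  then have "set_integrable lebesgue (cylinder L) (\<lambda>u. f u * ?w u)"
    unfolding set_integrable_def
  proof (rule Bochner_Integration.integrable_bound[OF _ meas], intro AE_I2)
    fix u
    have "\<bar>f u\<bar> * 1 \<le> (f u)\<^sup>2 + 1"
      using sum_squares_bound[of "\<bar>f u\<bar>" 1] by simp
    then have "\<bar>f u\<bar> * ?w u \<le> ((f u)\<^sup>2 + 1) * ?w u" if "u \<in> cylinder L"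
      using w_nonneg[OF that] by (intro mult_right_mono) auto
    then show "norm (indicator (cylinder L) u *\<^sub>R (f u * ?w u)) \<le> norm (indicator (cylinder L) u *\<^sub>R ((f u)\<^sup>2 * ?w u + ?w u))"
      using w_nonneg[of u] by (auto simp: indicator_def abs_mult algebra_simps)
  qed
  then have "set_integrable lebesgue (cylinder L) (\<lambda>u. \<psi> u * (f u * ?w u))"
    by (rule set_integrable_continuous_mult[OF _ \<psi> compact_cylinder])
  then show ?thesis by (simp add: mult_ac)
qed

text \<open>The kernel as a function on the cylinder, with t the component of the disk point along
  e_\<xi> and w the height.\<close>

definition ridge_phi :: "real \<Rightarrow> real \<Rightarrow> (real \<Rightarrow> real) \<Rightarrow> nat \<Rightarrow> real \<Rightarrow> (real \<times> real) \<times> real \<Rightarrow> (real \<times> real) \<times> real \<Rightarrow> real" where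
  "ridge_phi \<mu> L W n \<xi> x u = Phi_kernel \<mu> L W n \<xi> (snd u) (fst (fst u) * cos \<xi> + snd (fst u) * sin \<xi>) x"

lemma ridge_phi_eq:
  "ridge_phi \<mu> L W n \<xi> x u = (\<Sum>k=0..n. ridge_poly \<mu> k \<xi> (fst u) * D_angle \<mu> k \<xi> (fst x) *
    (\<Sum>l=0..n - k. poly (orthonormal_polys 0 L W l) (snd u) * poly (orthonormal_polys 0 L W l) (snd x)))"
  by (simp add: ridge_phi_def Phi_kernel_def D_kernel_def ridge_poly_def split_beta)

lemma ridge_phi_continuous: "continuous_on S (ridge_phi \<mu> L W n \<xi> x)"
  unfolding ridge_phi_eq[abs_def] ridge_poly_def by (intro continuous_intros)

text \<open>In coordinates rotated by \<xi> the ridge argument is t itself, so only f and the disk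
  weight depend on s, and their integral over s is the Radon projection.\<close>

lemma radon_integral_eq:
  assumes \<mu>: "\<mu> \<ge> 0" and W: "weight_function_on 0 L W" and f: "f \<in> cylinder_L2 \<mu> L W"
  shows "(LINT t:{-1..1}|lebesgue. LINT w:{0..L}|lebesgue.
      radon \<mu> \<xi> (\<lambda>v. f (v, w)) t * Phi_kernel \<mu> L W n \<xi> w t x * W w) =
    (LINT u:cylinder L|lebesgue. f u * ridge_phi \<mu> L W n \<xi> x u * cylinder_weight \<mu> W u)"
proof -
  define F where "F u = indicator (cylinder L) u * (f u * ridge_phi \<mu> L W n \<xi> x u * cylinder_weight \<mu> W u)" for u
  have "set_integrable lebesgue (cylinder L) (\<lambda>u. f u * ridge_phi \<mu> L W n \<xi> x u * cylinder_weight \<mu> W u)"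
    by (rule cylinder_L2_integrable[OF \<mu> W f ridge_phi_continuous])
  then have F: "integrable lebesgue F"
    by (simp add: set_integrable_def F_def[abs_def])
  have ind: "indicator (cylinder L) (plane_rotation \<xi> (t, s), w) =
      (indicator {-1..1} t * indicator {- sqrt (1 - t\<^sup>2)..sqrt (1 - t\<^sup>2)} s * indicator {0..L} w :: real)" for t s w
    unfolding cylinder_def indicator_times indicator_disk_rotation fst_conv snd_conv ..
  have F_eq: "F (plane_rotation \<xi> (t, s), w) = indicator {-1..1} t * (indicator {0..L} w *
      (indicator {- sqrt (1 - t\<^sup>2)..sqrt (1 - t\<^sup>2)} s * (f (plane_rotation \<xi> (t, s), w) * (1 - s\<^sup>2 - t\<^sup>2) powr (\<mu> - 1/2)) *
        Phi_kernel \<mu> L W n \<xi> w t x * W w))" for t s w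
    unfolding F_def ind ridge_phi_def fst_conv snd_conv ridge_rotation cylinder_weight_def prod.case disk_weight_rotation
    by (simp add: mult_ac)
  have radon: "radon \<mu> \<xi> (\<lambda>v. f (v, w)) t =
      (\<integral>s. indicator {- sqrt (1 - t\<^sup>2)..sqrt (1 - t\<^sup>2)} s * (f (plane_rotation \<xi> (t, s), w) * (1 - s\<^sup>2 - t\<^sup>2) powr (\<mu> - 1/2)) \<partial>lebesgue)" for t w
    by (simp add: radon_def set_lebesgue_integral_def plane_rotation_def)
  have "integral\<^sup>L lebesgue F = (\<integral>t. \<integral>w. \<integral>s. F (plane_rotation \<xi> (t, s), w) \<partial>lebesgue \<partial>lebesgue \<partial>lebesgue)"
    by (rule lebesgue_integral_rotated_cylinder[OF F])
  also have "\<dots> = (\<integral>t. indicator {-1..1} t * (\<integral>w. indicator {0..L} w *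
     (radon \<mu> \<xi> (\<lambda>v. f (v, w)) t * Phi_kernel \<mu> L W n \<xi> w t x * W w) \<partial>lebesgue) \<partial>lebesgue)"
    \<comment> \<open>Constant factors leave the integral even where a slice fails to be integrable,
      since both sides then have the default value 0; the rewriting holds for every t and w.\<close>
    unfolding F_eq radon integral_mult_right_zero integral_mult_left_zero ..
  finally show ?thesis
    by (simp add: set_lebesgue_integral_def F_def[abs_def])
qed

text \<open>Reindexes by the degree in the disk variables and the degree l - k in z, the grouping
  used in \<open>Phi_kernel\<close>.\<close>

lemma sum_triangle_swap:
  fixes A :: "nat \<Rightarrow> nat \<Rightarrow> real"
  shows "(\<Sum>l=0..n. \<Sum>k=0..l. A k (l - k)) = (\<Sum>k=0..n. \<Sum>l=0..n - k. A k l)"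
proof -
  have "(\<Sum>l=0..n. \<Sum>k=0..l. A k (l - k)) = (\<Sum>(l, k)\<in>(SIGMA l:{0..n}. {0..l}). A k (l - k))"
    by (simp add: sum.Sigma)
  also have "\<dots> = (\<Sum>(k, l)\<in>(SIGMA k:{0..n}. {0..n - k}). A k l)"
    by (rule sum.reindex_bij_witness[of _ "\<lambda>(k, l). (k + l, k)" "\<lambda>(l, k). (k, l - k)"]) auto
  also have "\<dots> = (\<Sum>k=0..n. \<Sum>l=0..n - k. A k l)"
    by (simp add: sum.Sigma)
  finally show ?thesis .
qed

lemma partial_sum_eq_integral:
  assumes \<mu>: "\<mu> \<ge> 0" and W: "weight_function_on 0 L W" and f: "f \<in> cylinder_L2 \<mu> L W"
    and P: "\<And>k. disk_orthonormal_basis \<mu> k (P k)"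
  shows "partial_sum \<mu> L W P n f x = disk_const \<mu> * (LINT u:cylinder L|lebesgue. f u *
    (\<Sum>k=0..n. (\<Sum>j\<le>k. P k j (fst u) * P k j (fst x)) *
      (\<Sum>l=0..n - k. poly (orthonormal_polys 0 L W l) (snd u) * poly (orthonormal_polys 0 L W l) (snd x))) * cylinder_weight \<mu> W u)"
proof -
  let ?c = "\<lambda>l k j. cylinder_poly L W P l k j" and ?w = "cylinder_weight \<mu> W"
  have Pc: "continuous_on S (P k j)" if "j \<le> k" for S k j
  proof -
    have "P k j \<in> bipolys k"
      using P[of k] that by (auto simp: disk_orthonormal_basis_def disk_orth_polys_iff[OF \<mu>])
    then show ?thesis by (rule bipolys_continuous)
  qed
  have c: "continuous_on S (?c l k j)" if "j \<le> k" for S l k j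
    unfolding cylinder_poly_def split_beta
    by (intro continuous_intros continuous_on_compose2[OF Pc[OF that, of UNIV]]) auto
  have I: "set_integrable lebesgue (cylinder L) (\<lambda>u. f u * ?c l k j u * ?w u * ?c l k j x)" if "j \<in> {0..k}" for l k j
    using that by (intro set_integrable_mult_left cylinder_L2_integrable[OF \<mu> W f] c) auto
  have "partial_sum \<mu> L W P n f x = disk_const \<mu> * (\<Sum>l=0..n. \<Sum>k=0..l. \<Sum>j=0..k.
      LINT u:cylinder L|lebesgue. f u * ?c l k j u * ?w u * ?c l k j x)"
    unfolding partial_sum_def cylinder_coeff_def set_integral_mult_left sum_distrib_left
    by (simp only: mult.assoc)
  also have "(\<Sum>l=0..n. \<Sum>k=0..l. \<Sum>j=0..k. LINT u:cylinder L|lebesgue. f u * ?c l k j u * ?w u * ?c l k j x)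
      = (LINT u:cylinder L|lebesgue. (\<Sum>l=0..n. \<Sum>k=0..l. \<Sum>j=0..k. f u * ?c l k j u * ?w u * ?c l k j x))"
    by (simp only: set_lebesgue_integral_sum I)
  also have "\<dots> = (LINT u:cylinder L|lebesgue. f u *
    (\<Sum>k=0..n. (\<Sum>j\<le>k. P k j (fst u) * P k j (fst x)) *
      (\<Sum>l=0..n - k. poly (orthonormal_polys 0 L W l) (snd u) * poly (orthonormal_polys 0 L W l) (snd x))) * ?w u)"
  proof (rule arg_cong[where f="\<lambda>g. LINT u:cylinder L|lebesgue. g u"], rule ext)
    fix u
    define p where "p l z = poly (orthonormal_polys 0 L W l) z" for l z
    define A where "A k l = (\<Sum>j\<le>k. P k j (fst u) * P k j (fst x)) * (p l (snd u) * p l (snd x))" for k l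
    have "(\<Sum>l=0..n. \<Sum>k=0..l. \<Sum>j=0..k. f u * ?c l k j u * ?w u * ?c l k j x)
      = f u * ?w u * (\<Sum>l=0..n. \<Sum>k=0..l. A k (l - k))"
      by (simp add: A_def p_def cylinder_poly_def split_beta sum_distrib_left sum_distrib_right atMost_atLeast0 mult_ac)
    also have "(\<Sum>l=0..n. \<Sum>k=0..l. A k (l - k)) =
        (\<Sum>k=0..n. (\<Sum>j\<le>k. P k j (fst u) * P k j (fst x)) * (\<Sum>l=0..n - k. p l (snd u) * p l (snd x)))"
      unfolding sum_triangle_swap by (simp only: A_def[abs_def] sum_distrib_left)
    finally show "(\<Sum>l=0..n. \<Sum>k=0..l. \<Sum>j=0..k. f u * ?c l k j u * ?w u * ?c l k j x) =
       f u * (\<Sum>k=0..n. (\<Sum>j\<le>k. P k j (fst u) * P k j (fst x)) *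
      (\<Sum>l=0..n - k. poly (orthonormal_polys 0 L W l) (snd u) * poly (orthonormal_polys 0 L W l) (snd x))) * ?w u"
      by (simp add: p_def mult_ac)
  qed
  finally show ?thesis .
qed

theorem proposition5p3:
  fixes \<mu> L :: real
    and W :: "real \<Rightarrow> real"
    and m :: nat
    and P :: "nat \<Rightarrow> nat \<Rightarrow> real \<times> real \<Rightarrow> real"
    and f :: "(real \<times> real) \<times> real \<Rightarrow> real"
    and x1 x2 x3 :: real
    and \<phi> :: "nat \<Rightarrow> real"
  assumes "\<mu> \<ge> 0" and "L > 0"
    and "weight_function_on 0 L W"
    and "\<forall>k. disk_orthonormal_basis \<mu> k (P k)"
    and "\<forall>\<nu>\<le>2 * m. \<phi> \<nu> = 2 * real \<nu> * pi / (2 * real m + 1)"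
    and "f \<in> cylinder_L2 \<mu> L W"
    and "((x1, x2), x3) \<in> cylinder L"
  shows "partial_sum \<mu> L W P (2 * m) f ((x1, x2), x3) =
    1 / (2 * real m + 1) *
      (\<Sum>\<nu>=0..2 * m. disk_const \<mu> *
        (LINT t:{-1..1}|lebesgue. LINT w:{0..L}|lebesgue.
           radon \<mu> (\<phi> \<nu>) (\<lambda>v. f (v, w)) t *
           Phi_kernel \<mu> L W (2 * m) (\<phi> \<nu>) w t ((x1, x2), x3) * W w))"
proof -
  define x where "x = ((x1, x2), x3)"
  let ?w = "cylinder_weight \<mu> W"
  let ?\<Phi> = "\<lambda>\<nu> u. ridge_phi \<mu> L W (2 * m) (equi_angle m \<nu>) x u"
  note \<mu> = assms(1) and W = assms(3) and f = assms(6)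
  define pp where "pp k u = (\<Sum>l=0..2 * m - k. poly (orthonormal_polys 0 L W l) (snd u) * poly (orthonormal_polys 0 L W l) (snd x))"
    for k and u :: "(real \<times> real) \<times> real"
  \<comment> \<open>Pointwise in u, the average of the ridge kernels is the kernel of the partial
    sum. The discrete formula applies to every summand because k \<le> 2 * m.\<close>
  have kernel: "1 / (2 * real m + 1) * (\<Sum>\<nu>=0..2 * m. ?\<Phi> \<nu> u) =
      (\<Sum>k=0..2 * m. (\<Sum>j\<le>k. P k j (fst u) * P k j (fst x)) * pp k u)" for u
  proof -
    have "1 / (2 * real m + 1) * (\<Sum>\<nu>=0..2 * m. ?\<Phi> \<nu> u) =
      (\<Sum>k=0..2 * m. (1 / (2 * real m + 1) * (\<Sum>\<nu>=0..2 * m. ridge_poly \<mu> k (equi_angle m \<nu>) (fst u) *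
        D_angle \<mu> k (equi_angle m \<nu>) (fst x))) * pp k u)"
      unfolding ridge_phi_eq pp_def[symmetric]
      by (subst sum.swap) (simp add: sum_distrib_left sum_distrib_right mult.assoc)
    also have "\<dots> = (\<Sum>k=0..2 * m. (\<Sum>j\<le>k. P k j (fst u) * P k j (fst x)) * pp k u)"
      using assms(4) by (intro sum.cong refl) (subst discrete_ridge_kernel[OF \<mu>], auto)
    finally show ?thesis .
  qed
  have I: "set_integrable lebesgue (cylinder L) (\<lambda>u. 1 / (2 * real m + 1) * (f u * ?\<Phi> \<nu> u * ?w u))" for \<nu>
    by (intro set_integrable_mult_right cylinder_L2_integrable[OF \<mu> W f] ridge_phi_continuous)
  have "1 / (2 * real m + 1) * (\<Sum>\<nu>=0..2 * m. disk_const \<mu> *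
        (LINT t:{-1..1}|lebesgue. LINT w:{0..L}|lebesgue.
           radon \<mu> (\<phi> \<nu>) (\<lambda>v. f (v, w)) t * Phi_kernel \<mu> L W (2 * m) (\<phi> \<nu>) w t x * W w)) =
     1 / (2 * real m + 1) * (\<Sum>\<nu>=0..2 * m. disk_const \<mu> * (LINT u:cylinder L|lebesgue. f u * ?\<Phi> \<nu> u * ?w u))"
    using assms(5) by (simp add: radon_integral_eq[OF \<mu> W f] equi_angle_def)
  also have "\<dots> = disk_const \<mu> * (\<Sum>\<nu>=0..2 * m. LINT u:cylinder L|lebesgue. 1 / (2 * real m + 1) * (f u * ?\<Phi> \<nu> u * ?w u))"
    unfolding set_integral_mult_right sum_distrib_left by (simp only: mult.left_commute)
  also have "(\<Sum>\<nu>=0..2 * m. LINT u:cylinder L|lebesgue. 1 / (2 * real m + 1) * (f u * ?\<Phi> \<nu> u * ?w u)) =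
      (LINT u:cylinder L|lebesgue. (\<Sum>\<nu>=0..2 * m. 1 / (2 * real m + 1) * (f u * ?\<Phi> \<nu> u * ?w u)))"
    by (rule set_lebesgue_integral_sum(2)[OF I, symmetric])
  also have "\<dots> = (LINT u:cylinder L|lebesgue. f u * (1 / (2 * real m + 1) * (\<Sum>\<nu>=0..2 * m. ?\<Phi> \<nu> u)) * ?w u)"
    by (simp add: sum_distrib_left sum_distrib_right sum_divide_distrib mult_ac)
  also have "disk_const \<mu> * \<dots> = partial_sum \<mu> L W P (2 * m) f x"
    unfolding kernel pp_def using assms(4) by (subst partial_sum_eq_integral[OF \<mu> W f]) auto
  finally show ?thesis unfolding x_def ..
qed

end
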